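(* Let $m\ge1$ be an integer, $m-1<\mu<m$, $\rho>0$, $\gamma,\omega\in\mathbb C$, $R=\mathcal E_{\rho,\mu,\omega}^{\gamma}$, and put $\delta=m-\mu\in(0,1)$. If $v\in\mathrm{AC}[0,T]$, then $Rv\in\mathrm{AC}_0^m[0,T]$. More precisely, define $$w(t)=v(0)\,r_{\rho,1-\delta,\omega}^{\gamma}(t)+\bigl(\mathcal E_{\rho,1-\delta,\omega}^{\gamma}v'\bigr)(t).$$ Then $w\in L^1(0,T)$ and $$v=\mathcal E_{\rho,\delta,\omega}^{-\gamma}w\qquad\text{a.e. on }(0,T).$$ Consequently, the range condition (RC) on a density $v\in C[0,T]$, namely (RC) $v=\mathcal E_{\rho,m-\mu,\omega}^{-\gamma}w$ a.e. on $(0,T)$ for some $w\in L^1(0,T)$ (a condition equivalent to $Rv\in\mathrm{AC}_0^m[0,T]$), is automatic for absolutely continuous causal densities $v$, although it is not automatic for the continuous densities produced by the general resolvent theorem (described in the context).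
   Context: Fix $T>0$; functions are complex-valued. For $\rho,\mu>0$ and $\gamma,z\in\mathbb C$, $E_{\rho,\mu}^{\gamma}(z)=\sum_{n\ge0}\frac{(\gamma)_n}{n!\,\Gamma(\rho n+\mu)}z^n$ is the three-parameter Mittag--Leffler function, with $(\gamma)_n$ the Pochhammer symbol. The Prabhakar kernel is $r_{\rho,\mu,\omega}^{\gamma}(t)=t^{\mu-1}E_{\rho,\mu}^{\gamma}(\omega t^\rho)$, and the Prabhakar integral is $(\mathcal E_{\rho,\mu,\omega}^{\gamma}f)(t)=\int_0^tr_{\rho,\mu,\omega}^{\gamma}(t-s)f(s)\,ds$ for $f\in L^1(0,T)$. $\mathrm{AC}[0,T]$ is the space of absolutely continuous functions; $\mathrm{AC}^m[0,T]=\{u\in C^{m-1}[0,T]:u^{(m-1)}\in\mathrm{AC}[0,T]\}$; $\mathrm{AC}_0^m[0,T]=\{y\in\mathrm{AC}^m[0,T]:y^{(k)}(0)=0,\ 0\le k<m\}$. For a convolution kernel $q\in L^1(0,T)$ write $(V_qf)(t)=\int_0^tq(t-s)f(s)\,ds$, and for a two-variable kernel $G$ write $(V_Gf)(t)=\int_0^tG(t,s)f(s)\,ds$. The general resolvent theorem is the following. Let $R=V_r$ be an injective convolution operator on $C[0,T]$ with $r\in L^1(0,T)$ and $|r(t)|\le C_0t^{\eta_0-1}$ a.e. for some $C_0,\eta_0>0$ (the Prabhakar integral above is such an operator), let $A=R^{-1}$ on the natural range $R(C[0,T])$, let $B_1,\dots,B_N$ be linear operators on $R(C[0,T])$ with $B_jR=V_{q_j}$,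 $q_j\in L^1(0,T)$, $|q_j(t)|\le C_jt^{\eta_j-1}$ a.e., $\eta_j>0$, let $p_j\in C[0,T]$, and let $K$ be continuous on $\{(t,s):0\le s\le t\le T\}$. Then for every $f\in C[0,T]$ the equation $Au+\sum_{j=1}^Np_jB_ju+V_Ku=f$ has a unique solution $u\in R(C[0,T])$, namely $u=Rv$ with the continuous causal density $v=(I-V_{R_L})f\in C[0,T]$. Here $G_L(t,s)=\sum_{j=1}^Np_j(t)q_j(t-s)+\int_s^tK(t,\xi)r(\xi-s)\,d\xi$, and $R_L=\sum_{n\ge1}(-1)^{n-1}G_n$ with $G_1=G_L$, $G_{n+1}(t,s)=\int_s^tG_L(t,\xi)G_n(\xi,s)\,d\xi$, so that $(I+V_{G_L})^{-1}=I-V_{R_L}$ on $C[0,T]$. *)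

theory Defs
  imports "HOL-Analysis.Analysis"
begin

(* Functions on [0,T] are represented by total functions on the reals; values outside [0,T]
   are never used.  L^1(0,T) is represented by Lebesgue-integrable functions, so identities in
   L^1 are stated almost everywhere. *)

definition L1 :: "real \<Rightarrow> (real \<Rightarrow> complex) set" where
  "L1 T = {f. f absolutely_integrable_on {0<..<T}}"

definition conv_op :: "(real \<Rightarrow> complex) \<Rightarrow> (real \<Rightarrow> complex) \<Rightarrow> real \<Rightarrow> complex" where
  "conv_op q f t = (LINT s:{0..t}|lebesgue. q (t - s) * f s)"

definition kernel_op :: "(real \<Rightarrow> real \<Rightarrow> complex) \<Rightarrow> (real \<Rightarrow> complex) \<Rightarrow> real \<Rightarrow> complex" where
  "kernel_op G f t = (LINT s:{0..t}|lebesgue. G t s * f s)"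

definition mittag_leffler3 :: "real \<Rightarrow> real \<Rightarrow> complex \<Rightarrow> complex \<Rightarrow> complex" where
  "mittag_leffler3 \<rho> \<mu> \<gamma> z =
     (\<Sum>n. pochhammer \<gamma> n / (fact n * Gamma (of_real (\<rho> * real n + \<mu>))) * z ^ n)"

definition prabhakar_kernel :: "real \<Rightarrow> real \<Rightarrow> complex \<Rightarrow> complex \<Rightarrow> real \<Rightarrow> complex" where
  "prabhakar_kernel \<rho> \<mu> \<omega> \<gamma> t =
     of_real (t powr (\<mu> - 1)) * mittag_leffler3 \<rho> \<mu> \<gamma> (\<omega> * of_real (t powr \<rho>))"

definition prabhakar_integral ::
  "real \<Rightarrow> real \<Rightarrow> complex \<Rightarrow> complex \<Rightarrow> (real \<Rightarrow> complex) \<Rightarrow> real \<Rightarrow> complex" where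
  "prabhakar_integral \<rho> \<mu> \<omega> \<gamma> f = conv_op (prabhakar_kernel \<rho> \<mu> \<omega> \<gamma>) f"

definition AC :: "real \<Rightarrow> (real \<Rightarrow> complex) set" where
  "AC T = {f. \<forall>\<epsilon>>0. \<exists>d>0. \<forall>(n::nat) a b.
      (\<forall>i<n. 0 \<le> a i \<and> a i \<le> b i \<and> b i \<le> T) \<and>
      (\<forall>i<n. \<forall>j<n. i \<noteq> j \<longrightarrow> {a i<..<b i} \<inter> {a j<..<b j} = {}) \<and>
      (\<Sum>i<n. b i - a i) < d
      \<longrightarrow> (\<Sum>i<n. cmod (f (b i) - f (a i))) < \<epsilon>}"

(* k-th derivative on [0,T], one-sided at the endpoints *)
definition deriv_on :: "real \<Rightarrow> nat \<Rightarrow> (real \<Rightarrow> complex) \<Rightarrow> real \<Rightarrow> complex" where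
  "deriv_on T k u = ((\<lambda>g t. vector_derivative g (at t within {0..T})) ^^ k) u"

definition Cspace :: "real \<Rightarrow> nat \<Rightarrow> (real \<Rightarrow> complex) set" where
  "Cspace T k = {u. (\<forall>j<k. \<forall>t\<in>{0..T}. deriv_on T j u differentiable (at t within {0..T})) \<and>
                    continuous_on {0..T} (deriv_on T k u)}"

definition ACm :: "real \<Rightarrow> nat \<Rightarrow> (real \<Rightarrow> complex) set" where
  "ACm T m = {u \<in> Cspace T (m - 1). deriv_on T (m - 1) u \<in> AC T}"

definition AC0 :: "real \<Rightarrow> nat \<Rightarrow> (real \<Rightarrow> complex) set" where
  "AC0 T m = {y \<in> ACm T m. \<forall>k<m. deriv_on T k y 0 = 0}"

definition range_condition ::
  "real \<Rightarrow> nat \<Rightarrow> real \<Rightarrow> real \<Rightarrow> complex \<Rightarrow> complex \<Rightarrow> (real \<Rightarrow> complex) \<Rightarrow> bool" where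
  "range_condition T m \<rho> \<mu> \<omega> \<gamma> v \<longleftrightarrow>
     (\<exists>w\<in>L1 T. AE t in lebesgue. t \<in> {0<..<T} \<longrightarrow>
        v t = prabhakar_integral \<rho> (real m - \<mu>) \<omega> (- \<gamma>) w t)"

definition weakly_singular :: "real \<Rightarrow> (real \<Rightarrow> complex) \<Rightarrow> bool" where
  "weakly_singular T q \<longleftrightarrow> q \<in> L1 T \<and>
     (\<exists>C>0. \<exists>\<eta>>0. AE t in lebesgue. t \<in> {0<..<T} \<longrightarrow> cmod (q t) \<le> C * t powr (\<eta> - 1))"

definition conv_range :: "real \<Rightarrow> (real \<Rightarrow> complex) \<Rightarrow> (real \<Rightarrow> complex) set" where
  "conv_range T r = {u. \<exists>v. continuous_on {0..T} v \<and> (\<forall>t\<in>{0..T}. u t = conv_op r v t)}"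

definition linear_on_range :: "real \<Rightarrow> (real \<Rightarrow> complex) \<Rightarrow> ((real \<Rightarrow> complex) \<Rightarrow> real \<Rightarrow> complex) \<Rightarrow> bool" where
  "linear_on_range T r B \<longleftrightarrow>
     (\<forall>x\<in>conv_range T r. \<forall>y\<in>conv_range T r. \<forall>a b. \<forall>t\<in>{0..T}.
        B (\<lambda>s. a * x s + b * y s) t = a * B x t + b * B y t)"

(* The condition B R = V_q is required for every representative u of R v on [0,T], so that B
   acts on functions on [0,T]. *)
definition resolvent_setting ::
  "real \<Rightarrow> (real \<Rightarrow> complex) \<Rightarrow> nat \<Rightarrow> (nat \<Rightarrow> real \<Rightarrow> complex) \<Rightarrow>
   (nat \<Rightarrow> (real \<Rightarrow> complex) \<Rightarrow> real \<Rightarrow> complex) \<Rightarrow> (nat \<Rightarrow> real \<Rightarrow> complex) \<Rightarrow>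
   (real \<Rightarrow> real \<Rightarrow> complex) \<Rightarrow> bool" where
  "resolvent_setting T r N p B q K \<longleftrightarrow>
     weakly_singular T r \<and>
     (\<forall>x y. continuous_on {0..T} x \<and> continuous_on {0..T} y \<and>
        (\<forall>t\<in>{0..T}. conv_op r x t = conv_op r y t) \<longrightarrow> (\<forall>t\<in>{0..T}. x t = y t)) \<and>
     1 \<le> N \<and>
     (\<forall>j\<in>{1..N}. continuous_on {0..T} (p j) \<and> linear_on_range T r (B j) \<and>
        weakly_singular T (q j) \<and>
        (\<forall>u v. continuous_on {0..T} v \<and> (\<forall>t\<in>{0..T}. u t = conv_op r v t) \<longrightarrow>
           (\<forall>t\<in>{0..T}. B j u t = conv_op (q j) v t))) \<and>
     continuous_on {(t, s). 0 \<le> s \<and> s \<le> t \<and> t \<le> T} (\<lambda>(t, s). K t s)"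

definition GL ::
  "(real \<Rightarrow> complex) \<Rightarrow> nat \<Rightarrow> (nat \<Rightarrow> real \<Rightarrow> complex) \<Rightarrow> (nat \<Rightarrow> real \<Rightarrow> complex) \<Rightarrow>
   (real \<Rightarrow> real \<Rightarrow> complex) \<Rightarrow> real \<Rightarrow> real \<Rightarrow> complex" where
  "GL r N p q K t s = (\<Sum>j=1..N. p j t * q j (t - s)) + (LINT \<xi>:{s..t}|lebesgue. K t \<xi> * r (\<xi> - s))"

(* iterated_kernel G n is G_(n+1) in the numbering G_1 = G, so the resolvent below
   is the sum of (-1)^(n-1) G_n over n \<ge> 1 *)
primrec iterated_kernel :: "(real \<Rightarrow> real \<Rightarrow> complex) \<Rightarrow> nat \<Rightarrow> real \<Rightarrow> real \<Rightarrow> complex" where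
  "iterated_kernel G 0 = G"
| "iterated_kernel G (Suc n) =
     (\<lambda>t s. LINT \<xi>:{s..t}|lebesgue. G t \<xi> * iterated_kernel G n \<xi> s)"

definition resolvent_kernel :: "(real \<Rightarrow> real \<Rightarrow> complex) \<Rightarrow> real \<Rightarrow> real \<Rightarrow> complex" where
  "resolvent_kernel G t s = (\<Sum>n. (-1) ^ n * iterated_kernel G n t s)"

(* continuous causal densities v = (I - V_(R_L)) f of the solutions u = V_r v of
   A u + sum_j p_j B_j u + V_K u = f, where A is the inverse of V_r *)
definition resolvent_densities :: "real \<Rightarrow> (real \<Rightarrow> complex) \<Rightarrow> (real \<Rightarrow> complex) set" where
  "resolvent_densities T r = {v. continuous_on {0..T} v \<and>
     (\<exists>N p B q K f. resolvent_setting T r N p B q K \<and> continuous_on {0..T} f \<and>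
        (\<forall>t\<in>{0..T}. v t = f t - kernel_op (resolvent_kernel (GL r N p q K)) f t))}"

end

theory Submission
  imports Defs
begin

text \<open>
  Let \<open>r(\<mu>,\<gamma>)\<close> be the Prabhakar kernel of order \<open>\<mu>\<close>, \<open>*\<close> the convolution on \<open>(0,T)\<close>, and \<open>R\<close> the
  convolution with \<open>r(\<mu>,\<gamma>)\<close>.  Everything rests on the semigroup law
  \<open>r(\<mu>,\<gamma>) * r(\<nu>,\<beta>) = r(\<mu>+\<nu>,\<gamma>+\<beta>)\<close> (\<open>pk_convolution\<close>), which is Euler's Beta integral term by term
  together with the Vandermonde identity for the coefficients.  The kernel \<open>r(j,0)\<close> is that of
  \<open>j\<close>-fold integration.  As \<open>\<mu> + \<delta> = m\<close>, the convolutions with \<open>r(\<mu>,\<gamma>)\<close> and with \<open>r(\<delta>,-\<gamma>)\<close>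
  therefore compose to \<open>m\<close>-fold integration, and by \<open>pk_assoc\<close> this holds at every point, not only
  almost everywhere.

  On the other side, \<open>AC0 T m\<close> is the range of \<open>m\<close>-fold integration on \<open>L1 T\<close>
  (\<open>iterated_integral_AC0\<close>, \<open>AC0_imp_iterated_integral\<close>), and \<open>m\<close>-fold integration is injective modulo
  null sets.  This is where Lebesgue's theory enters: an absolutely continuous function is the
  integral of a Radon--Nikodym density (\<open>AC_imp_indefinite_integral\<close>), and that density is its
  derivative almost everywhere (\<open>Lebesgue_differentiation\<close>).

  The range condition is then equivalent to \<open>R v \<in> AC0 T m\<close>: if \<open>v = r(\<delta>,-\<gamma>) * w\<close>, then \<open>R v\<close> is the
  \<open>m\<close>-fold integral of \<open>w\<close>; conversely, if \<open>R v\<close> is the \<open>m\<close>-fold integral of \<open>w\<close>, then \<open>v\<close> and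
  \<open>r(\<delta>,-\<gamma>) * w\<close> have the same image under the injective \<open>R\<close>.  For absolutely continuous \<open>v\<close> the
  function \<open>w\<close> is explicit, because \<open>v = v(0) + 1 * v'\<close> and the constant \<open>1\<close> is
  \<open>r(\<delta>,-\<gamma>) * r(1-\<delta>,\<gamma>)\<close>.

  That continuity of the density does not suffice is seen on Fourier coefficients.  With vanishing
  perturbation terms every continuous function is a density of the resolvent theorem.  The
  coefficients of \<open>r(\<delta>,-\<gamma>) * w\<close> decay at least like the power \<open>-\<delta>/2\<close> of the frequency
  (\<open>fourier_decay\<close>), whereas those of a continuous lacunary series can be made to decay more slowly
  than any given power (\<open>lacunary_fourier_coefficient\<close>).
\<close>

section \<open>Lebesgue differentiation of indefinite integrals\<close>

definition deviation_points :: "(real \<Rightarrow> 'a::real_normed_vector) \<Rightarrow> real \<Rightarrow> real \<Rightarrow> real \<Rightarrow> real set" where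
  "deviation_points f a b \<epsilon> = {x. a < x \<and> x < b \<and> (\<forall>d>0. \<exists>u v. a \<le> u \<and> u < v \<and> v \<le> b \<and> x \<in> {u..v} \<and> v - u < d \<and>
     norm ((v - u) *\<^sub>R f x - integral {u..v} f) \<ge> \<epsilon> * (v - u))}"

text \<open>Through such a point passes some arbitrarily short interval that violates the difference quotient
  estimate by a margin proportional to its length.  Vitali's theorem selects disjoint intervals of
  this kind that cover almost all such points; tagged with the points they come from, they are fine
  for the gauge of Henstock's lemma, which bounds the sum of their errors and hence their total
  length.\<close>

lemma deviation_points_negligible:
  fixes f :: "real \<Rightarrow> 'a::euclidean_space"
  assumes f: "f integrable_on {a..b}" and \<epsilon>: "\<epsilon> > 0"
  shows "negligible (deviation_points f a b \<epsilon>)"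
proof -
  define S where "S = deviation_points f a b \<epsilon>"
  have "\<exists>U. S \<subseteq> U \<and> U \<in> lmeasurable \<and> measure lebesgue U \<le> e" if e: "e > 0" for e
  proof -
    have e\<epsilon>: "e * \<epsilon> > 0" using e \<epsilon> by simp
    have f': "f integrable_on cbox a b" using f by simp
    obtain \<gamma> where \<gamma>: "gauge \<gamma>"
      and H: "\<And>p. \<lbrakk>p tagged_partial_division_of (cbox a b); \<gamma> fine p\<rbrakk> \<Longrightarrow>
             sum (\<lambda>(x,k). norm(measure lborel k *\<^sub>R f x - integral k f)) p < e * \<epsilon>"
      by (rule Henstock_lemma[OF f' e\<epsilon>]) (rule that)
    define K where "K = {(x,u,v). x \<in> S \<and> a \<le> u \<and> u < v \<and> v \<le> b \<and> x \<in> {u..v} \<and> {u..v} \<subseteq> \<gamma> x \<and>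
          norm ((v - u) *\<^sub>R f x - integral {u..v} f) \<ge> \<epsilon> * (v - u)}"
    define c where "c = (\<lambda>(x::real,u::real,v::real). (u + v) / 2)"
    define r where "r = (\<lambda>(x::real,u::real,v::real). (v - u) / 2)"
    have cb: "cball (c i) (r i) = {fst (snd i)..snd (snd i)}" for i
      unfolding c_def r_def cball_eq_atLeastAtMost split_def by (auto simp: field_simps)
    have "\<exists>i\<in>K. x \<in> cball (c i) (r i) \<and> r i < d" if x: "x \<in> S" and d: "d > 0" for x d
    proof -
      obtain h where h: "h > 0" "ball x h \<subseteq> \<gamma> x"
        using \<gamma> by (meson gauge_def open_contains_ball)
      have "min d h > 0" using d h by simp
      then obtain u v where uv: "a \<le> u" "u < v" "v \<le> b" "x \<in> {u..v}" "v - u < min d h"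
          "norm ((v - u) *\<^sub>R f x - integral {u..v} f) \<ge> \<epsilon> * (v - u)"
        using x unfolding S_def deviation_points_def by blast
      have "{u..v} \<subseteq> ball x h" using uv by (auto simp: dist_real_def)
      then have "(x,u,v) \<in> K" using uv x h unfolding K_def by auto
      moreover have "x \<in> cball (c (x,u,v)) (r (x,u,v))" "r (x,u,v) < d"
        using uv unfolding cb by (auto simp: r_def)
      ultimately show ?thesis by blast
    qed
    then have vit: "\<And>x d. \<lbrakk>x \<in> S; 0 < d\<rbrakk> \<Longrightarrow> \<exists>i. i \<in> K \<and> x \<in> cball (c i) (r i) \<and> r i < d" by blast
    have rpos: "\<And>i. i \<in> K \<Longrightarrow> 0 < r i" unfolding K_def r_def by auto
    obtain C where C: "countable C" "C \<subseteq> K"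
       "pairwise (\<lambda>i j. disjnt (cball (c i) (r i)) (cball (c j) (r j))) C"
       "negligible (S - (\<Union>i\<in>C. cball (c i) (r i)))"
      by (rule Vitali_covering_theorem_cballs[where K=K and r=r and a=c and S=S, OF rpos vit]) (assumption | rule that)+
    have fin: "measure lebesgue (\<Union>i\<in>F. cball (c i) (r i)) \<le> e" if F: "F \<subseteq> C" "finite F" for F
    proof -
      \<comment> \<open>the selected intervals, with their bad points as tags, as a partial tagged division\<close>
      define q where "q = (\<lambda>(x::real,u::real,v::real). (x, {u..v}))"
      have Kin: "\<And>i. i \<in> F \<Longrightarrow> i \<in> K" using F C by auto
      let ?err = "\<lambda>i::real \<times> real \<times> real. norm ((snd (snd i) - fst (snd i)) *\<^sub>R f (fst i) - integral {fst (snd i)..snd (snd i)} f)"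
      have KD: "fst (snd i) < snd (snd i)" "{fst (snd i)..snd (snd i)} \<subseteq> \<gamma> (fst i)"
        "\<epsilon> * (snd (snd i) - fst (snd i)) \<le>
          ?err i"
        if "i \<in> F" for i
        using Kin[OF that] by (auto simp: K_def)
      have qi: "q i = (fst i, {fst (snd i)..snd (snd i)})" for i
        by (simp add: q_def split_def)
      have inj: "inj_on q F"
      proof (rule inj_onI)
        fix i j assume ij: "i \<in> F" "j \<in> F" "q i = q j"
        then have "fst i = fst j" "fst (snd i) = fst (snd j)" "snd (snd i) = snd (snd j)"
          using KD(1)[of i] KD(1)[of j] by (auto simp: qi Icc_eq_Icc)
        then show "i = j" by (simp add: prod_eq_iff)
      qed
      have p: "q ` F tagged_partial_division_of (cbox a b)"
        unfolding tagged_partial_division_of_def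
      proof (intro conjI allI impI)
        show "finite (q ` F)" using F by simp
      next
        fix x k assume "(x,k) \<in> q ` F"
        then obtain u v where i: "(x,u,v) \<in> F" "k = {u..v}" by (auto simp: q_def)
        then have "(x,u,v) \<in> K" using Kin by blast
        then show "x \<in> k" "k \<subseteq> cbox a b" "\<exists>a b. k = cbox a b"
          using i unfolding K_def cbox_interval by auto
      next
        fix x k x' k' assume "(x,k) \<in> q ` F \<and> (x',k') \<in> q ` F \<and> (x,k) \<noteq> (x',k')"
        then obtain u v u' v' where i: "(x,u,v) \<in> F" "k = {u..v}" "(x',u',v') \<in> F" "k' = {u'..v'}"
          "(x,u,v) \<noteq> (x',u',v')" by (auto simp: q_def)
        then have "disjnt (cball (c (x,u,v)) (r (x,u,v))) (cball (c (x',u',v')) (r (x',u',v')))"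
          using pairwiseD[OF C(3) subsetD[OF F(1) i(1)] subsetD[OF F(1) i(3)] i(5)] by simp
        then have "disjnt k k'" unfolding cb using i by simp
        then show "interior k \<inter> interior k' = {}" using interior_subset by (fastforce simp: disjnt_def)
      qed
      have fine: "\<gamma> fine (q ` F)"
        unfolding fine_def using KD(2) by (auto simp: qi)
      have "(\<Sum>i\<in>F. ?err i) < e * \<epsilon>"
      proof -
        have "(\<Sum>i\<in>F. ?err i)
          = sum (\<lambda>(x,k). norm(measure lborel k *\<^sub>R f x - integral k f)) (q ` F)"
          unfolding sum.reindex[OF inj]
        proof (rule sum.cong[OF refl])
          fix i assume "i \<in> F"
          from KD(1)[OF this] show "?err i
            = ((\<lambda>(x,k). norm(measure lborel k *\<^sub>R f x - integral k f)) \<circ> q) i"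
            unfolding comp_def qi prod.case by simp
        qed
        then show ?thesis using H[OF p fine] by simp
      qed
      moreover have "(\<Sum>i\<in>F. \<epsilon> * (snd (snd i) - fst (snd i))) \<le> (\<Sum>i\<in>F. ?err i)"
        by (rule sum_mono) (rule KD(3))
      ultimately have "\<epsilon> * (\<Sum>i\<in>F. snd (snd i) - fst (snd i)) < \<epsilon> * e"
        by (simp add: sum_distrib_left mult.commute)
      then have "(\<Sum>i\<in>F. snd (snd i) - fst (snd i)) < e" using \<epsilon> by simp
      moreover have "measure lebesgue (\<Union>i\<in>F. cball (c i) (r i)) \<le> (\<Sum>i\<in>F. measure lebesgue (cball (c i) (r i)))"
        by (rule measure_UNION_le) (use F in auto)
      moreover have "(\<Sum>i\<in>F. measure lebesgue (cball (c i) (r i))) = (\<Sum>i\<in>F. snd (snd i) - fst (snd i))"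
        unfolding cb by (rule sum.cong[OF refl]) (simp add: less_imp_le[OF KD(1)])
      ultimately show ?thesis by linarith
    qed
    define U where "U = (\<Union>i\<in>C. cball (c i) (r i))"
    have U: "U \<in> lmeasurable" "measure lebesgue U \<le> e"
    proof -
      have *: "\<And>I'. I' \<subseteq> C \<Longrightarrow> finite I' \<Longrightarrow> measure lebesgue (\<Union>i\<in>I'. cball (c i) (r i)) \<le> e"
        using fin by blast
      show "U \<in> lmeasurable" unfolding U_def
        by (rule fmeasurable_UN_bound[OF C(1) _ *]) auto
      show "measure lebesgue U \<le> e" unfolding U_def
        by (rule measure_UN_bound[OF C(1) _ *]) auto
    qed
    have "U \<union> (S - U) \<in> lmeasurable"
      using U C(4) by (metis U_def fmeasurable.Un negligible_iff_measure)
    moreover have "measure lebesgue (U \<union> (S - U)) \<le> measure lebesgue U + measure lebesgue (S - U)"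
      using U(1) C(4) unfolding U_def[symmetric]
      by (intro measure_Un_le) (auto simp: negligible_iff_measure)
    moreover have "measure lebesgue (S - U) = 0" using C(4) unfolding U_def[symmetric] by (simp add: negligible_iff_measure)
    ultimately show ?thesis using U by (intro exI[of _ "U \<union> (S - U)"]) auto
  qed
  then show ?thesis unfolding negligible_outer_le S_def by blast
qed

theorem Lebesgue_differentiation:
  fixes f :: "real \<Rightarrow> 'a::euclidean_space"
  assumes f: "f integrable_on {a..b}"
  shows "negligible {x. a < x \<and> x < b \<and> \<not> ((\<lambda>t. integral {a..t} f) has_vector_derivative f x) (at x)}"
proof -
  \<comment> \<open>outside the exceptional sets for all margins \<open>inverse (Suc n)\<close> the difference quotients converge\<close>
  define S where "S = deviation_points f a b"
  have "negligible (S e)" if "e > 0" for e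
    unfolding S_def by (rule deviation_points_negligible[OF f that])
  then have "negligible (\<Union>n::nat. S (inverse (real (Suc n))))"
    by (intro negligible_countable_Union) (auto simp del: of_nat_Suc)
  moreover have "{x. a < x \<and> x < b \<and> \<not> ((\<lambda>t. integral {a..t} f) has_vector_derivative f x) (at x)}
     \<subseteq> (\<Union>n::nat. S (inverse (real (Suc n))))"
  proof safe
    fix x assume x: "a < x" "x < b" "\<not> ((\<lambda>t. integral {a..t} f) has_vector_derivative f x) (at x)"
    show "x \<in> (\<Union>n::nat. S (inverse (real (Suc n))))"
    proof (rule ccontr)
      assume c: "x \<notin> (\<Union>n::nat. S (inverse (real (Suc n))))"
      let ?F = "\<lambda>t. integral {a..t} f"
      have "(?F has_derivative (\<lambda>h. h *\<^sub>R f x)) (at x)"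
        unfolding has_derivative_at_alt
      proof (intro conjI allI impI)
        show "bounded_linear (\<lambda>h. h *\<^sub>R f x)" by (rule bounded_linear_scaleR_left)
        fix e :: real assume e: "e > 0"
        then obtain n where n: "inverse (real (Suc n)) < e" using reals_Archimedean by blast
        from c have "x \<notin> S (inverse (real (Suc n)))" by blast
        then obtain d where d: "d > 0" and D: "\<And>u v. a \<le> u \<Longrightarrow> u < v \<Longrightarrow> v \<le> b \<Longrightarrow> x \<in> {u..v} \<Longrightarrow> v - u < d \<Longrightarrow>
           norm ((v - u) *\<^sub>R f x - integral {u..v} f) < inverse (real (Suc n)) * (v - u)"
          using x unfolding S_def deviation_points_def mem_Collect_eq not_le[symmetric] by blast
        have D': "norm ((v - u) *\<^sub>R f x - integral {u..v} f) \<le> e * (v - u)"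
          if "a \<le> u" "u < v" "v \<le> b" "x \<in> {u..v}" "v - u < d" for u v
          by (rule order_trans[OF less_imp_le[OF D[OF that]]]) (use n that in \<open>auto intro!: mult_right_mono\<close>)
        define d' where "d' = min d (min (x - a) (b - x))"
        have "d' > 0" using d x by (simp add: d'_def)
        moreover have "norm (?F y - ?F x - (y - x) *\<^sub>R f x) \<le> e * norm (y - x)" if y: "norm (y - x) < d'" for y
        proof -
          have yab: "a \<le> y" "y \<le> b" "\<bar>y - x\<bar> < d" using y unfolding d'_def by auto
          consider "y = x" | "x < y" | "y < x" by linarith
          then show ?thesis
          proof cases
            case 2
            have "?F x + integral {x..y} f = ?F y"
              by (rule Henstock_Kurzweil_Integration.integral_combine) (use 2 x yab in \<open>auto intro: integrable_subinterval_real[OF f]\<close>)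
            then have "?F y - ?F x = integral {x..y} f" by (simp add: algebra_simps)
            then show ?thesis using D'[of x y] 2 x yab by (simp add: norm_minus_commute)
          next
            case 3
            have "?F y + integral {y..x} f = ?F x"
              by (rule Henstock_Kurzweil_Integration.integral_combine) (use 3 x yab in \<open>auto intro: integrable_subinterval_real[OF f]\<close>)
            then have "?F y - ?F x - (y - x) *\<^sub>R f x = (x - y) *\<^sub>R f x - integral {y..x} f"
              by (simp add: algebra_simps)
            then show ?thesis using D'[of y x] 3 x yab by simp
          qed simp
        qed
        ultimately show "\<exists>d>0. \<forall>y. norm (y - x) < d \<longrightarrow> norm (?F y - ?F x - (y - x) *\<^sub>R f x) \<le> e * norm (y - x)"
          by blast
      qed
      then show False using x by (simp add: has_vector_derivative_def)
    qed
  qed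
  ultimately show ?thesis using negligible_subset by blast
qed

section \<open>Absolutely continuous functions are indefinite integrals\<close>

text \<open>The finite families of non-overlapping intervals that test absolute continuity, encoded as
  sets of endpoint pairs: a set can be split, mapped and united without any indexing.\<close>

definition interval_systems :: "real \<Rightarrow> real \<Rightarrow> (real \<times> real) set set" where
  "interval_systems a b = {D. finite D \<and> (\<forall>p\<in>D. a \<le> fst p \<and> fst p \<le> snd p \<and> snd p \<le> b) \<and>
     (\<forall>p\<in>D. \<forall>q\<in>D. p \<noteq> q \<longrightarrow> {fst p<..<snd p} \<inter> {fst q<..<snd q} = {})}"

definition increment :: "(real \<Rightarrow> real) \<Rightarrow> (real \<times> real) set \<Rightarrow> real" where
  "increment F D = (\<Sum>p\<in>D. F (snd p) - F (fst p))"

abbreviation total_length :: "(real \<times> real) set \<Rightarrow> real" where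
  "total_length \<equiv> increment (\<lambda>x. x)"

text \<open>A signed sum of increments loses nothing for real functions, since the intervals with increments
  of either sign can be tested separately, and it is what the positive variation estimates.\<close>

definition abs_continuous :: "real \<Rightarrow> (real \<Rightarrow> real) \<Rightarrow> bool" where
  "abs_continuous T F \<longleftrightarrow> (\<forall>\<epsilon>>0. \<exists>d>0. \<forall>D\<in>interval_systems 0 T.
     total_length D < d \<longrightarrow> \<bar>increment F D\<bar> < \<epsilon>)"

lemma interval_systemsI:
  assumes "finite D" "\<And>p. p \<in> D \<Longrightarrow> a \<le> fst p" "\<And>p. p \<in> D \<Longrightarrow> fst p \<le> snd p" "\<And>p. p \<in> D \<Longrightarrow> snd p \<le> b"
    "\<And>p q x. p \<in> D \<Longrightarrow> q \<in> D \<Longrightarrow> fst p < x \<Longrightarrow> x < snd p \<Longrightarrow> fst q < x \<Longrightarrow> x < snd q \<Longrightarrow> p = q"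
  shows "D \<in> interval_systems a b"
  unfolding interval_systems_def mem_Collect_eq
proof (intro conjI ballI impI)
  fix p q assume "p \<in> D" "q \<in> D" "p \<noteq> q"
  with assms(5)[of p q] show "{fst p<..<snd p} \<inter> {fst q<..<snd q} = {}" by fastforce
qed (use assms(1-4) in blast)+

lemma interval_systemsD:
  assumes "D \<in> interval_systems a b"
  shows "finite D" "\<And>p. p \<in> D \<Longrightarrow> a \<le> fst p" "\<And>p. p \<in> D \<Longrightarrow> fst p \<le> snd p" "\<And>p. p \<in> D \<Longrightarrow> snd p \<le> b"
    "\<And>p q x. p \<in> D \<Longrightarrow> q \<in> D \<Longrightarrow> fst p < x \<Longrightarrow> x < snd p \<Longrightarrow> fst q < x \<Longrightarrow> x < snd q \<Longrightarrow> p = q"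
proof -
  note * = assms[unfolded interval_systems_def mem_Collect_eq]
  show "finite D" "\<And>p. p \<in> D \<Longrightarrow> a \<le> fst p" "\<And>p. p \<in> D \<Longrightarrow> fst p \<le> snd p" "\<And>p. p \<in> D \<Longrightarrow> snd p \<le> b"
    using * by blast+
  fix p q x assume pq: "p \<in> D" "q \<in> D" "fst p < x" "x < snd p" "fst q < x" "x < snd q"
  have "p \<noteq> q \<Longrightarrow> {fst p<..<snd p} \<inter> {fst q<..<snd q} = {}" using * pq(1,2) by blast
  moreover have "x \<in> {fst p<..<snd p} \<inter> {fst q<..<snd q}" using pq by simp
  ultimately show "p = q" by blast
qed

lemma empty_in_interval_systems [simp]: "{} \<in> interval_systems a b"
  by (simp add: interval_systems_def)

lemma singleton_in_interval_systems: "a \<le> s \<Longrightarrow> s \<le> t \<Longrightarrow> t \<le> b \<Longrightarrow> {(s,t)} \<in> interval_systems a b"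
  by (simp add: interval_systems_def)

lemma interval_systems_mono: "b \<le> c \<Longrightarrow> interval_systems a b \<subseteq> interval_systems a c"
  unfolding interval_systems_def by force

lemma increment_empty [simp]: "increment F {} = 0"
  by (simp add: increment_def)

text \<open>Truncating each interval from above and from below at \<open>c\<close> telescopes, since the minimum and
  the maximum of \<open>x\<close> and \<open>c\<close> are \<open>x\<close> and \<open>c\<close> in some order.  Distinct intervals can collapse to the
  same pair only when that pair is degenerate, where the increment vanishes.\<close>

lemma split_interval_system:
  assumes D: "D \<in> interval_systems a b" and c: "a \<le> c" "c \<le> b"
  obtains D1 D2 where "D1 \<in> interval_systems a c" "D2 \<in> interval_systems c b"
    "\<And>F. increment F D = increment F D1 + increment F D2"
proof -
  define h1 where "h1 = (\<lambda>p::real\<times>real. (min (fst p) c, min (snd p) c))"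
  define h2 where "h2 = (\<lambda>p::real\<times>real. (max (fst p) c, max (snd p) c))"
  note D' = interval_systemsD[OF D]
  have sys: "h ` D \<in> interval_systems u v"
    if h: "h = h1 \<and> u = a \<and> v = c \<or> h = h2 \<and> u = c \<and> v = b" for h u v
  proof (rule interval_systemsI)
    fix p q x assume "p \<in> h ` D" "q \<in> h ` D" and x: "fst p < x" "x < snd p" "fst q < x" "x < snd q"
    then obtain p' q' where p': "p' \<in> D" "p = h p'" and q': "q' \<in> D" "q = h q'" by blast
    have "fst p' < x" "x < snd p'" "fst q' < x" "x < snd q'"
      using x h unfolding p' q' by (auto simp: h1_def h2_def)
    from D'(5)[OF p'(1) q'(1) this] show "p = q" using p' q' by simp
  next
    fix p assume "p \<in> h ` D"
    then obtain p' where p': "p' \<in> D" "p = h p'" by blast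
    from D'(2,3,4)[OF p'(1)] c h show "u \<le> fst p" "fst p \<le> snd p" "snd p \<le> v"
      unfolding p' by (auto simp: h1_def h2_def)
  qed (use D'(1) in simp)
  have incr: "increment F (h ` D) = (\<Sum>p\<in>D. F (snd (h p)) - F (fst (h p)))"
    if h: "h = h1 \<or> h = h2" for h F
    unfolding increment_def
  proof (rule sum.reindex_nontrivial[unfolded comp_def, OF D'(1)])
    fix p q assume pq: "p \<in> D" "q \<in> D" "p \<noteq> q" "h p = h q"
    have le: "fst (h p) \<le> snd (h p)" using h D'(3)[OF pq(1)] by (auto simp: h1_def h2_def min_le_iff_disj le_max_iff_disj)
    have "\<not> fst (h p) < snd (h p)"
    proof
      assume l: "fst (h p) < snd (h p)"
      obtain x where x: "fst (h p) < x" "x < snd (h p)" using dense l by blast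
      then have "fst p < x" "x < snd p" using h by (auto simp: h1_def h2_def)
      moreover have "fst q < x" "x < snd q" using h x unfolding pq(4) by (auto simp: h1_def h2_def)
      ultimately show False using D'(5)[OF pq(1,2)] pq(3) by blast
    qed
    then have "fst (h p) = snd (h p)" using le by simp
    then show "F (snd (h p)) - F (fst (h p)) = 0" by simp
  qed
  have "increment F D = increment F (h1 ` D) + increment F (h2 ` D)" for F
    unfolding incr[OF disjI1[OF refl]] incr[OF disjI2[OF refl]]
    unfolding increment_def sum.distrib[symmetric]
  proof (rule sum.cong[OF refl])
    fix p assume "p \<in> D"
    have "F (min x c) + F (max x c) = F x + F c" for x by (auto simp: min_def max_def)
    from this[of "fst p"] this[of "snd p"]
    show "F (snd p) - F (fst p) = F (snd (h1 p)) - F (fst (h1 p)) + (F (snd (h2 p)) - F (fst (h2 p)))"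
      by (simp add: h1_def h2_def)
  qed
  then show ?thesis using that[OF sys sys] by blast
qed

text \<open>Degenerate intervals are discarded before the union is taken: they are the only pairs that two
  refinements of different intervals can share, and they carry no increment.\<close>

lemma union_interval_systems:
  assumes D: "D \<in> interval_systems a b" and E: "\<And>p. p \<in> D \<Longrightarrow> E p \<in> interval_systems (fst p) (snd p)"
  obtains U where "U \<in> interval_systems a b" "\<And>F. increment F U = (\<Sum>p\<in>D. increment F (E p))"
proof -
  note D' = interval_systemsD[OF D]
  define E' where "E' p = {q\<in>E p. fst q < snd q}" for p
  have E'in: "E' p \<subseteq> E p" for p by (auto simp: E'_def)
  note ED = interval_systemsD[OF E]
  have sub: "fst p \<le> fst q \<and> fst q < snd q \<and> snd q \<le> snd p" if "p \<in> D" "q \<in> E' p" for p q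
    using ED(2,4)[OF that(1)] that by (auto simp: E'_def)
  have same: "p = p'" if "p \<in> D" "p' \<in> D" "q \<in> E' p" "q' \<in> E' p'" "fst q < x" "x < snd q" "fst q' < x" "x < snd q'" for p p' q q' x
    using sub[OF that(1,3)] sub[OF that(2,4)] that D'(5)[OF that(1,2), of x] by linarith
  define U where "U = (\<Union>p\<in>D. E' p)"
  have fin: "finite (E' p)" if "p \<in> D" for p using finite_subset[OF E'in ED(1)[OF that]] .
  have 1: "U \<in> interval_systems a b"
  proof (rule interval_systemsI)
    show "finite U" unfolding U_def using D'(1) fin by blast
    fix q assume "q \<in> U"
    then obtain p where p: "p \<in> D" "q \<in> E' p" by (auto simp: U_def)
    show "a \<le> fst q" "fst q \<le> snd q" "snd q \<le> b"
      using sub[OF p] D'(2,4)[OF p(1)] by auto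
  next
    fix q q' x assume "q \<in> U" "q' \<in> U" and x: "fst q < x" "x < snd q" "fst q' < x" "x < snd q'"
    then obtain p p' where p: "p \<in> D" "q \<in> E' p" and p': "p' \<in> D" "q' \<in> E' p'" by (auto simp: U_def)
    have "p = p'" using same[OF p(1) p'(1) p(2) p'(2) x] .
    then show "q = q'" using ED(5)[OF p(1) _ _ x] p p' E'in by blast
  qed
  have "increment F U = (\<Sum>p\<in>D. increment F (E p))" for F
  proof -
    have "increment F U = (\<Sum>p\<in>D. increment F (E' p))"
      unfolding increment_def U_def
    proof (rule sum.UNION_disjoint)
      show "\<forall>i\<in>D. \<forall>j\<in>D. i \<noteq> j \<longrightarrow> E' i \<inter> E' j = {}"
      proof (intro ballI impI)
        fix i j assume ij: "i \<in> D" "j \<in> D" "i \<noteq> j"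
        show "E' i \<inter> E' j = {}"
        proof (rule ccontr)
          assume "E' i \<inter> E' j \<noteq> {}"
          then obtain q where q: "q \<in> E' i" "q \<in> E' j" by blast
          obtain x where "fst q < x" "x < snd q" using dense sub[OF ij(1) q(1)] by blast
          with same[OF ij(1,2) q] ij show False by blast
        qed
      qed
    qed (use D'(1) fin in auto)
    also have "\<dots> = (\<Sum>p\<in>D. increment F (E p))"
    proof (rule sum.cong[OF refl])
      fix p assume p: "p \<in> D"
      show "increment F (E' p) = increment F (E p)"
        unfolding increment_def
      proof (rule sum.mono_neutral_left[OF ED(1)[OF p] E'in])
        show "\<forall>i\<in>E p - E' p. F (snd i) - F (fst i) = 0"
          using ED(3)[OF p] by (auto simp: E'_def) (metis less_eq_real_def)
      qed
    qed
    finally show ?thesis .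
  qed
  with 1 show ?thesis using that by blast
qed

lemma total_length_le:
  assumes D: "D \<in> interval_systems a b" and ab: "a \<le> b"
  shows "total_length D \<le> b - a"
proof -
  note D' = interval_systemsD[OF D]
  have "total_length D = (\<Sum>p\<in>D. measure lborel {fst p<..<snd p})"
    unfolding increment_def by (rule sum.cong[OF refl]) (simp add: D'(3))
  also have "\<dots> = measure lborel (\<Union>p\<in>D. {fst p<..<snd p})"
  proof (rule measure_finite_Union[symmetric, OF D'(1)])
    show "disjoint_family_on (\<lambda>p. {fst p<..<snd p}) D"
      unfolding disjoint_family_on_def using D'(5) by (fastforce simp: disjoint_iff)
  qed (auto simp: D'(3))
  also have "\<dots> \<le> measure lborel {a..b}"
  proof (rule measure_mono_fmeasurable)
    show "(\<Union>p\<in>D. {fst p<..<snd p}) \<subseteq> {a..b}" using D'(2,4) by force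
    show "(\<Union>p\<in>D. {fst p<..<snd p}) \<in> sets lborel" by (simp add: borel_open open_UN)
    show "{a..b} \<in> fmeasurable lborel" by (rule fmeasurableI) (use ab in auto)
  qed
  also have "\<dots> = b - a" using ab by simp
  finally show ?thesis .
qed

text \<open>Cut \<open>{0..T}\<close> into pieces shorter than the \<open>d\<close> that belongs to \<open>\<epsilon> = 1\<close>; each piece contributes
  at most \<open>1\<close>.\<close>

lemma abs_continuous_bounded_increments:
  assumes F: "abs_continuous T F"
  obtains B where "\<And>t D. t \<le> T \<Longrightarrow> D \<in> interval_systems 0 t \<Longrightarrow> increment F D \<le> B"
proof -
  obtain d where d: "d > 0" and dd: "\<And>D. D \<in> interval_systems 0 T \<Longrightarrow> total_length D < d \<Longrightarrow> \<bar>increment F D\<bar> < 1"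
    using F unfolding abs_continuous_def by (meson zero_less_one)
  have main: "increment F D \<le> real k" if "0 \<le> t" "t \<le> T" "t \<le> real k * (d / 2)" "D \<in> interval_systems 0 t" for t k D
    using that
  proof (induction k arbitrary: t D)
    case 0
    then have "t = 0" by simp
    then have "fst p = 0 \<and> snd p = 0" if "p \<in> D" for p
      using interval_systemsD(2,3,4)[OF 0(4) that] by auto
    then have "increment F D = 0" unfolding increment_def by (intro sum.neutral) auto
    then show ?case by simp
  next
    case (Suc k)
    define c where "c = max 0 (t - d / 2)"
    have c: "0 \<le> c" "c \<le> t" "t - c < d" using Suc.prems d by (auto simp: c_def max_def)
    obtain D1 D2 where s: "D1 \<in> interval_systems 0 c" "D2 \<in> interval_systems c t"
       "\<And>F. increment F D = increment F D1 + increment F D2"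
      using split_interval_system[OF Suc.prems(4) c(1,2)] by metis
    have "increment F D1 \<le> real k"
    proof (rule Suc.IH[OF c(1) _ _ s(1)])
      show "c \<le> T" using c Suc.prems by simp
      show "c \<le> real k * (d / 2)" using Suc.prems(3) d by (auto simp: c_def max_def field_simps)
    qed
    moreover have "D2 \<in> interval_systems 0 T"
      using s(2) c Suc.prems unfolding interval_systems_def by force
    then have "increment F D2 < 1" using dd[of D2] total_length_le[OF s(2) c(2)] c(3) by auto
    ultimately show ?case using s(3)[of F] by simp
  qed
  obtain k where k: "T / (d/2) < real k" using reals_Archimedean2 by blast
  have "increment F D \<le> real k" if "t \<le> T" "D \<in> interval_systems 0 t" for t D
  proof (cases "0 \<le> t")
    case True
    have "T \<le> real k * (d/2)" using k d by (simp add: field_simps)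
    then show ?thesis using main[OF True that(1) _ that(2)] that(1) by simp
  next
    case False
    have "p \<notin> D" for p
    proof
      assume "p \<in> D"
      from interval_systemsD(2,3,4)[OF that(2) this] False show False by linarith
    qed
    then have "D = {}" by blast
    then show ?thesis by simp
  qed
  with that show ?thesis by blast
qed

text \<open>The positive variation of the Jordan decomposition.  Both it and its difference with \<open>F\<close> are
  monotone, which reduces absolutely continuous functions to monotone ones.\<close>

definition positive_variation :: "(real \<Rightarrow> real) \<Rightarrow> real \<Rightarrow> real" where
  "positive_variation F t = (SUP D\<in>interval_systems 0 t. increment F D)"

context
  fixes T :: real and F :: "real \<Rightarrow> real"
  assumes F: "abs_continuous T F"
begin

lemma positive_variation_upper:
  assumes "t \<le> T" "D \<in> interval_systems 0 t"
  shows "increment F D \<le> positive_variation F t"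
proof -
  obtain B where "\<And>t D. t \<le> T \<Longrightarrow> D \<in> interval_systems 0 t \<Longrightarrow> increment F D \<le> B"
    using abs_continuous_bounded_increments[OF F] by metis
  then show ?thesis unfolding positive_variation_def using assms
    by (intro cSUP_upper) (auto simp: bdd_above_def)
qed

lemma positive_variation_least:
  assumes "\<And>D. D \<in> interval_systems 0 t \<Longrightarrow> increment F D \<le> B"
  shows "positive_variation F t \<le> B"
  unfolding positive_variation_def by (rule cSUP_least) (use assms empty_in_interval_systems in blast)+

lemma positive_variation_mono:
  assumes "s \<le> t" "t \<le> T"
  shows "positive_variation F s \<le> positive_variation F t"
  by (rule positive_variation_least)
     (use assms positive_variation_upper interval_systems_mono[OF assms(1), of 0] in blast)

lemma positive_variation_minus_mono:
  assumes st: "0 \<le> s" "s \<le> t" "t \<le> T"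
  shows "positive_variation F s - F s \<le> positive_variation F t - F t"
proof (cases "s = t")
  case False
  then have lt: "s < t" using st by simp
  have "positive_variation F s \<le> positive_variation F t - (F t - F s)"
  proof (rule positive_variation_least)
    fix D assume D: "D \<in> interval_systems 0 s"
    note D' = interval_systemsD[OF D]
    have "insert (s,t) D \<in> interval_systems 0 t"
    proof (rule interval_systemsI)
      fix p q x assume "p \<in> insert (s,t) D" "q \<in> insert (s,t) D" and x: "fst p < x" "x < snd p" "fst q < x" "x < snd q"
      then show "p = q" using D'(5)[of p q x] D'(4)[of p] D'(4)[of q] by auto
    next
      fix p assume "p \<in> insert (s,t) D"
      then show "0 \<le> fst p" "fst p \<le> snd p" "snd p \<le> t"
        using D'(2)[of p] D'(3)[of p] D'(4)[of p] st by auto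
    qed (use D'(1) in simp)
    moreover have "(s,t) \<notin> D" using D'(4)[of "(s,t)"] lt by auto
    then have "increment F (insert (s,t) D) = F t - F s + increment F D"
      using D'(1) by (simp add: increment_def)
    ultimately show "increment F D \<le> positive_variation F t - (F t - F s)"
      using positive_variation_upper[OF st(3)] by fastforce
  qed
  then show ?thesis by simp
qed simp

text \<open>Refine every interval of a short system by a system that nearly attains the growth of the
  positive variation there.  The union of the refinements is again a short system, so the absolute
  continuity of \<open>F\<close> controls it.\<close>

lemma abs_continuous_positive_variation: "abs_continuous T (positive_variation F)"
  unfolding abs_continuous_def
proof (intro allI impI)
  fix \<epsilon> :: real assume \<epsilon>: "\<epsilon> > 0"
  let ?P = "positive_variation F"
  obtain d where d: "d > 0" and dd: "\<And>D. D \<in> interval_systems 0 T \<Longrightarrow> total_length D < d \<Longrightarrow> \<bar>increment F D\<bar> < \<epsilon> / 2"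
    using F \<epsilon> unfolding abs_continuous_def by (meson half_gt_zero)
  have "\<bar>increment ?P D\<bar> < \<epsilon>" if D: "D \<in> interval_systems 0 T" and len: "total_length D < d" for D
  proof -
    note D' = interval_systemsD[OF D]
    \<comment> \<open>the deficit allowed per interval; the deficits add up to less than \<open>\<epsilon> / 2\<close>\<close>
    define \<eta> where "\<eta> = \<epsilon> / (2 * (real (card D) + 1))"
    have \<eta>: "\<eta> > 0" "real (card D) * \<eta> < \<epsilon> / 2" using \<epsilon> by (auto simp: \<eta>_def field_simps)
    have "\<exists>E. E \<in> interval_systems (fst p) (snd p) \<and> ?P (snd p) - ?P (fst p) - \<eta> \<le> increment F E"
      if p: "p \<in> D" for p
    proof -
      have "\<exists>D0\<in>interval_systems 0 (snd p). ?P (snd p) - \<eta> < increment F D0"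
      proof (rule ccontr)
        assume "\<not> ?thesis"
        then have "?P (snd p) \<le> ?P (snd p) - \<eta>" by (intro positive_variation_least) (auto simp: not_less)
        then show False using \<eta> by simp
      qed
      then obtain D0 where D0: "D0 \<in> interval_systems 0 (snd p)" "?P (snd p) - \<eta> < increment F D0" by blast
      obtain D1 D2 where s: "D1 \<in> interval_systems 0 (fst p)" "D2 \<in> interval_systems (fst p) (snd p)"
        "\<And>F. increment F D0 = increment F D1 + increment F D2"
        using split_interval_system[OF D0(1) D'(2)[OF p] D'(3)[OF p]] by metis
      have "increment F D1 \<le> ?P (fst p)"
        by (rule positive_variation_upper[OF _ s(1)]) (use D'(3,4)[OF p] in linarith)
      then show ?thesis using s D0 by (intro exI[of _ D2]) auto
    qed
    then obtain E where E: "\<And>p. p \<in> D \<Longrightarrow> E p \<in> interval_systems (fst p) (snd p)"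
      "\<And>p. p \<in> D \<Longrightarrow> ?P (snd p) - ?P (fst p) - \<eta> \<le> increment F (E p)" by metis
    obtain U where U: "U \<in> interval_systems 0 T" "\<And>F. increment F U = (\<Sum>p\<in>D. increment F (E p))"
      using union_interval_systems[OF D E(1)] by metis
    have "total_length U \<le> total_length D"
      unfolding U(2) increment_def[of _ D]
      by (rule sum_mono) (use total_length_le[OF E(1)] D'(3) in auto)
    then have "\<bar>increment F U\<bar> < \<epsilon> / 2" using dd[OF U(1)] len by simp
    moreover have "increment ?P D \<le> increment F U + real (card D) * \<eta>"
    proof -
      have "increment ?P D \<le> (\<Sum>p\<in>D. increment F (E p) + \<eta>)"
        unfolding increment_def[of _ D] by (rule sum_mono) (use E(2) in fastforce)
      then show ?thesis unfolding U(2) by (simp add: sum.distrib)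
    qed
    moreover have "0 \<le> increment ?P D"
      unfolding increment_def using positive_variation_mono D' by (intro sum_nonneg) auto
    ultimately show ?thesis using \<eta> by linarith
  qed
  then show "\<exists>d>0. \<forall>D\<in>interval_systems 0 T. total_length D < d \<longrightarrow> \<bar>increment ?P D\<bar> < \<epsilon>"
    using d by blast
qed

end

lemma abs_continuous_diff:
  assumes "abs_continuous T F" "abs_continuous T G"
  shows "abs_continuous T (\<lambda>x. F x - G x)"
  unfolding abs_continuous_def
proof (intro allI impI)
  fix \<epsilon> :: real assume "\<epsilon> > 0"
  then have e: "\<epsilon> / 2 > 0" by simp
  obtain d1 where d1: "d1 > 0" "\<And>D. D \<in> interval_systems 0 T \<Longrightarrow> total_length D < d1 \<Longrightarrow> \<bar>increment F D\<bar> < \<epsilon> / 2"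
    using assms(1) e unfolding abs_continuous_def by meson
  obtain d2 where d2: "d2 > 0" "\<And>D. D \<in> interval_systems 0 T \<Longrightarrow> total_length D < d2 \<Longrightarrow> \<bar>increment G D\<bar> < \<epsilon> / 2"
    using assms(2) e unfolding abs_continuous_def by meson
  have "increment (\<lambda>x. F x - G x) D = increment F D - increment G D" for D
    unfolding increment_def sum_subtractf[symmetric] by (rule sum.cong) auto
  then show "\<exists>d>0. \<forall>D\<in>interval_systems 0 T. total_length D < d \<longrightarrow> \<bar>increment (\<lambda>x. F x - G x) D\<bar> < \<epsilon>"
    using d1 d2 by (intro exI[of _ "min d1 d2"]) fastforce
qed


lemma abs_continuous_imp_continuous_on:
  assumes F: "abs_continuous T F"
  shows "continuous_on {0..T} F"
  unfolding continuous_on_iff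
proof (intro ballI allI impI)
  fix x e :: real assume x: "x \<in> {0..T}" and e: "e > 0"
  obtain d where d: "d > 0" "\<And>D. D \<in> interval_systems 0 T \<Longrightarrow> total_length D < d \<Longrightarrow> \<bar>increment F D\<bar> < e"
    using F e unfolding abs_continuous_def by meson
  have "dist (F y) (F x) < e" if y: "y \<in> {0..T}" "dist y x < d" for y
  proof -
    have "{(min x y, max x y)} \<in> interval_systems 0 T"
      using x y by (intro singleton_in_interval_systems) auto
    from d(2)[OF this] y show ?thesis
      by (cases "x \<le> y") (auto simp: increment_def dist_real_def min_def max_def abs_minus_commute)
  qed
  then show "\<exists>d>0. \<forall>x'\<in>{0..T}. dist x' x < d \<longrightarrow> dist (F x') (F x) < e" using d(1) by blast
qed

text \<open>The Lebesgue--Stieltjes measure of \<open>F\<close> is absolutely continuous with respect to Lebesgue measure: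
  a null set is covered by almost disjoint intervals of small total length, and absolute continuity
  of \<open>F\<close> makes the measure of every finite union of them small.  The density is the Radon--Nikodym
  derivative.\<close>

lemma mono_abs_continuous_imp_indefinite_integral:
  assumes T: "T > 0" and F: "abs_continuous T F"
    and mono: "\<And>s t. 0 \<le> s \<Longrightarrow> s \<le> t \<Longrightarrow> t \<le> T \<Longrightarrow> F s \<le> F t"
  shows "\<exists>g. integrable lborel g \<and> (\<forall>x. x \<notin> {0<..T} \<longrightarrow> g x = 0) \<and>
    (\<forall>t\<in>{0..T}. F t = F 0 + (LINT s:{0..t}|lborel. g s))"
proof -
  \<comment> \<open>constant continuation, so that the Stieltjes measure lives on \<open>{0<..T}\<close>\<close>
  define G where "G x = F (max 0 (min T x))" for x
  have GF: "G x = F x" if "x \<in> {0..T}" for x using that by (auto simp: G_def)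
  have Gmono: "G x \<le> G y" if "x \<le> y" for x y unfolding G_def using that T by (intro mono) auto
  have "continuous_on UNIV G"
    unfolding G_def using T
    by (intro continuous_on_compose2[OF abs_continuous_imp_continuous_on[OF F]] continuous_intros) auto
  then have Gcont: "continuous (at_right x) G" for x
    by (simp add: continuous_on_eq_continuous_at continuous_at_imp_continuous_at_within)
  define N where "N = interval_measure G"
  have N: "emeasure N {u<..v} = ennreal (G v - G u)" if "u \<le> v" for u v
    unfolding N_def using that by (rule emeasure_interval_measure_Ioc[OF _ Gmono Gcont])
  have Nicc: "emeasure N {u..v} = ennreal (G v - G u)" if "u \<le> v" for u v
    unfolding N_def using that by (rule emeasure_interval_measure_Icc[OF _ Gmono \<open>continuous_on UNIV G\<close>])
  have setsN [measurable_cong]: "sets N = sets borel" unfolding N_def by simp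
  have inner: "emeasure N A = 0" if A: "A \<in> null_sets lborel" "A \<subseteq> {0..T}" for A
  proof -
    have "emeasure N A \<le> ennreal e" if e: "e > 0" for e
    proof -
      obtain d where d: "d > 0" and dd: "\<And>D. D \<in> interval_systems 0 T \<Longrightarrow> total_length D < d \<Longrightarrow> \<bar>increment F D\<bar> < e"
        using F e unfolding abs_continuous_def by meson
      have Alm: "A \<in> lmeasurable" "measure lebesgue A = 0"
        using A(1) null_sets_completionI[of A lborel] by (auto simp: negligible_iff_null_sets[symmetric] negligible_iff_measure)
      have "d / 2 > 0" "A \<subseteq> cbox 0 T" using d A(2) by auto
      then obtain \<D> where \<D>: "countable \<D>" "\<And>K. K \<in> \<D> \<Longrightarrow> K \<subseteq> cbox 0 T \<and> K \<noteq> {} \<and> (\<exists>c d. K = cbox c d)"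
        "pairwise (\<lambda>A B. interior A \<inter> interior B = {}) \<D>" "A \<subseteq> \<Union>\<D>"
        "\<Union>\<D> \<in> lmeasurable" "measure lebesgue (\<Union>\<D>) \<le> measure lebesgue A + d / 2"
        using measurable_outer_intervals_bounded[OF Alm(1)] by (smt (verit, ccfv_threshold))
      have K: "K = {Inf K..Sup K} \<and> 0 \<le> Inf K \<and> Inf K \<le> Sup K \<and> Sup K \<le> T" if "K \<in> \<D>" for K
      proof -
        obtain u v where uv: "K = {u..v}" "u \<le> v" "K \<subseteq> {0..T}" using \<D>(2)[OF \<open>K \<in> \<D>\<close>] by auto
        then show ?thesis by auto
      qed
      have fin: "\<Union>\<F> \<in> fmeasurable N \<and> measure N (\<Union>\<F>) \<le> e" if \<F>: "\<F> \<subseteq> \<D>" "finite \<F>" for \<F>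
      proof -
        define h where "h = (\<lambda>K::real set. (Inf K, Sup K))"
        have inj: "inj_on h \<F>"
        proof (rule inj_onI)
          fix K L assume "K \<in> \<F>" "L \<in> \<F>" "h K = h L"
          then show "K = L" using K[of K] K[of L] \<F>(1) unfolding h_def by (metis prod.inject subsetD)
        qed
        have sys: "h ` \<F> \<in> interval_systems 0 T"
        proof (rule interval_systemsI)
          fix p q x assume "p \<in> h ` \<F>" "q \<in> h ` \<F>" and x: "fst p < x" "x < snd p" "fst q < x" "x < snd q"
          then obtain K L where KL: "K \<in> \<F>" "p = h K" "L \<in> \<F>" "q = h L" by blast
          have "interior K = {Inf K<..<Sup K}" "interior L = {Inf L<..<Sup L}"
            using K[of K] K[of L] \<F>(1) KL by (metis interior_atLeastAtMost_real subsetD)+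
          then have "x \<in> interior K \<inter> interior L" using x KL by (simp add: h_def)
          then have "K = L" using \<D>(3) \<F>(1) KL unfolding pairwise_def by blast
          then show "p = q" using KL by simp
        next
          fix p assume "p \<in> h ` \<F>"
          then obtain L where L: "L \<in> \<F>" "p = h L" by blast
          with K[of L] \<F>(1) show "0 \<le> fst p" "fst p \<le> snd p" "snd p \<le> T" by (auto simp: h_def)
        qed (use \<F> in simp)
        have "total_length (h ` \<F>) = (\<Sum>p\<in>h ` \<F>. measure lebesgue {fst p<..<snd p})"
          unfolding increment_def by (rule sum.cong[OF refl]) (simp add: interval_systemsD(3)[OF sys])
        also have "\<dots> = measure lebesgue (\<Union>p\<in>h ` \<F>. {fst p<..<snd p})"
        proof (rule measure_finite_Union[symmetric])
          show "disjoint_family_on (\<lambda>p. {fst p<..<snd p}) (h ` \<F>)"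
            unfolding disjoint_family_on_def using interval_systemsD(5)[OF sys] by (fastforce simp: disjoint_iff)
        qed (use interval_systemsD(1,3)[OF sys] in auto)
        also have "\<dots> \<le> measure lebesgue (\<Union>\<D>)"
        proof (rule measure_mono_fmeasurable[OF _ _ \<D>(5)])
          show "(\<Union>p\<in>h ` \<F>. {fst p<..<snd p}) \<subseteq> \<Union>\<D>"
          proof
            fix x assume "x \<in> (\<Union>p\<in>h ` \<F>. {fst p<..<snd p})"
            then obtain L where L: "L \<in> \<F>" "Inf L < x" "x < Sup L" by (auto simp: h_def)
            then have "x \<in> {Inf L..Sup L}" by simp
            then show "x \<in> \<Union>\<D>" using K[of L] L(1) \<F>(1) by blast
          qed
          show "(\<Union>p\<in>h ` \<F>. {fst p<..<snd p}) \<in> sets lebesgue"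
            by (intro sets.finite_UN) (use \<F> in auto)
        qed
        also have "\<dots> < d" using \<D>(6) Alm(2) d by simp
        finally have lt: "\<bar>increment F (h ` \<F>)\<bar> < e" by (rule dd[OF sys])
        have eq: "increment F (h ` \<F>) = (\<Sum>K\<in>\<F>. F (Sup K) - F (Inf K))"
          unfolding increment_def sum.reindex[OF inj] by (simp add: h_def)
        have fmK: "K \<in> fmeasurable N \<and> measure N K = F (Sup K) - F (Inf K)" if "K \<in> \<F>" for K
        proof -
          have k: "K = {Inf K..Sup K}" "0 \<le> Inf K" "Inf K \<le> Sup K" "Sup K \<le> T" using K[of K] that \<F>(1) by auto
          have "emeasure N K = ennreal (G (Sup K) - G (Inf K))"
            by (subst k(1)) (rule Nicc[OF k(3)])
          also have "\<dots> = ennreal (F (Sup K) - F (Inf K))" using k(2-4) by (simp add: GF)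
          finally have "emeasure N K = ennreal (F (Sup K) - F (Inf K))" .
          moreover have "K \<in> sets N" unfolding setsN by (subst k(1)) simp
          moreover have "F (Inf K) \<le> F (Sup K)" using k by (intro mono) auto
          ultimately show ?thesis by (auto intro!: fmeasurableI simp: measure_def)
        qed
        have "measure N (\<Union>\<F>) \<le> (\<Sum>K\<in>\<F>. measure N K)"
          using measure_UNION_le[of \<F> "\<lambda>K. K" N] \<F>(2) fmK by (auto dest: fmeasurableD)
        also have "\<dots> = (\<Sum>K\<in>\<F>. F (Sup K) - F (Inf K))" using fmK by (intro sum.cong) auto
        finally have "measure N (\<Union>\<F>) \<le> (\<Sum>K\<in>\<F>. F (Sup K) - F (Inf K))" .
        moreover have "\<Union>\<F> \<in> fmeasurable N" using fmK \<F>(2) by (intro fmeasurable.finite_Union) auto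
        ultimately show ?thesis using lt eq by linarith
      qed
      have sing: "K \<in> fmeasurable N" if "K \<in> \<D>" for K using fin[of "{K}"] that by simp
      have bnd: "measure N (\<Union>\<F>) \<le> e" if "\<F> \<subseteq> \<D>" "finite \<F>" for \<F> using fin[OF that] by simp
      have "\<Union>\<D> \<in> fmeasurable N" "measure N (\<Union>\<D>) \<le> e"
        using fmeasurable_Union_bound[OF \<D>(1) sing bnd] measure_Union_bound[OF \<D>(1) sing bnd] by auto
      then have "emeasure N (\<Union>\<D>) \<le> ennreal e"
        by (simp add: emeasure_eq_measure2 ennreal_leI)
      moreover have "emeasure N A \<le> emeasure N (\<Union>\<D>)"
        by (rule emeasure_mono[OF \<D>(4)]) (use \<open>\<Union>\<D> \<in> fmeasurable N\<close> in auto)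
      ultimately show ?thesis by simp
    qed
    then have "emeasure N A \<le> 0 + ennreal e" if "e > 0" for e using that by simp
    then have "emeasure N A \<le> 0" using ennreal_le_epsilon[of 0 "emeasure N A"] by blast
    then show ?thesis by simp
  qed
  have left: "{..0} \<in> null_sets N"
  proof -
    have "(\<Union>n::nat. {- real n<..0}) \<in> null_sets N"
    proof (rule null_sets_UN)
      fix n :: nat
      have "G 0 - G (- real n) = 0" using T by (auto simp: G_def)
      then show "{- real n<..0} \<in> null_sets N" using N[of "- real n" 0] by (auto simp: null_sets_def setsN)
    qed
    moreover have "(\<Union>n::nat. {- real n<..0}) = {..0}"
      by (auto simp: minus_less_iff intro: reals_Archimedean2)
    ultimately show ?thesis by simp
  qed
  have right: "{T<..} \<in> null_sets N"
  proof -
    have "(\<Union>n::nat. {T<..T + real n}) \<in> null_sets N"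
    proof (rule null_sets_UN)
      fix n :: nat
      have "G (T + real n) - G T = 0" using T by (auto simp: G_def)
      then show "{T<..T + real n} \<in> null_sets N" using N[of T "T + real n"] by (auto simp: null_sets_def setsN)
    qed
    moreover have "(\<Union>n::nat. {T<..T + real n}) = {T<..}"
    proof (intro equalityI subsetI)
      fix x assume x: "x \<in> {T<..}"
      obtain n :: nat where "x - T < real n" using reals_Archimedean2 by blast
      then show "x \<in> (\<Union>n::nat. {T<..T + real n})" using x by (intro UN_I[of n]) auto
    qed auto
    ultimately show ?thesis by simp
  qed
  have "absolutely_continuous lborel N"
    unfolding absolutely_continuous_def
  proof
    fix A :: "real set" assume A: "A \<in> null_sets lborel"
    have "A \<inter> {0..T} \<in> null_sets lborel" using A by (intro null_set_Int2) auto
    then have "A \<inter> {0..T} \<in> null_sets N" using inner[of "A \<inter> {0..T}"] by (auto simp: null_sets_def setsN)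
    then have "A \<inter> {0..T} \<union> ({..0} \<union> {T<..}) \<in> null_sets N"
      using left right by auto
    then show "A \<in> null_sets N"
      by (rule null_sets_subset) (use A in \<open>auto simp: setsN null_sets_def\<close>)
  qed
  then obtain f where f: "f \<in> borel_measurable lborel" "density lborel f = N"
    using sigma_finite_measure.Radon_Nikodym[OF sigma_finite_lborel, of N] setsN by auto
  define g where "g x = enn2real (f x * indicator {0<..T} x)" for x
  have fN: "(\<integral>\<^sup>+x. f x * indicator {0<..t} x \<partial>lborel) = ennreal (F t - F 0)" if "t \<in> {0..T}" for t
  proof -
    have "(\<integral>\<^sup>+x. f x * indicator {0<..t} x \<partial>lborel) = emeasure (density lborel f) {0<..t}"
      by (rule emeasure_density[symmetric]) (use f in auto)
    also have "\<dots> = ennreal (F t - F 0)" unfolding f(2) using that N[of 0 t] by (simp add: GF)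
    finally show ?thesis .
  qed
  have meas: "g \<in> borel_measurable lborel" using f(1) unfolding g_def by measurable
  have AEfin: "AE x in lborel. f x * indicator {0<..T} x \<noteq> \<infinity>"
    by (rule nn_integral_PInf_AE) (use f(1) fN[of T] T in auto)
  have gint: "(\<integral>\<^sup>+x. ennreal (g x) * indicator {0..t} x \<partial>lborel) = ennreal (F t - F 0)" if t: "t \<in> {0..T}" for t
  proof -
    have "(\<integral>\<^sup>+x. ennreal (g x) * indicator {0..t} x \<partial>lborel) = (\<integral>\<^sup>+x. f x * indicator {0<..t} x \<partial>lborel)"
    proof (rule nn_integral_cong_AE)
      show "AE x in lborel. ennreal (g x) * indicator {0..t} x = f x * indicator {0<..t} x"
        using AEfin by eventually_elim (use t in \<open>auto simp: g_def indicator_def less_top[symmetric]\<close>)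
    qed
    then show ?thesis using fN[OF t] by simp
  qed
  have gsupp: "g x = 0" if "x \<notin> {0<..T}" for x using that by (simp add: g_def)
  have gind: "ennreal (g x) * indicator {0..T} x = ennreal (g x)" for x
    using gsupp[of x] by (auto simp: indicator_def)
  have gpos: "g x \<ge> 0" for x by (simp add: g_def)
  have int: "integrable lborel g"
    by (rule integrableI_nonneg[OF meas]) (use gint[of T] T gpos in \<open>auto simp: gind\<close>)
  have "F t = F 0 + (LINT s:{0..t}|lborel. g s)" if t: "t \<in> {0..T}" for t
  proof -
    have "(LINT s:{0..t}|lborel. g s) = enn2real (\<integral>\<^sup>+x. ennreal (indicator {0..t} x *\<^sub>R g x) \<partial>lborel)"
      unfolding set_lebesgue_integral_def
      by (rule integral_eq_nn_integral) (use meas gpos in auto)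
    also have "(\<integral>\<^sup>+x. ennreal (indicator {0..t} x *\<^sub>R g x) \<partial>lborel) = ennreal (F t - F 0)"
      unfolding gint[OF t, symmetric] by (rule nn_integral_cong) (auto simp: indicator_def)
    finally show ?thesis using mono[of 0 t] t by simp
  qed
  with int gsupp show ?thesis by blast
qed

lemma set_integrable_Icc:
  fixes f :: "real \<Rightarrow> 'a::{banach,second_countable_topology}"
  shows "integrable lborel f \<Longrightarrow> set_integrable lborel {a..b} f"
  unfolding set_integrable_def by (rule integrable_mult_indicator) auto

lemma abs_continuous_imp_indefinite_integral:
  assumes T: "T > 0" and F: "abs_continuous T F"
  shows "\<exists>g. integrable lborel g \<and> (\<forall>x. x \<notin> {0<..T} \<longrightarrow> g x = 0) \<and>
    (\<forall>t\<in>{0..T}. F t = F 0 + (LINT s:{0..t}|lborel. g s))"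
proof -
  let ?P = "positive_variation F"
  let ?Q = "\<lambda>t. positive_variation F t - F t"
  have P: "abs_continuous T ?P" by (rule abs_continuous_positive_variation[OF F])
  have Q: "abs_continuous T ?Q" by (rule abs_continuous_diff[OF P F])
  have Pm: "?P s \<le> ?P t" if "0 \<le> s" "s \<le> t" "t \<le> T" for s t
    using positive_variation_mono[OF F that(2,3)] .
  have Qm: "?Q s \<le> ?Q t" if "0 \<le> s" "s \<le> t" "t \<le> T" for s t
    using positive_variation_minus_mono[OF F that] .
  obtain p where p: "integrable lborel p" "\<And>x. x \<notin> {0<..T} \<Longrightarrow> p x = 0"
    "\<And>t. t \<in> {0..T} \<Longrightarrow> ?P t = ?P 0 + (LINT s:{0..t}|lborel. p s)"
    using mono_abs_continuous_imp_indefinite_integral[OF T P] Pm by blast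
  obtain q where q: "integrable lborel q" "\<And>x. x \<notin> {0<..T} \<Longrightarrow> q x = 0"
    "\<And>t. t \<in> {0..T} \<Longrightarrow> ?Q t = ?Q 0 + (LINT s:{0..t}|lborel. q s)"
    using mono_abs_continuous_imp_indefinite_integral[OF T Q] Qm by blast
  define r where "r = (\<lambda>x. p x - q x)"
  have "F t = F 0 + (LINT s:{0..t}|lborel. r s)" if "t \<in> {0..T}" for t
  proof -
    have "(LINT s:{0..t}|lborel. r s) = (LINT s:{0..t}|lborel. p s) - (LINT s:{0..t}|lborel. q s)"
      unfolding r_def by (rule set_integral_diff(2)) (rule set_integrable_Icc[OF p(1)] set_integrable_Icc[OF q(1)])+
    with p(3)[OF that] q(3)[OF that] show ?thesis by linarith
  qed
  moreover have "integrable lborel r" unfolding r_def by (intro Bochner_Integration.integrable_diff p(1) q(1))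
  moreover have "r x = 0" if "x \<notin> {0<..T}" for x using p(2)[OF that] q(2)[OF that] by (simp add: r_def)
  ultimately show ?thesis by blast
qed

text \<open>Applied to \<open>Re\<close> and \<open>Im\<close>.\<close>

lemma AC_imp_abs_continuous:
  assumes v: "v \<in> AC T" and L: "\<And>x y. L (x - y) = L x - L y" "\<And>x. \<bar>L x\<bar> \<le> cmod x"
  shows "abs_continuous T (\<lambda>t. L (v t))"
  unfolding abs_continuous_def
proof (intro allI impI)
  fix \<epsilon> :: real assume \<epsilon>: "\<epsilon> > 0"
  obtain d where d: "d > 0" and dd: "\<forall>(n::nat) a b. (\<forall>i<n. 0 \<le> a i \<and> a i \<le> b i \<and> b i \<le> T) \<and>
      (\<forall>i<n. \<forall>j<n. i \<noteq> j \<longrightarrow> {a i<..<b i} \<inter> {a j<..<b j} = {}) \<and>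
      (\<Sum>i<n. b i - a i) < d \<longrightarrow> (\<Sum>i<n. cmod (v (b i) - v (a i))) < \<epsilon>"
    using v[unfolded AC_def mem_Collect_eq, THEN spec, THEN mp, OF \<epsilon>] by (elim exE conjE) (rule that)
  have "\<bar>increment (\<lambda>t. L (v t)) D\<bar> < \<epsilon>" if D: "D \<in> interval_systems 0 T" "total_length D < d" for D
  proof -
    note D' = interval_systemsD[OF D(1)]
    obtain e where e: "bij_betw e {..<card D} D"
      using ex_bij_betw_nat_finite[OF D'(1)] by (auto simp: atLeast0LessThan)
    have eD: "e i \<in> D" if "i < card D" for i using e that by (auto simp: bij_betw_def)
    have re: "(\<Sum>i<card D. H (e i)) = (\<Sum>p\<in>D. H p)" for H :: "real \<times> real \<Rightarrow> real"
      by (rule sum.reindex_bij_betw[OF e])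
    have "(\<Sum>i<card D. cmod (v (snd (e i)) - v (fst (e i)))) < \<epsilon>"
    proof (rule dd[THEN spec, THEN spec, THEN spec, THEN mp], intro conjI)
      show "\<forall>i<card D. 0 \<le> fst (e i) \<and> fst (e i) \<le> snd (e i) \<and> snd (e i) \<le> T"
        using D'(2-4) eD by blast
      show "\<forall>i<card D. \<forall>j<card D. i \<noteq> j \<longrightarrow> {fst (e i)<..<snd (e i)} \<inter> {fst (e j)<..<snd (e j)} = {}"
      proof (intro allI impI)
        fix i j assume ij: "i < card D" "j < card D" "i \<noteq> j"
        then have "e i \<noteq> e j" using e by (auto simp: bij_betw_def inj_on_def)
        then show "{fst (e i)<..<snd (e i)} \<inter> {fst (e j)<..<snd (e j)} = {}"
          using D'(5)[OF eD[OF ij(1)] eD[OF ij(2)]] by fastforce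
      qed
      show "(\<Sum>i<card D. snd (e i) - fst (e i)) < d"
        using D(2) re[of "\<lambda>p. snd p - fst p"] by (simp add: increment_def)
    qed
    moreover have "\<bar>increment (\<lambda>t. L (v t)) D\<bar> \<le> (\<Sum>p\<in>D. cmod (v (snd p) - v (fst p)))"
      unfolding increment_def L(1)[symmetric] by (rule order_trans[OF sum_abs]) (intro sum_mono L(2))
    ultimately show ?thesis using re[of "\<lambda>p. cmod (v (snd p) - v (fst p))"] by simp
  qed
  then show "\<exists>d>0. \<forall>D\<in>interval_systems 0 T. total_length D < d \<longrightarrow> \<bar>increment (\<lambda>t. L (v t)) D\<bar> < \<epsilon>"
    using d by blast
qed

theorem AC_imp_indefinite_integral:
  assumes T: "T > 0" and v: "v \<in> AC T"
  shows "\<exists>g::real \<Rightarrow> complex. integrable lborel g \<and> (\<forall>x. x \<notin> {0<..T} \<longrightarrow> g x = 0) \<and>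
    (\<forall>t\<in>{0..T}. v t = v 0 + (LINT s:{0..t}|lborel. g s))"
proof -
  have acRe: "abs_continuous T (\<lambda>t. Re (v t))"
    by (rule AC_imp_abs_continuous[OF v]) (simp_all add: abs_Re_le_cmod)
  have acIm: "abs_continuous T (\<lambda>t. Im (v t))"
    by (rule AC_imp_abs_continuous[OF v]) (simp_all add: abs_Im_le_cmod)
  obtain p where p: "integrable lborel p" "\<And>x. x \<notin> {0<..T} \<Longrightarrow> p x = 0"
    "\<And>t. t \<in> {0..T} \<Longrightarrow> Re (v t) = Re (v 0) + (LINT s:{0..t}|lborel. p s)"
    using abs_continuous_imp_indefinite_integral[OF T acRe] by blast
  obtain q where q: "integrable lborel q" "\<And>x. x \<notin> {0<..T} \<Longrightarrow> q x = 0"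
    "\<And>t. t \<in> {0..T} \<Longrightarrow> Im (v t) = Im (v 0) + (LINT s:{0..t}|lborel. q s)"
    using abs_continuous_imp_indefinite_integral[OF T acIm] by blast
  define g where "g x = complex_of_real (p x) + \<i> * complex_of_real (q x)" for x
  have "v t = v 0 + (LINT s:{0..t}|lborel. g s)" if "t \<in> {0..T}" for t
  proof -
    have s: "set_integrable lborel {0..t} (\<lambda>s. complex_of_real (p s))" "set_integrable lborel {0..t} (\<lambda>s. complex_of_real (q s))"
      using p(1) q(1) by (auto intro!: set_integrable_Icc)
    have "(LINT s:{0..t}|lborel. g s) = (LINT s:{0..t}|lborel. complex_of_real (p s)) + \<i> * (LINT s:{0..t}|lborel. complex_of_real (q s))"
      unfolding g_def using s by (simp add: set_integral_add(2) set_integral_mult_right)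
    also have "\<dots> = complex_of_real (LINT s:{0..t}|lborel. p s) + \<i> * complex_of_real (LINT s:{0..t}|lborel. q s)"
      by (simp add: set_integral_complex_of_real)
    finally show ?thesis using p(3)[OF that] q(3)[OF that] by (simp add: complex_eq_iff)
  qed
  moreover have "integrable lborel g" unfolding g_def using p(1) q(1) by auto
  moreover have "g x = 0" if "x \<notin> {0<..T}" for x using p(2) q(2) that by (simp add: g_def)
  ultimately show ?thesis by blast
qed

section \<open>Prabhakar kernels and their convolution semigroup\<close>

text \<open>Restrict Euler's integral to \<open>{A..A+1}\<close>.  As \<open>A\<close> is arbitrary, this makes the Gamma function grow
  faster than any exponential.\<close>

lemma Gamma_lower_bound:
  fixes A x :: real
  assumes "A > 0" "x \<ge> 1"
  shows "A powr (x - 1) * exp (- (A + 1)) \<le> Gamma x"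
proof -
  let ?f = "\<lambda>t::real. t powr (x - 1) / exp t"
  have G: "(?f has_integral Gamma x) {0..}" by (rule Gamma_integral_real) (use assms in simp)
  have int: "?f integrable_on {A..A+1}"
    by (rule integrable_on_subinterval[OF has_integral_integrable[OF G]]) (use assms in auto)
  have "integral {A..A+1} (\<lambda>t. A powr (x - 1) * exp (- (A + 1))) \<le> integral {A..A+1} ?f"
  proof (rule integral_le[OF _ int])
    fix t assume t: "t \<in> {A..A+1}"
    have "A powr (x - 1) * exp (- (A + 1)) \<le> t powr (x - 1) * exp (- t)"
      using t assms by (intro mult_mono powr_mono2) auto
    then show "A powr (x - 1) * exp (- (A + 1)) \<le> ?f t" by (simp add: exp_minus field_simps)
  qed auto
  also have "\<dots> \<le> integral {0..} ?f"
    by (rule integral_subset_le[OF _ int has_integral_integrable[OF G]]) (use assms in auto)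
  finally show ?thesis using G by (simp add: integral_unique)
qed

text \<open>Take \<open>A\<close> with \<open>A powr \<rho> = 2 * r + 1\<close> in the lower bound for Gamma: the terms are then dominated
  by a geometric series of ratio \<open>1/2\<close>.\<close>

lemma summable_power_div_Gamma:
  fixes \<rho> \<mu> r :: real
  assumes "\<rho> > 0" "\<mu> > 0" "r \<ge> 0"
  shows "summable (\<lambda>n. r ^ n / Gamma (\<rho> * real n + \<mu>))"
proof (rule summable_comparison_test_ev)
  define A where "A = (2 * r + 1) powr (1 / \<rho>)"
  have A: "A > 0" "A powr \<rho> = 2 * r + 1" using assms by (auto simp: A_def powr_powr)
  define C where "C = inverse (A powr (\<mu> - 1) * exp (- (A + 1)))"
  have C: "C > 0" using A by (simp add: C_def)
  show "summable (\<lambda>n. C * (1/2) ^ n)" by (intro summable_mult summable_geometric) simp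
  have "\<forall>\<^sub>F n in sequentially. 1 / \<rho> \<le> real n" using filterlim_real_sequentially
    by (simp add: filterlim_at_top)
  then show "\<forall>\<^sub>F n in sequentially. norm (r ^ n / Gamma (\<rho> * real n + \<mu>)) \<le> C * (1/2) ^ n"
  proof eventually_elim
    case (elim n)
    then have ge: "\<rho> * real n + \<mu> \<ge> 1" using assms by (simp add: field_simps)
    have "A powr (\<rho> * real n + \<mu> - 1) = (2 * r + 1) ^ n * A powr (\<mu> - 1)"
    proof -
      have "(2 * r + 1) ^ n = A powr (\<rho> * real n)"
        unfolding powr_powr[symmetric] A(2) using assms by (simp add: powr_realpow)
      then show ?thesis by (simp add: powr_add[symmetric] add_diff_eq)
    qed
    then have G: "(2 * r + 1) ^ n / C \<le> Gamma (\<rho> * real n + \<mu>)"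
      using Gamma_lower_bound[OF A(1) ge] by (simp add: C_def divide_inverse inverse_mult_distrib mult_ac)
    have "r ^ n * 2 ^ n \<le> (2 * r + 1) ^ n"
      unfolding power_mult_distrib[symmetric] using assms by (intro power_mono) auto
    then have "r ^ n \<le> C * (1/2)^n * ((2 * r + 1) ^ n / C)" using C by (simp add: field_simps)
    also have "\<dots> \<le> C * (1/2)^n * Gamma (\<rho> * real n + \<mu>)" using C by (intro mult_left_mono G) auto
    finally show ?case using assms ge Gamma_real_pos[of "\<rho> * real n + \<mu>"]
      by (simp add: field_simps)
  qed
qed

lemma norm_pochhammer_le:
  fixes \<gamma> :: complex
  shows "cmod (pochhammer \<gamma> n) \<le> pochhammer (cmod \<gamma>) n"
  unfolding pochhammer_prod prod_norm[symmetric]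
  by (intro prod_mono) (auto intro: order_trans[OF norm_triangle_ineq])

text \<open>Each factor \<open>c + k\<close> is at most \<open>(c + 1) * (k + 1)\<close>, so the quotient \<open>pochhammer c n / fact n\<close> grows at
  most exponentially and is absorbed by the Gamma function.\<close>

lemma pochhammer_le_power_fact:
  fixes c :: real
  assumes "c \<ge> 0"
  shows "pochhammer c n \<le> (c + 1) ^ n * fact n"
proof (induction n)
  case (Suc n)
  have "pochhammer c (Suc n) \<le> ((c + 1) ^ n * fact n) * ((c + 1) * (real n + 1))"
    unfolding pochhammer_Suc
  proof (rule mult_mono[OF Suc])
    show "c + real n \<le> (c + 1) * (real n + 1)" using assms by (simp add: algebra_simps)
  qed (use assms in \<open>auto simp: pochhammer_nonneg\<close>)
  then show ?case by (simp add: algebra_simps)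
qed simp

text \<open>The coefficients of the three-parameter Mittag--Leffler series with the powers of \<open>w\<close> included.
  The general type serves both the complex coefficients and, for real arguments, their majorants.\<close>

definition ml_coeff :: "real \<Rightarrow> 'a::real_normed_field \<Rightarrow> 'a \<Rightarrow> real \<Rightarrow> nat \<Rightarrow> 'a" where
  "ml_coeff \<rho> w \<gamma> \<mu> n = pochhammer \<gamma> n * w ^ n / (fact n * of_real (Gamma (\<rho> * real n + \<mu>)))"

lemma summable_ml_coeff_real:
  fixes \<rho> \<mu> r c :: real
  assumes "\<rho> > 0" "\<mu> > 0" "r \<ge> 0" "c \<ge> 0"
  shows "summable (ml_coeff \<rho> r c \<mu>)"
proof (rule summable_comparison_test)
  show "summable (\<lambda>n. ((c + 1) * r) ^ n / Gamma (\<rho> * real n + \<mu>))"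
    using assms by (intro summable_power_div_Gamma) auto
  have "norm (ml_coeff \<rho> r c \<mu> n) \<le> ((c + 1) * r) ^ n / Gamma (\<rho> * real n + \<mu>)" for n
  proof -
    have G: "Gamma (\<rho> * real n + \<mu>) > 0" using assms by (intro Gamma_real_pos add_nonneg_pos) auto
    have "pochhammer c n \<ge> 0" using assms unfolding pochhammer_prod by (intro prod_nonneg) auto
    then have "norm (ml_coeff \<rho> r c \<mu> n) = pochhammer c n / fact n * (r ^ n / Gamma (\<rho> * real n + \<mu>))"
      using G assms by (simp add: ml_coeff_def abs_mult)
    also have "\<dots> \<le> (c + 1) ^ n * (r ^ n / Gamma (\<rho> * real n + \<mu>))"
      using pochhammer_le_power_fact[OF assms(4), of n] G assms
      by (intro mult_right_mono) (auto simp: divide_le_eq)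
    finally show ?thesis by (simp add: power_mult_distrib)
  qed
  then show "\<exists>N. \<forall>n\<ge>N. norm (ml_coeff \<rho> r c \<mu> n) \<le> ((c + 1) * r) ^ n / Gamma (\<rho> * real n + \<mu>)"
    by blast
qed

text \<open>Kernels are extended by zero to the left of the origin.  The Volterra convolution over \<open>{0..t}\<close>
  then becomes a convolution over the whole line, to which translation invariance and Fubini apply
  without any bookkeeping of the domain of integration.\<close>

definition power_kernel :: "real \<Rightarrow> real \<Rightarrow> real" where
  "power_kernel a x = (if x > 0 then x powr (a - 1) else 0)"

lemma power_kernel_nonneg [simp]: "0 \<le> power_kernel a x"
  by (simp add: power_kernel_def)

lemma power_kernel_eq_0: "x \<le> 0 \<Longrightarrow> power_kernel a x = 0"
  by (simp add: power_kernel_def)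

lemma borel_measurable_power_kernel [measurable]: "power_kernel a \<in> borel_measurable borel"
  unfolding power_kernel_def[abs_def] by measurable

text \<open>The substitution \<open>s = x * u\<close> turns this into Euler's Beta integral.\<close>

lemma power_kernel_convolution:
  assumes ab: "a > 0" "b > 0"
  shows "has_bochner_integral lborel (\<lambda>s. power_kernel a (x - s) * power_kernel b s) (Beta a b * power_kernel (a + b) x)"
proof (cases "x > 0")
  case False
  then have "(\<lambda>s. power_kernel a (x - s) * power_kernel b s) = (\<lambda>s. 0)"
    by (auto simp: power_kernel_def)
  then show ?thesis using False by (simp add: power_kernel_def has_bochner_integral_zero)
next
  case True
  have eq: "indicator {0..1} t *\<^sub>R (t powr (b - 1) * (1 - t) powr (a - 1)) = power_kernel a (1 - t) * power_kernel b t" for t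
    by (auto simp: power_kernel_def indicator_def mult.commute)
  have "set_integrable lborel {0..1} (\<lambda>t. t powr (b - 1) * (1 - t) powr (a - 1))"
    by (rule integrable_Beta) (use ab in auto)
  moreover from this have "(LINT t:{0..1}|lborel. t powr (b - 1) * (1 - t) powr (a - 1)) = Beta b a"
    using set_borel_integral_eq_integral(2) has_integral_Beta_real[of b a] ab integral_unique by metis
  ultimately have base: "has_bochner_integral lborel (\<lambda>t. power_kernel a (1 - t) * power_kernel b t) (Beta a b)"
    unfolding set_integrable_def set_lebesgue_integral_def eq by (simp add: has_bochner_integral_iff Beta_commute)
  have sc: "power_kernel a (x - (0 + x * u)) * power_kernel b (0 + x * u) =
     x powr (a + b - 2) * (power_kernel a (1 - u) * power_kernel b u)" for u
  proof -
    have "x - x * u = x * (1 - u)" by (simp add: algebra_simps)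
    moreover have "x powr (a + b - 2) = x powr (a - 1) * x powr (b - 1)"
      by (simp add: powr_add[symmetric] algebra_simps)
    ultimately show ?thesis using True
      by (auto simp: power_kernel_def powr_mult zero_less_mult_iff)
  qed
  have "has_bochner_integral lborel (\<lambda>u. power_kernel a (x - (0 + x * u)) * power_kernel b (0 + x * u)) (x powr (a + b - 2) * Beta a b)"
    unfolding sc by (rule has_bochner_integral_mult_right[OF base])
  moreover have "x powr (a + b - 2) * Beta a b = (Beta a b * power_kernel (a + b) x) /\<^sub>R \<bar>x\<bar>"
    using True by (simp add: power_kernel_def powr_diff power2_eq_square field_simps)
  ultimately show ?thesis
    using lborel_has_bochner_integral_real_affine_iff[of x "\<lambda>s. power_kernel a (x - s) * power_kernel b s" _ 0] True by simp
qed

lemma vandermonde_fact: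
  fixes a b :: "'a::field_char_0"
  shows "(\<Sum>i\<le>n. pochhammer a i / fact i * (pochhammer b (n - i) / fact (n - i))) = pochhammer (a + b) n / fact n"
proof -
  have "(\<Sum>i\<le>n. pochhammer a i / fact i * (pochhammer b (n - i) / fact (n - i)))
     = (\<Sum>i\<le>n. of_nat (n choose i) * pochhammer a i * pochhammer b (n - i) / fact n)"
    by (intro sum.cong refl) (simp add: binomial_fact)
  then show ?thesis by (simp add: pochhammer_binomial_sum sum_divide_distrib)
qed

text \<open>The Beta function cancels the two Gamma factors and leaves the single one of the sum of the
  orders; the Vandermonde identity for rising factorials adds the upper parameters.\<close>

lemma ml_coeff_convolution:
  fixes w \<gamma>1 \<gamma>2 :: "'a::real_normed_field"
  assumes "\<rho> > 0" "\<mu>1 > 0" "\<mu>2 > 0"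
  shows "(\<Sum>i\<le>n. ml_coeff \<rho> w \<gamma>1 \<mu>1 i * ml_coeff \<rho> w \<gamma>2 \<mu>2 (n - i) *
      of_real (Beta (\<rho> * real i + \<mu>1) (\<rho> * real (n - i) + \<mu>2))) = ml_coeff \<rho> w (\<gamma>1 + \<gamma>2) (\<mu>1 + \<mu>2) n"
proof -
  let ?G = "of_real (Gamma (\<rho> * real n + (\<mu>1 + \<mu>2))) :: 'a"
  have "ml_coeff \<rho> w \<gamma>1 \<mu>1 i * ml_coeff \<rho> w \<gamma>2 \<mu>2 (n - i) * of_real (Beta (\<rho> * real i + \<mu>1) (\<rho> * real (n - i) + \<mu>2))
      = pochhammer \<gamma>1 i / fact i * (pochhammer \<gamma>2 (n - i) / fact (n - i)) * (w ^ n / ?G)" if i: "i \<le> n" for i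
  proof -
    define x y where "x = \<rho> * real i + \<mu>1" and "y = \<rho> * real (n - i) + \<mu>2"
    have "x > 0" "y > 0" using assms by (auto simp: x_def y_def intro: add_nonneg_pos)
    then have nz: "Gamma x \<noteq> 0" "Gamma y \<noteq> 0" using Gamma_real_pos[of x] Gamma_real_pos[of y] by linarith+
    have xy: "\<rho> * real n + (\<mu>1 + \<mu>2) = x + y" using i by (simp add: x_def y_def of_nat_diff algebra_simps)
    have w: "w ^ n = w ^ i * w ^ (n - i)" using i by (simp add: power_add[symmetric])
    show ?thesis
      unfolding ml_coeff_def xy w x_def[symmetric] y_def[symmetric] Beta_def using nz by (simp add: field_simps)
  qed
  then have "(\<Sum>i\<le>n. ml_coeff \<rho> w \<gamma>1 \<mu>1 i * ml_coeff \<rho> w \<gamma>2 \<mu>2 (n - i) *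
      of_real (Beta (\<rho> * real i + \<mu>1) (\<rho> * real (n - i) + \<mu>2)))
    = (\<Sum>i\<le>n. pochhammer \<gamma>1 i / fact i * (pochhammer \<gamma>2 (n - i) / fact (n - i))) * (w ^ n / ?G)"
    unfolding sum_distrib_right by (intro sum.cong) auto
  then show ?thesis unfolding vandermonde_fact by (simp add: ml_coeff_def)
qed

locale prabhakar =
  fixes \<rho> :: real and \<omega> :: complex
  assumes \<rho>: "\<rho> > 0"
begin

abbreviation coeff :: "complex \<Rightarrow> real \<Rightarrow> nat \<Rightarrow> complex" where
  "coeff \<equiv> ml_coeff \<rho> \<omega>"

definition pk :: "complex \<Rightarrow> real \<Rightarrow> real \<Rightarrow> complex" where
  "pk \<gamma> \<mu> x = (if x > 0 then prabhakar_kernel \<rho> \<mu> \<omega> \<gamma> x else 0)"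

lemma order_pos: "\<mu> > 0 \<Longrightarrow> \<rho> * real n + \<mu> > 0"
  using \<rho> by (intro add_nonneg_pos) auto

lemma norm_coeff_le:
  assumes "\<mu> > 0"
  shows "cmod (coeff \<gamma> \<mu> n) \<le> ml_coeff \<rho> (cmod \<omega>) (cmod \<gamma>) \<mu> n"
proof -
  have "Gamma (\<rho> * real n + \<mu>) > 0" using order_pos[OF assms] by (rule Gamma_real_pos)
  then show ?thesis using norm_pochhammer_le[of \<gamma> n]
    by (simp add: ml_coeff_def norm_mult norm_divide norm_power divide_right_mono mult_right_mono)
qed

lemma summable_coeff:
  assumes "\<mu> > 0" "r \<ge> 0"
  shows "summable (\<lambda>n. cmod (coeff \<gamma> \<mu> n) * r ^ n)"
proof (rule summable_comparison_test)
  show "summable (ml_coeff \<rho> (cmod \<omega> * r) (cmod \<gamma>) \<mu>)"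
    using assms \<rho> by (intro summable_ml_coeff_real) auto
  have "norm (cmod (coeff \<gamma> \<mu> n) * r ^ n) \<le> ml_coeff \<rho> (cmod \<omega> * r) (cmod \<gamma>) \<mu> n" for n
    using mult_right_mono[OF norm_coeff_le[OF assms(1), of \<gamma> n], of "r ^ n"] assms(2)
    by (simp add: ml_coeff_def power_mult_distrib abs_mult mult_ac)
  then show "\<exists>N. \<forall>n\<ge>N. norm (cmod (coeff \<gamma> \<mu> n) * r ^ n) \<le> ml_coeff \<rho> (cmod \<omega> * r) (cmod \<gamma>) \<mu> n"
    by blast
qed

lemma power_kernel_shift: "x > 0 \<Longrightarrow> power_kernel (\<rho> * real n + \<mu>) x = (x powr \<rho>) ^ n * power_kernel \<mu> x"
proof -
  assume x: "x > 0"
  then have "(x powr \<rho>) ^ n = x powr (\<rho> * real n)" by (simp add: powr_realpow[symmetric] powr_powr)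
  then show ?thesis using x by (simp add: power_kernel_def powr_add[symmetric] add_diff_eq)
qed

lemma pk_summable_norm:
  assumes "\<mu> > 0"
  shows "summable (\<lambda>n. norm (coeff \<gamma> \<mu> n * of_real (power_kernel (\<rho> * real n + \<mu>) x)))"
proof (cases "x > 0")
  case True
  have "summable (\<lambda>n. cmod (coeff \<gamma> \<mu> n) * (x powr \<rho>) ^ n * power_kernel \<mu> x)"
    by (intro summable_mult2 summable_coeff assms) simp
  then show ?thesis by (simp add: power_kernel_shift[OF True] norm_mult norm_power mult_ac)
qed (simp add: power_kernel_def)

lemma pk_eq_suminf:
  assumes "\<mu> > 0"
  shows "pk \<gamma> \<mu> x = (\<Sum>n. coeff \<gamma> \<mu> n * of_real (power_kernel (\<rho> * real n + \<mu>) x))"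
proof (cases "x > 0")
  case True
  have "summable (\<lambda>n. cmod (coeff \<gamma> \<mu> n) * (x powr \<rho>) ^ n)"
    by (intro summable_coeff assms) simp
  then have "summable (\<lambda>n. norm (coeff \<gamma> \<mu> n * of_real (x powr \<rho>) ^ n))"
    by (simp add: norm_mult norm_power)
  then have s: "summable (\<lambda>n. coeff \<gamma> \<mu> n * of_real (x powr \<rho>) ^ n)"
    by (rule summable_norm_cancel)
  have "pk \<gamma> \<mu> x = of_real (x powr (\<mu> - 1)) * (\<Sum>n. coeff \<gamma> \<mu> n * of_real (x powr \<rho>) ^ n)"
    using True by (simp add: pk_def prabhakar_kernel_def mittag_leffler3_def ml_coeff_def Gamma_complex_of_real power_mult_distrib mult_ac
        del: of_real_add of_real_mult)
  also have "\<dots> = (\<Sum>n. of_real (x powr (\<mu> - 1)) * (coeff \<gamma> \<mu> n * of_real (x powr \<rho>) ^ n))"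
    by (rule suminf_mult[OF s, symmetric])
  also have "\<dots> = (\<Sum>n. coeff \<gamma> \<mu> n * of_real (power_kernel (\<rho> * real n + \<mu>) x))"
    using True by (intro suminf_cong) (simp add: power_kernel_shift, simp add: power_kernel_def)
  finally show ?thesis .
qed (simp add: pk_def power_kernel_def)

lemma borel_measurable_pk [measurable]:
  assumes "\<mu> > 0"
  shows "pk \<gamma> \<mu> \<in> borel_measurable borel"
proof -
  have "pk \<gamma> \<mu> = (\<lambda>x. \<Sum>n. coeff \<gamma> \<mu> n * of_real (power_kernel (\<rho> * real n + \<mu>) x))"
    using pk_eq_suminf[OF assms] by (intro ext)
  then show ?thesis by simp
qed

text \<open>On \<open>(0,T]\<close> the Mittag--Leffler factor is bounded by its majorant series at \<open>T\<close>, so the singularity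
  of the kernel is that of its leading power.\<close>

lemma pk_bound:
  assumes "\<mu> > 0" "T > 0"
  obtains B where "B > 0" "\<And>x. x \<le> T \<Longrightarrow> cmod (pk \<gamma> \<mu> x) \<le> B * power_kernel \<mu> x"
proof -
  let ?r = "T powr \<rho>"
  have s: "summable (\<lambda>n. cmod (coeff \<gamma> \<mu> n) * ?r ^ n)" by (intro summable_coeff assms) simp
  define B where "B = (\<Sum>n. cmod (coeff \<gamma> \<mu> n) * ?r ^ n) + 1"
  have "B > 0" unfolding B_def using s by (intro add_nonneg_pos suminf_nonneg) auto
  moreover have "cmod (pk \<gamma> \<mu> x) \<le> B * power_kernel \<mu> x" if x: "x \<le> T" for x
  proof (cases "x > 0")
    case True
    have "cmod (pk \<gamma> \<mu> x) \<le> (\<Sum>n. cmod (coeff \<gamma> \<mu> n) * ?r ^ n * power_kernel \<mu> x)"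
      unfolding pk_eq_suminf[OF assms(1)]
    proof (rule order_trans[OF summable_norm[OF pk_summable_norm[OF assms(1)]]], rule suminf_le)
      fix n
      have "(x powr \<rho>) ^ n \<le> ?r ^ n" using x True \<rho> by (intro power_mono powr_mono2) auto
      then show "norm (coeff \<gamma> \<mu> n * of_real (power_kernel (\<rho> * real n + \<mu>) x)) \<le> cmod (coeff \<gamma> \<mu> n) * ?r ^ n * power_kernel \<mu> x"
        using True by (simp add: power_kernel_shift norm_mult norm_power mult.assoc mult_left_mono mult_right_mono)
    qed (use pk_summable_norm[OF assms(1)] s in \<open>auto intro: summable_mult2\<close>)
    also have "\<dots> = (\<Sum>n. cmod (coeff \<gamma> \<mu> n) * ?r ^ n) * power_kernel \<mu> x"
      by (rule suminf_mult2[OF s, symmetric])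
    also have "\<dots> \<le> B * power_kernel \<mu> x" by (intro mult_right_mono) (auto simp: B_def)
    finally show ?thesis .
  qed (simp add: pk_def power_kernel_def)
  ultimately show ?thesis using that by blast
qed

text \<open>For \<open>\<gamma> = 0\<close> only the leading term survives: these are the kernels of fractional, and for integer \<open>\<mu>\<close>
  of iterated, integration.\<close>

lemma pk_0: "\<mu> > 0 \<Longrightarrow> pk 0 \<mu> x = of_real (power_kernel \<mu> x / Gamma \<mu>)"
proof -
  assume \<mu>: "\<mu> > 0"
  have "pk 0 \<mu> x = (\<Sum>n\<in>{0}. coeff 0 \<mu> n * of_real (power_kernel (\<rho> * real n + \<mu>) x))"
    unfolding pk_eq_suminf[OF \<mu>] by (rule suminf_finite) (auto simp: ml_coeff_def pochhammer_0_left)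
  then show ?thesis by (simp add: ml_coeff_def)
qed

text \<open>The semigroup law.  Multiply the two kernels as a Cauchy product and integrate term by term: each
  product of powers gives a Beta integral, so \<open>ml_coeff_convolution\<close> evaluates the terms.  Applied to the
  real majorants, the same identity justifies the interchange.\<close>

theorem pk_convolution:
  assumes \<mu>: "\<mu>1 > 0" "\<mu>2 > 0"
  shows "has_bochner_integral lborel (\<lambda>s. pk \<gamma>1 \<mu>1 (x - s) * pk \<gamma>2 \<mu>2 s) (pk (\<gamma>1 + \<gamma>2) (\<mu>1 + \<mu>2) x)"
proof -
  define a where "a i s = coeff \<gamma>1 \<mu>1 i * of_real (power_kernel (\<rho> * real i + \<mu>1) (x - s))" for i s
  define b where "b i s = coeff \<gamma>2 \<mu>2 i * of_real (power_kernel (\<rho> * real i + \<mu>2) s)" for i s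
  define f where "f n s = (\<Sum>i\<le>n. a i s * b (n - i) s)" for n s
  have na: "summable (\<lambda>i. norm (a i s))" for s unfolding a_def by (rule pk_summable_norm[OF \<mu>(1)])
  have nb: "summable (\<lambda>i. norm (b i s))" for s unfolding b_def by (rule pk_summable_norm[OF \<mu>(2)])
  have fsum: "pk \<gamma>1 \<mu>1 (x - s) * pk \<gamma>2 \<mu>2 s = (\<Sum>n. f n s)" for s
    unfolding f_def pk_eq_suminf[OF \<mu>(1)] pk_eq_suminf[OF \<mu>(2)] a_def[symmetric] b_def[symmetric]
    by (rule Cauchy_product[OF na nb])
  have nf: "summable (\<lambda>n. norm (f n s))" for s
  proof (rule summable_comparison_test)
    show "summable (\<lambda>n. \<Sum>i\<le>n. norm (a i s) * norm (b (n - i) s))"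
      by (rule summable_Cauchy_product) (use na nb in simp_all)
    show "\<exists>N. \<forall>n\<ge>N. norm (norm (f n s)) \<le> (\<Sum>i\<le>n. norm (a i s) * norm (b (n - i) s))"
      unfolding f_def by (auto simp: norm_mult[symmetric] intro: norm_sum)
  qed
  have conv: "has_bochner_integral lborel (\<lambda>s. power_kernel (\<rho> * real i + \<mu>1) (x - s) * power_kernel (\<rho> * real (n - i) + \<mu>2) s)
      (Beta (\<rho> * real i + \<mu>1) (\<rho> * real (n - i) + \<mu>2) * power_kernel (\<rho> * real n + (\<mu>1 + \<mu>2)) x)"
    if "i \<le> n" for i n
  proof -
    have *: "\<rho> * real i + \<mu>1 + (\<rho> * real (n - i) + \<mu>2) = \<rho> * real n + (\<mu>1 + \<mu>2)"
      using that by (simp add: of_nat_diff algebra_simps)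
    then show ?thesis using power_kernel_convolution[OF order_pos[OF \<mu>(1), of i] order_pos[OF \<mu>(2), of "n - i"], of x] by (simp only: *)
  qed
  let ?P = "\<lambda>n. power_kernel (\<rho> * real n + (\<mu>1 + \<mu>2)) x"
  let ?B = "\<lambda>n i. Beta (\<rho> * real i + \<mu>1) (\<rho> * real (n - i) + \<mu>2)"
  have Bpos: "?B n i \<ge> 0" if "i \<le> n" for n i
    using Gamma_real_pos[OF order_pos[OF \<mu>(1), of i]] Gamma_real_pos[OF order_pos[OF \<mu>(2), of "n - i"]]
      Gamma_real_pos[OF add_pos_pos[OF order_pos[OF \<mu>(1), of i] order_pos[OF \<mu>(2), of "n - i"]]]
    by (simp add: Beta_def)
  have fint: "has_bochner_integral lborel (f n) (coeff (\<gamma>1 + \<gamma>2) (\<mu>1 + \<mu>2) n * of_real (?P n))" for n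
  proof -
    have "has_bochner_integral lborel (f n) (\<Sum>i\<le>n. (coeff \<gamma>1 \<mu>1 i * coeff \<gamma>2 \<mu>2 (n - i)) * of_real (?B n i * ?P n))"
      unfolding f_def
    proof (rule has_bochner_integral_sum)
      fix i assume "i \<in> {..n}"
      then have i: "i \<le> n" by simp
      have *: "(\<lambda>s. a i s * b (n - i) s) = (\<lambda>s. (coeff \<gamma>1 \<mu>1 i * coeff \<gamma>2 \<mu>2 (n - i)) *
          complex_of_real (power_kernel (\<rho> * real i + \<mu>1) (x - s) * power_kernel (\<rho> * real (n - i) + \<mu>2) s))"
        unfolding a_def b_def by (simp add: mult_ac)
      show "has_bochner_integral lborel (\<lambda>s. a i s * b (n - i) s) ((coeff \<gamma>1 \<mu>1 i * coeff \<gamma>2 \<mu>2 (n - i)) * of_real (?B n i * ?P n))"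
        unfolding * by (rule has_bochner_integral_mult_right[OF has_bochner_integral_of_real[OF conv[OF i]]])
    qed
    also have "(\<Sum>i\<le>n. (coeff \<gamma>1 \<mu>1 i * coeff \<gamma>2 \<mu>2 (n - i)) * of_real (?B n i * ?P n))
       = (\<Sum>i\<le>n. coeff \<gamma>1 \<mu>1 i * coeff \<gamma>2 \<mu>2 (n - i) * of_real (?B n i)) * of_real (?P n)"
      unfolding sum_distrib_right by (simp add: mult_ac)
    also have "\<dots> = coeff (\<gamma>1 + \<gamma>2) (\<mu>1 + \<mu>2) n * of_real (?P n)"
      unfolding ml_coeff_convolution[OF \<rho> \<mu>] ..
    finally show ?thesis .
  qed
  let ?m = "\<lambda>\<gamma>. ml_coeff \<rho> (cmod \<omega>) (cmod \<gamma>)"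
  let ?M = "\<lambda>n. ml_coeff \<rho> (cmod \<omega>) (cmod \<gamma>1 + cmod \<gamma>2) (\<mu>1 + \<mu>2) n * ?P n"
  have nint: "(\<integral>s. norm (f n s) \<partial>lborel) \<le> ?M n" for n
  proof -
    have summand: "has_bochner_integral lborel (\<lambda>s. norm (a i s) * norm (b (n - i) s)) (cmod (coeff \<gamma>1 \<mu>1 i) * cmod (coeff \<gamma>2 \<mu>2 (n - i)) * (?B n i * ?P n))"
      if i: "i \<le> n" for i
    proof -
      have *: "(\<lambda>s. norm (a i s) * norm (b (n - i) s)) = (\<lambda>s. (cmod (coeff \<gamma>1 \<mu>1 i) * cmod (coeff \<gamma>2 \<mu>2 (n - i))) *
          (power_kernel (\<rho> * real i + \<mu>1) (x - s) * power_kernel (\<rho> * real (n - i) + \<mu>2) s))"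
        unfolding a_def b_def by (simp add: norm_mult mult_ac)
      show ?thesis unfolding * by (rule has_bochner_integral_mult_right[OF conv[OF i]])
    qed
    have "has_bochner_integral lborel (\<lambda>s. \<Sum>i\<le>n. norm (a i s) * norm (b (n - i) s)) (\<Sum>i\<le>n. cmod (coeff \<gamma>1 \<mu>1 i) * cmod (coeff \<gamma>2 \<mu>2 (n - i)) * (?B n i * ?P n))"
      by (rule has_bochner_integral_sum) (use summand in auto)
    note T = this[unfolded has_bochner_integral_iff]
    have "(\<integral>s. norm (f n s) \<partial>lborel) \<le> (\<integral>s. (\<Sum>i\<le>n. norm (a i s) * norm (b (n - i) s)) \<partial>lborel)"
    proof (rule integral_mono)
      show "integrable lborel (\<lambda>s. norm (f n s))" using fint[of n] by (simp add: has_bochner_integral_iff)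
      show "norm (f n s) \<le> (\<Sum>i\<le>n. norm (a i s) * norm (b (n - i) s))" for s
        unfolding f_def norm_mult[symmetric] by (rule norm_sum)
    qed (use T in blast)
    also have "\<dots> = (\<Sum>i\<le>n. cmod (coeff \<gamma>1 \<mu>1 i) * cmod (coeff \<gamma>2 \<mu>2 (n - i)) * (?B n i * ?P n))" using T by blast
    also have "\<dots> \<le> (\<Sum>i\<le>n. ?m \<gamma>1 \<mu>1 i * ?m \<gamma>2 \<mu>2 (n - i) * (?B n i * ?P n))"
    proof (rule sum_mono)
      fix i assume "i \<in> {..n}"
      then have i: "i \<le> n" by simp
      show "cmod (coeff \<gamma>1 \<mu>1 i) * cmod (coeff \<gamma>2 \<mu>2 (n - i)) * (?B n i * ?P n) \<le> ?m \<gamma>1 \<mu>1 i * ?m \<gamma>2 \<mu>2 (n - i) * (?B n i * ?P n)"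
      proof (intro mult_right_mono mult_mono norm_coeff_le \<mu>)
        show "0 \<le> ?m \<gamma>1 \<mu>1 i" using norm_coeff_le[OF \<mu>(1), of \<gamma>1 i] norm_ge_zero order_trans by blast
      qed (use Bpos[OF i] in auto)
    qed
    also have "\<dots> = (\<Sum>i\<le>n. ?m \<gamma>1 \<mu>1 i * ?m \<gamma>2 \<mu>2 (n - i) * of_real (?B n i)) * ?P n"
      unfolding sum_distrib_right by (simp add: mult_ac)
    also have "\<dots> = ?M n" unfolding ml_coeff_convolution[OF \<rho> \<mu>] ..
    finally show ?thesis .
  qed
  have sumM: "summable ?M"
  proof (cases "x > 0")
    case True
    have "summable (\<lambda>n. ml_coeff \<rho> (cmod \<omega> * x powr \<rho>) (cmod \<gamma>1 + cmod \<gamma>2) (\<mu>1 + \<mu>2) n * power_kernel (\<mu>1 + \<mu>2) x)"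
      using \<mu> \<rho> by (intro summable_mult2 summable_ml_coeff_real) auto
    then show ?thesis by (simp add: power_kernel_shift[OF True] ml_coeff_def power_mult_distrib mult_ac)
  qed (simp add: power_kernel_def)
  have fi: "integrable lborel (f n)" for n using fint[of n] by (simp add: has_bochner_integral_iff)
  have snint: "summable (\<lambda>n. \<integral>s. norm (f n s) \<partial>lborel)"
    by (rule summable_comparison_test[OF _ sumM]) (use nint in \<open>auto intro!: exI[of _ 0]\<close>)
  have "integrable lborel (\<lambda>s. \<Sum>n. f n s)"
    by (rule integrable_suminf[OF fi _ snint]) (use nf in simp)
  moreover have "(\<integral>s. (\<Sum>n. f n s) \<partial>lborel) = (\<Sum>n. \<integral>s. f n s \<partial>lborel)"
    by (rule integral_suminf[OF fi _ snint]) (use nf in simp)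
  moreover have "(\<Sum>n. \<integral>s. f n s \<partial>lborel) = pk (\<gamma>1 + \<gamma>2) (\<mu>1 + \<mu>2) x"
    using fint \<mu> by (simp add: pk_eq_suminf has_bochner_integral_iff)
  ultimately show ?thesis by (simp add: fsum has_bochner_integral_iff)
qed

end

section \<open>Convolution on the line\<close>

definition convolution :: "(real \<Rightarrow> complex) \<Rightarrow> (real \<Rightarrow> complex) \<Rightarrow> real \<Rightarrow> complex" where
  "convolution k g t = (\<integral>s. k (t - s) * g s \<partial>lborel)"

lemma convolution_cong:
  assumes "\<And>s. s < t \<Longrightarrow> g s = h s" "\<And>x. x \<le> 0 \<Longrightarrow> k x = 0"
  shows "convolution k g t = convolution k h t"
  unfolding convolution_def
proof (rule Bochner_Integration.integral_cong[OF refl])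
  fix s show "k (t - s) * g s = k (t - s) * h s"
    using assms(1)[of s] assms(2)[of "t - s"] by (cases "s < t") auto
qed

lemma convolution_eq_0:
  assumes "\<And>x. x \<le> 0 \<Longrightarrow> k x = 0" "\<And>x. x \<le> 0 \<Longrightarrow> g x = 0" "t \<le> 0"
  shows "convolution k g t = 0"
proof -
  have "(\<lambda>s. k (t - s) * g s) = (\<lambda>s. 0)"
  proof
    fix s show "k (t - s) * g s = 0" using assms(1)[of "t - s"] assms(2)[of s] assms(3) by (cases "s \<le> 0") auto
  qed
  then show ?thesis by (simp add: convolution_def)
qed

lemma borel_measurable_convolution [measurable]:
  assumes [measurable]: "k \<in> borel_measurable borel" "g \<in> borel_measurable borel"
  shows "convolution k g \<in> borel_measurable borel"
  unfolding convolution_def[abs_def] by measurable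

text \<open>Fubini's theorem at a fixed point \<open>t\<close>.  A bound on the absolute convolution of the two kernels,
  uniform up to \<open>T\<close>, makes the double integrand integrable for every \<open>t\<close>, so that associativity
  holds pointwise and not just almost everywhere.\<close>

theorem convolution_assoc:
  fixes k1 k2 g :: "real \<Rightarrow> complex"
  assumes [measurable]: "k1 \<in> borel_measurable borel" "k2 \<in> borel_measurable borel"
    and g: "integrable lborel g" and supp: "\<And>x. x \<le> 0 \<Longrightarrow> g x = 0"
    and int: "\<And>x. x \<le> T \<Longrightarrow> integrable lborel (\<lambda>s. k1 (x - s) * k2 s)"
    and bound: "\<And>x. x \<le> T \<Longrightarrow> (\<integral>s. norm (k1 (x - s) * k2 s) \<partial>lborel) \<le> M"
    and t: "t \<le> T"
  shows "has_bochner_integral lborel (\<lambda>s. k1 (t - s) * convolution k2 g s) (convolution (convolution k1 k2) g t)"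
proof -
  have [measurable]: "g \<in> borel_measurable borel" using g by auto
  define F where "F \<tau> s = k1 (t - s) * (k2 (s - \<tau>) * g \<tau>)" for \<tau> s
  have inner: "has_bochner_integral lborel (F \<tau>) (convolution k1 k2 (t - \<tau>) * g \<tau>) \<and>
     (\<integral>s. norm (F \<tau> s) \<partial>lborel) \<le> M * norm (g \<tau>)" for \<tau>
  proof (cases "g \<tau> = 0")
    case True
    then have "F \<tau> = (\<lambda>s. 0)" by (simp add: F_def fun_eq_iff)
    then show ?thesis using True by (simp add: has_bochner_integral_zero)
  next
    case False
    then have "\<tau> > 0" using supp[of \<tau>] by force
    then have x: "t - \<tau> \<le> T" using t by simp
    have Feq: "F \<tau> s = (k1 (t - \<tau> - (- \<tau> + 1 * s)) * k2 (- \<tau> + 1 * s)) * g \<tau>" for s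
      by (simp add: F_def algebra_simps)
    have 1: "has_bochner_integral lborel (\<lambda>s. k1 (t - \<tau> - s) * k2 s) (convolution k1 k2 (t - \<tau>))"
      using int[OF x] by (simp add: has_bochner_integral_iff convolution_def)
    have 2: "has_bochner_integral lborel (\<lambda>s. norm (k1 (t - \<tau> - s) * k2 s)) (\<integral>s. norm (k1 (t - \<tau> - s) * k2 s) \<partial>lborel)"
      using int[OF x] by (simp add: has_bochner_integral_iff)
    have "has_bochner_integral lborel (\<lambda>s. k1 (t - \<tau> - (- \<tau> + 1 * s)) * k2 (- \<tau> + 1 * s)) (convolution k1 k2 (t - \<tau>))"
      using lborel_has_bochner_integral_real_affine_iff[of 1 "\<lambda>s. k1 (t - \<tau> - s) * k2 s" _ "- \<tau>"] 1 by simp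
    then have "has_bochner_integral lborel (F \<tau>) (convolution k1 k2 (t - \<tau>) * g \<tau>)"
      unfolding Feq[abs_def] by (rule has_bochner_integral_mult_left)
    moreover have "has_bochner_integral lborel (\<lambda>s. norm (k1 (t - \<tau> - (- \<tau> + 1 * s)) * k2 (- \<tau> + 1 * s))) (\<integral>s. norm (k1 (t - \<tau> - s) * k2 s) \<partial>lborel)"
      using lborel_has_bochner_integral_real_affine_iff[of 1 "\<lambda>s. norm (k1 (t - \<tau> - s) * k2 s)" _ "- \<tau>"] 2 by simp
    then have "has_bochner_integral lborel (\<lambda>s. norm (F \<tau> s)) ((\<integral>s. norm (k1 (t - \<tau> - s) * k2 s) \<partial>lborel) * norm (g \<tau>))"
      unfolding Feq[abs_def] norm_mult[of _ "g \<tau>"] by (rule has_bochner_integral_mult_left)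
    then have "(\<integral>s. norm (F \<tau> s) \<partial>lborel) \<le> M * norm (g \<tau>)"
      using mult_right_mono[OF bound[OF x], of "norm (g \<tau>)"] by (simp add: has_bochner_integral_iff)
    ultimately show ?thesis by blast
  qed
  have pair: "integrable (lborel \<Otimes>\<^sub>M lborel) (case_prod F)"
  proof (rule lborel_pair.Fubini_integrable)
    show meas: "case_prod F \<in> borel_measurable (lborel \<Otimes>\<^sub>M lborel)" unfolding F_def by measurable
    show "integrable lborel (\<lambda>\<tau>. \<integral>s. norm (case_prod F (\<tau>, s)) \<partial>lborel)"
    proof (rule Bochner_Integration.integrable_bound)
      show "integrable lborel (\<lambda>\<tau>. M * norm (g \<tau>))" using g by simp
      show "(\<lambda>\<tau>. \<integral>s. norm (case_prod F (\<tau>, s)) \<partial>lborel) \<in> borel_measurable lborel"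
        unfolding F_def by measurable
      show "AE \<tau> in lborel. norm (\<integral>s. norm (case_prod F (\<tau>, s)) \<partial>lborel) \<le> norm (M * norm (g \<tau>))"
      proof (rule AE_I2)
        fix \<tau>
        have "0 \<le> (\<integral>s. norm (F \<tau> s) \<partial>lborel)" by (rule Bochner_Integration.integral_nonneg) simp
        with inner[of \<tau>] show "norm (\<integral>s. norm (case_prod F (\<tau>, s)) \<partial>lborel) \<le> norm (M * norm (g \<tau>))"
          by (auto intro: order_trans[OF _ abs_ge_self])
      qed
    qed
    show "AE \<tau> in lborel. integrable lborel (\<lambda>s. case_prod F (\<tau>, s))"
      using inner by (simp add: has_bochner_integral_iff)
  qed
  have eq: "(\<integral>\<tau>. F \<tau> s \<partial>lborel) = k1 (t - s) * convolution k2 g s" for s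
    unfolding F_def convolution_def by (rule integral_mult_right_zero)
  have "integrable lborel (\<lambda>s. \<integral>\<tau>. F \<tau> s \<partial>lborel)" by (rule lborel_pair.integrable_snd[OF pair])
  moreover have "(\<integral>s. (\<integral>\<tau>. F \<tau> s \<partial>lborel) \<partial>lborel) = (\<integral>\<tau>. (\<integral>s. F \<tau> s \<partial>lborel) \<partial>lborel)"
    by (rule lborel_pair.Fubini_integral[OF pair])
  moreover have "(\<integral>\<tau>. (\<integral>s. F \<tau> s \<partial>lborel) \<partial>lborel) = convolution (convolution k1 k2) g t"
    unfolding convolution_def[of "convolution k1 k2"]
    using inner by (intro Bochner_Integration.integral_cong refl) (simp add: has_bochner_integral_iff)
  ultimately show ?thesis unfolding eq by (simp add: has_bochner_integral_iff)
qed

lemma integrable_convolution: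
  fixes k g :: "real \<Rightarrow> complex"
  assumes k: "integrable lborel k" and g: "integrable lborel g"
  shows "integrable lborel (convolution k g)"
proof -
  have [measurable]: "g \<in> borel_measurable borel" "k \<in> borel_measurable borel" using k g by auto
  define F where "F s t = k (t - s) * g s" for s t
  have sh: "has_bochner_integral lborel (\<lambda>t. h (- s + 1 * t)) (\<integral>t. h t \<partial>lborel)" if "integrable lborel h" for h :: "real \<Rightarrow> 'a::{banach,second_countable_topology}" and s
    using lborel_has_bochner_integral_real_affine_iff[of 1 h "\<integral>t. h t \<partial>lborel" "- s"] that by (simp add: has_bochner_integral_iff)
  have "integrable (lborel \<Otimes>\<^sub>M lborel) (case_prod F)"
  proof (rule lborel_pair.Fubini_integrable)
    show "case_prod F \<in> borel_measurable (lborel \<Otimes>\<^sub>M lborel)" unfolding F_def by measurable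
    have "(\<integral>t. norm (case_prod F (s, t)) \<partial>lborel) = (\<integral>t. norm (k t) \<partial>lborel) * norm (g s)" for s
      using has_bochner_integral_mult_left[OF sh[of "\<lambda>t. norm (k t)" s], of "norm (g s)"] k
      by (simp add: F_def norm_mult has_bochner_integral_iff algebra_simps)
    then show "integrable lborel (\<lambda>s. \<integral>t. norm (case_prod F (s, t)) \<partial>lborel)" using g by simp
    show "AE s in lborel. integrable lborel (\<lambda>t. case_prod F (s, t))"
      using sh[OF k] by (auto simp: F_def has_bochner_integral_iff algebra_simps)
  qed
  then have "integrable lborel (\<lambda>t. \<integral>s. F s t \<partial>lborel)" by (rule lborel_pair.integrable_snd)
  then show ?thesis unfolding convolution_def[abs_def] F_def .
qed

section \<open>Borel representatives and derivatives almost everywhere\<close>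

text \<open>Lebesgue measure is complete.  This is what makes the almost everywhere defined derivative of an
  absolutely continuous function measurable.\<close>

lemma borel_measurable_lebesgue_AE_eq:
  fixes f g :: "real \<Rightarrow> complex"
  assumes g: "g \<in> borel_measurable lebesgue" and ae: "AE x in lebesgue. f x = g x"
  shows "f \<in> borel_measurable lebesgue"
proof (rule measurableI)
  fix A :: "complex set" assume A: "A \<in> sets borel"
  let ?N = "{x. f x \<noteq> g x}"
  have N: "?N \<in> null_sets lebesgue"
    using ae completion.AE_iff_null_sets[of "\<lambda>x. f x = g x" lborel] by simp
  have NA: "S \<in> sets lebesgue" if "S \<subseteq> ?N" for S
    using completion.complete2[OF that N] by auto
  have gA: "g -` A \<in> sets lebesgue" using measurable_sets[OF g A] by simp
  have "f -` A \<inter> space lebesgue = (g -` A - (?N \<inter> g -` A)) \<union> (?N \<inter> f -` A)" by auto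
  also have "\<dots> \<in> sets lebesgue" by (intro sets.Un sets.Diff gA NA) auto
  finally show "f -` A \<inter> space lebesgue \<in> sets lebesgue" .
qed simp

text \<open>A Borel function on the line that stands for the class of \<open>f\<close> in \<open>L\<^sup>1(0,T)\<close>.  Joint
  measurability of \<open>(t,s) \<mapsto> k (t - s) * f s\<close>, needed for Fubini, can fail for a merely Lebesgue
  measurable \<open>f\<close>, whereas it is immediate for the representative.\<close>

definition represents :: "real \<Rightarrow> (real \<Rightarrow> complex) \<Rightarrow> (real \<Rightarrow> complex) \<Rightarrow> bool" where
  "represents T g f \<longleftrightarrow> integrable lborel g \<and> (\<forall>x. x \<notin> {0<..<T} \<longrightarrow> g x = 0) \<and>
     (AE x in lebesgue. x \<in> {0<..<T} \<longrightarrow> f x = g x)"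

lemma AE_lebesgue_neq: "AE x in lebesgue. x \<noteq> (c::real)"
  by (rule AE_completion) (rule AE_lborel_singleton)

lemma represents_imp_L1:
  assumes "represents T g f"
  shows "f \<in> L1 T"
proof -
  have g: "integrable lborel g" "\<And>x. x \<notin> {0<..<T} \<Longrightarrow> g x = 0" and ae: "AE x in lebesgue. x \<in> {0<..<T} \<longrightarrow> f x = g x"
    using assms by (auto simp: represents_def)
  have gl: "integrable lebesgue g" using g(1) by (simp add: integrable_completion)
  have ae': "AE x in lebesgue. indicator {0<..<T} x *\<^sub>R f x = g x"
    using ae by eventually_elim (use g(2) in \<open>auto simp: indicator_def\<close>)
  have "integrable lebesgue (\<lambda>x. indicator {0<..<T} x *\<^sub>R f x)"
  proof (rule integrable_cong_AE_imp[OF gl])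
    show "(\<lambda>x. indicator {0<..<T} x *\<^sub>R f x) \<in> borel_measurable lebesgue"
      by (rule borel_measurable_lebesgue_AE_eq[OF _ ae']) (use gl in auto)
    show "AE x in lebesgue. g x = indicator {0<..<T} x *\<^sub>R f x" using ae' by eventually_elim simp
  qed
  then show ?thesis by (simp add: L1_def set_integrable_def)
qed

lemma completion_ex_borel_measurable_complex:
  fixes f :: "'a \<Rightarrow> complex"
  assumes "f \<in> borel_measurable (completion M)"
  obtains f' where "f' \<in> borel_measurable M" "AE x in M. f x = f' x"
proof -
  have "(\<lambda>x. Re (f x)) \<in> borel_measurable (completion M)" "(\<lambda>x. Im (f x)) \<in> borel_measurable (completion M)"
    using assms by (auto simp: measurable_compose[OF assms borel_measurable_Re] measurable_compose[OF assms borel_measurable_Im])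
  then obtain u v where u: "u \<in> borel_measurable M" "AE x in M. Re (f x) = u x"
    and v: "v \<in> borel_measurable M" "AE x in M. Im (f x) = v x"
    using completion_ex_borel_measurable_real by metis
  have "AE x in M. f x = complex_of_real (u x) + \<i> * complex_of_real (v x)"
    using u(2) v(2) by eventually_elim (simp add: complex_eq_iff)
  then show ?thesis by (intro that[of "\<lambda>x. complex_of_real (u x) + \<i> * complex_of_real (v x)"]) (use u v in measurable)
qed

lemma L1_imp_represents:
  assumes "f \<in> L1 T"
  obtains g where "represents T g f"
proof -
  let ?h = "\<lambda>x. indicator {0<..<T} x *\<^sub>R f x"
  have h: "integrable lebesgue ?h" using assms by (simp add: L1_def set_integrable_def)
  then obtain g where g: "g \<in> borel_measurable lborel" "AE x in lborel. ?h x = g x"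
    using completion_ex_borel_measurable_complex[of ?h lborel] by auto
  define g' where "g' x = indicator {0<..<T} x *\<^sub>R g x" for x
  have [measurable]: "g' \<in> borel_measurable lborel" unfolding g'_def using g(1) by measurable
  have ae: "AE x in lebesgue. ?h x = g' x"
    using AE_completion[OF g(2)] by eventually_elim (auto simp: g'_def indicator_def)
  have "integrable lebesgue g'"
    by (rule integrable_cong_AE_imp[OF h]) (auto simp: measurable_completion ae)
  then have "integrable lborel g'" by (simp add: integrable_completion)
  moreover have "AE x in lebesgue. x \<in> {0<..<T} \<longrightarrow> f x = g' x"
    using ae by eventually_elim (auto simp: indicator_def)
  ultimately have "represents T g' f" by (simp add: represents_def g'_def)
  then show ?thesis by (rule that)
qed

lemma conv_op_eq_convolution:
  assumes t: "t \<in> {0..T}" and rep: "represents T g f"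
    and k: "k \<in> borel_measurable borel" "\<And>x. x \<le> 0 \<Longrightarrow> k x = 0" "\<And>x. x > 0 \<Longrightarrow> k x = q x"
  shows "conv_op q f t = convolution k g t"
proof -
  have g: "integrable lborel g" "\<And>x. x \<notin> {0<..<T} \<Longrightarrow> g x = 0" and ae: "AE x in lebesgue. x \<in> {0<..<T} \<longrightarrow> f x = g x"
    using rep by (auto simp: represents_def)
  have [measurable]: "g \<in> borel_measurable borel" using g(1) by auto
  let ?h = "\<lambda>s. indicator {0..t} s *\<^sub>R (q (t - s) * f s)"
  let ?h' = "\<lambda>s. k (t - s) * g s"
  have m: "?h' \<in> borel_measurable lborel" using k(1) by measurable
  have ae': "AE s in lebesgue. ?h s = ?h' s"
    using ae AE_lebesgue_neq[of 0] AE_lebesgue_neq[of t]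
  proof eventually_elim
    case (elim s)
    consider "s < 0" | "s > t" | "0 < s" "s < t" using elim by linarith
    then show ?case
    proof cases
      case 1 then show ?thesis using g(2)[of s] by simp
    next
      case 2 then show ?thesis using k(2)[of "t - s"] by simp
    next
      case 3 then show ?thesis using k(3)[of "t - s"] elim t by simp
    qed
  qed
  have m': "?h' \<in> borel_measurable lebesgue" by (rule measurable_completion[OF m])
  have "conv_op q f t = (\<integral>s. ?h s \<partial>lebesgue)" by (simp add: conv_op_def set_lebesgue_integral_def)
  also have "\<dots> = (\<integral>s. ?h' s \<partial>lebesgue)"
    by (rule integral_cong_AE[OF borel_measurable_lebesgue_AE_eq[OF m' ae'] m' ae'])
  also have "\<dots> = (\<integral>s. ?h' s \<partial>lborel)" by (rule integral_completion[OF m])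
  finally show ?thesis by (simp add: convolution_def)
qed

lemma continuous_represents:
  assumes v: "continuous_on {0..T} v"
  shows "represents T (\<lambda>x. indicator {0<..<T} x *\<^sub>R v x) v"
proof -
  have "set_integrable lborel {0..T} v" by (rule borel_integrable_atLeastAtMost'[OF v])
  then have "set_integrable lborel {0<..<T} v" by (rule set_integrable_subset) auto
  then show ?thesis by (auto simp: represents_def set_integrable_def)
qed

lemma AE_has_vector_derivative_integral:
  fixes g :: "real \<Rightarrow> complex"
  assumes g: "integrable lborel g"
  shows "AE x in lebesgue. x \<in> {0<..<T} \<longrightarrow>
    ((\<lambda>t. LINT s:{0..t}|lborel. g s) has_vector_derivative g x) (at x)"
proof -
  have si: "set_integrable lborel {0..t} g" for t by (rule set_integrable_Icc[OF g])
  have gint: "g integrable_on {0..T}" using set_borel_integral_eq_integral(1)[OF si] .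
  have "negligible {x. 0 < x \<and> x < T \<and> \<not> ((\<lambda>t. integral {0..t} g) has_vector_derivative g x) (at x)}"
    by (rule Lebesgue_differentiation[OF gint])
  then have "AE x in lebesgue. x \<notin> {x. 0 < x \<and> x < T \<and> \<not> ((\<lambda>t. integral {0..t} g) has_vector_derivative g x) (at x)}"
    unfolding negligible_iff_null_sets by (rule AE_not_in)
  then show ?thesis
    by eventually_elim (simp add: set_borel_integral_eq_integral(2)[OF si])
qed

text \<open>Lebesgue differentiation identifies the Radon--Nikodym density of the function with its
  derivative.\<close>

lemma AC_vector_derivative:
  assumes T: "T > 0" and v: "v \<in> AC T"
  obtains g where "represents T g (\<lambda>s. vector_derivative v (at s))"
    "\<And>t. t \<in> {0..T} \<Longrightarrow> v t = v 0 + (LINT s:{0..t}|lborel. g s)"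
proof -
  obtain g0 :: "real \<Rightarrow> complex" where g0: "integrable lborel g0" "\<And>x. x \<notin> {0<..T} \<Longrightarrow> g0 x = 0"
    "\<And>t. t \<in> {0..T} \<Longrightarrow> v t = v 0 + (LINT s:{0..t}|lborel. g0 s)"
    using AC_imp_indefinite_integral[OF T v] by blast
  define g where "g = (\<lambda>x. indicator {0<..<T} x *\<^sub>R g0 x)"
  have g: "integrable lborel g" unfolding g_def by (rule integrable_mult_indicator[OF _ g0(1)]) simp
  have veq: "v t = v 0 + (LINT s:{0..t}|lborel. g s)" if t: "t \<in> {0..T}" for t
  proof -
    have "(LINT s:{0..t}|lborel. g s) = (LINT s:{0..t}|lborel. g0 s)"
      unfolding set_lebesgue_integral_def
    proof (rule integral_cong_AE)
      show "AE s in lborel. indicator {0..t} s *\<^sub>R g s = indicator {0..t} s *\<^sub>R g0 s"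
        using AE_lborel_singleton[of T] AE_lborel_singleton[of 0] by eventually_elim (use t g0(2) in \<open>auto simp: g_def indicator_def\<close>)
    qed (use g g0 in auto)
    then show ?thesis using g0(3)[OF t] by simp
  qed
  have "AE x in lebesgue. x \<in> {0<..<T} \<longrightarrow> vector_derivative v (at x) = g x"
    using AE_has_vector_derivative_integral[OF g, of T]
  proof eventually_elim
    case (elim x)
    show ?case
    proof
      assume x: "x \<in> {0<..<T}"
      with elim have "((\<lambda>t. v 0 + (LINT s:{0..t}|lborel. g s)) has_vector_derivative g x) (at x)"
        by (auto intro!: derivative_eq_intros)
      then have "(v has_vector_derivative g x) (at x)"
        by (rule has_vector_derivative_transform_within_open[OF _ open_greaterThanLessThan x]) (rule veq[symmetric], simp)
      then show "vector_derivative v (at x) = g x" by (rule vector_derivative_at)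
    qed
  qed
  with g have "represents T g (\<lambda>s. vector_derivative v (at s))"
    by (auto simp: represents_def g_def)
  then show ?thesis using veq that by blast
qed

text \<open>Split \<open>norm g\<close> at a height \<open>N\<close>.  The part above \<open>N\<close> has small integral by dominated convergence, the
  part below contributes at most \<open>N\<close> times the total length.\<close>

lemma indefinite_integral_AC:
  fixes g :: "real \<Rightarrow> complex"
  assumes g: "integrable lborel g" and y: "\<And>t. t \<in> {0..T} \<Longrightarrow> y t = (LINT s:{0..t}|lborel. g s)"
  shows "y \<in> AC T"
  unfolding AC_def mem_Collect_eq
proof (intro allI impI)
  fix \<epsilon> :: real assume \<epsilon>: "\<epsilon> > 0"
  have [measurable]: "g \<in> borel_measurable borel" using g by auto
  \<comment> \<open>the excess of \<open>norm g\<close> over the height \<open>N\<close>\<close>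
  define \<phi> where "\<phi> N s = max (norm (g s) - real N) 0" for N :: nat and s
  have \<phi>int: "integrable lborel (\<phi> N)" for N
    unfolding \<phi>_def by (rule Bochner_Integration.integrable_bound[OF integrable_norm[OF g]]) auto
  have "(\<lambda>N. \<integral>s. \<phi> N s \<partial>lborel) \<longlonglongrightarrow> (\<integral>s. 0 \<partial>(lborel :: real measure))"
  proof (rule integral_dominated_convergence[where w="\<lambda>s. norm (g s)"])
    show "AE s in lborel. (\<lambda>N. \<phi> N s) \<longlonglongrightarrow> 0"
    proof (rule AE_I2)
      fix s
      obtain N0 :: nat where "norm (g s) < real N0" using reals_Archimedean2 by blast
      then have "\<forall>\<^sub>F N in sequentially. \<phi> N s = 0"
        by (intro eventually_sequentiallyI[of N0]) (auto simp: \<phi>_def)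
      then show "(\<lambda>N. \<phi> N s) \<longlonglongrightarrow> 0" by (rule tendsto_eventually)
    qed
  qed (use g in \<open>auto simp: \<phi>_def\<close>)
  then have "(\<lambda>N. \<integral>s. \<phi> N s \<partial>lborel) \<longlonglongrightarrow> 0" by simp
  then have "\<forall>\<^sub>F N in sequentially. (\<integral>s. \<phi> N s \<partial>lborel) < \<epsilon> / 2" using \<epsilon> by (intro order_tendstoD(2)) auto
  then obtain N where N: "(\<integral>s. \<phi> N s \<partial>lborel) < \<epsilon> / 2" by (auto simp: eventually_sequentially)
  define d where "d = \<epsilon> / (2 * (real N + 1))"
  have d: "d > 0" "real N * d \<le> \<epsilon> / 2" using \<epsilon> by (auto simp: d_def field_simps)
  show "\<exists>d>0. \<forall>(n::nat) a b. (\<forall>i<n. 0 \<le> a i \<and> a i \<le> b i \<and> b i \<le> T) \<and>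
      (\<forall>i<n. \<forall>j<n. i \<noteq> j \<longrightarrow> {a i<..<b i} \<inter> {a j<..<b j} = {}) \<and> (\<Sum>i<n. b i - a i) < d
      \<longrightarrow> (\<Sum>i<n. cmod (y (b i) - y (a i))) < \<epsilon>"
  proof (intro exI[of _ d] conjI allI impI d(1))
    fix n :: nat and a b assume "(\<forall>i<n. 0 \<le> a i \<and> a i \<le> b i \<and> b i \<le> T) \<and>
      (\<forall>i<n. \<forall>j<n. i \<noteq> j \<longrightarrow> {a i<..<b i} \<inter> {a j<..<b j} = {}) \<and> (\<Sum>i<n. b i - a i) < d"
    then have ab: "\<And>i. i < n \<Longrightarrow> 0 \<le> a i \<and> a i \<le> b i \<and> b i \<le> T"
      and dis: "\<And>i j. i < n \<Longrightarrow> j < n \<Longrightarrow> i \<noteq> j \<Longrightarrow> {a i<..<b i} \<inter> {a j<..<b j} = {}"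
      and len: "(\<Sum>i<n. b i - a i) < d" by blast+
    define I where "I i = (indicator {a i<..<b i} :: real \<Rightarrow> real)" for i
    have [measurable]: "I i \<in> borel_measurable borel" for i by (simp add: I_def)
    have ii: "integrable lborel (\<lambda>s. I i s * \<phi> N s)" for i
      using integrable_mult_indicator[OF _ \<phi>int, of "{a i<..<b i}" N] by (simp add: I_def)
    have "cmod (y (b i) - y (a i)) \<le> (\<integral>s. I i s * \<phi> N s \<partial>lborel) + real N * (b i - a i)" if i: "i < n" for i
    proof -
      have Ii: "integrable lborel (I i)" "(\<integral>s. I i s \<partial>lborel) = b i - a i" using ab[OF i] by (simp_all add: I_def)
      have "y (b i) - y (a i) = (\<integral>s. indicator {0..b i} s *\<^sub>R g s - indicator {0..a i} s *\<^sub>R g s \<partial>lborel)"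
        using ab[OF i] y set_integrable_Icc[OF g]
        by (subst Bochner_Integration.integral_diff) (auto simp: set_integrable_def set_lebesgue_integral_def)
      also have "\<dots> = (\<integral>s. I i s *\<^sub>R g s \<partial>lborel)"
      proof (rule integral_cong_AE)
        show "AE s in lborel. indicator {0..b i} s *\<^sub>R g s - indicator {0..a i} s *\<^sub>R g s = I i s *\<^sub>R g s"
          using AE_lborel_singleton[of "a i"] AE_lborel_singleton[of "b i"]
          by eventually_elim (use ab[OF i] in \<open>auto simp: I_def indicator_def\<close>)
      qed auto
      also have "norm \<dots> \<le> (\<integral>s. I i s * \<phi> N s + real N * I i s \<partial>lborel)"
      proof (rule Bochner_Integration.integral_norm_bound_integral)
        show "integrable lborel (\<lambda>s. I i s *\<^sub>R g s)" unfolding I_def by (rule integrable_mult_indicator[OF _ g]) simp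
        show "integrable lborel (\<lambda>s. I i s * \<phi> N s + real N * I i s)" using ii Ii by auto
        show "norm (I i s *\<^sub>R g s) \<le> I i s * \<phi> N s + real N * I i s" for s
          by (auto simp: I_def indicator_def \<phi>_def)
      qed
      also have "\<dots> = (\<integral>s. I i s * \<phi> N s \<partial>lborel) + real N * (b i - a i)"
        using ii Ii by (subst Bochner_Integration.integral_add) auto
      finally show ?thesis .
    qed
    then have "(\<Sum>i<n. cmod (y (b i) - y (a i))) \<le> (\<Sum>i<n. (\<integral>s. I i s * \<phi> N s \<partial>lborel) + real N * (b i - a i))"
      by (intro sum_mono) auto
    also have "\<dots> = (\<integral>s. (\<Sum>i<n. I i s * \<phi> N s) \<partial>lborel) + real N * (\<Sum>i<n. b i - a i)"
      using ii by (simp add: sum.distrib sum_distrib_left)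
    also have "(\<integral>s. (\<Sum>i<n. I i s * \<phi> N s) \<partial>lborel) \<le> (\<integral>s. \<phi> N s \<partial>lborel)"
    proof (rule integral_mono)
      show "integrable lborel (\<lambda>s. \<Sum>i<n. I i s * \<phi> N s)" using ii by auto
      fix s
      have "(\<Sum>i<n. I i s) \<le> 1"
      proof (cases "\<exists>i<n. s \<in> {a i<..<b i}")
        case True
        then obtain j where j: "j < n" "s \<in> {a j<..<b j}" by blast
        have "I i s = 0" if "i < n" "i \<noteq> j" for i using dis[OF that(1) j(1) that(2)] j(2) by (auto simp: I_def indicator_def)
        then have "(\<Sum>i<n. I i s) = (\<Sum>i\<in>{j}. I i s)" using j(1) by (intro sum.mono_neutral_right) auto
        then have "(\<Sum>i<n. I i s) = I j s" by simp
        then show ?thesis by (simp add: I_def)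
      next
        case False
        then have "(\<Sum>i<n. I i s) = 0" by (intro sum.neutral) (auto simp: I_def indicator_def)
        then show ?thesis by simp
      qed
      then show "(\<Sum>i<n. I i s * \<phi> N s) \<le> \<phi> N s"
        unfolding sum_distrib_right[symmetric] by (intro mult_left_le_one_le) (auto simp: \<phi>_def I_def intro!: sum_nonneg)
    qed (rule \<phi>int)
    also have "(\<integral>s. \<phi> N s \<partial>lborel) + real N * (\<Sum>i<n. b i - a i) < \<epsilon>"
      using N d(2) len mult_left_mono[OF less_imp_le[OF len], of "real N"] by linarith
    finally show "(\<Sum>i<n. cmod (y (b i) - y (a i))) < \<epsilon>" by simp
  qed
qed

section \<open>Prabhakar integrals, iterated integrals and their ranges\<close>

context prabhakar
begin

lemma pk_nonpos: "x \<le> 0 \<Longrightarrow> pk \<gamma> \<mu> x = 0"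
  by (simp add: pk_def)

lemma pk_pos: "x > 0 \<Longrightarrow> pk \<gamma> \<mu> x = prabhakar_kernel \<rho> \<mu> \<omega> \<gamma> x"
  by (simp add: pk_def)

lemma convolution_pk_pk:
  assumes "\<mu>1 > 0" "\<mu>2 > 0"
  shows "convolution (pk \<gamma>1 \<mu>1) (pk \<gamma>2 \<mu>2) = pk (\<gamma>1 + \<gamma>2) (\<mu>1 + \<mu>2)"
  using pk_convolution[OF assms] by (auto simp: convolution_def has_bochner_integral_iff fun_eq_iff)

text \<open>The absolute convolution is dominated by a multiple of the power \<open>x powr (\<mu>1 + \<mu>2 - 1)\<close>, which is
  bounded near the origin exactly when \<open>\<mu>1 + \<mu>2 \<ge> 1\<close>.\<close>

lemma pk_product_integral_bound:
  assumes \<mu>: "\<mu>1 > 0" "\<mu>2 > 0" "\<mu>1 + \<mu>2 \<ge> 1" and T: "T > 0"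
  obtains M where "\<And>x. x \<le> T \<Longrightarrow> (\<integral>s. norm (pk \<gamma>1 \<mu>1 (x - s) * pk \<gamma>2 \<mu>2 s) \<partial>lborel) \<le> M"
proof -
  let ?N = "\<lambda>x. \<integral>s. norm (pk \<gamma>1 \<mu>1 (x - s) * pk \<gamma>2 \<mu>2 s) \<partial>lborel"
  obtain B1 where B1: "B1 > 0" "\<And>x. x \<le> T \<Longrightarrow> cmod (pk \<gamma>1 \<mu>1 x) \<le> B1 * power_kernel \<mu>1 x"
    using pk_bound[OF \<mu>(1) T] by metis
  obtain B2 where B2: "B2 > 0" "\<And>x. x \<le> T \<Longrightarrow> cmod (pk \<gamma>2 \<mu>2 x) \<le> B2 * power_kernel \<mu>2 x"
    using pk_bound[OF \<mu>(2) T] by metis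
  have "?N x \<le> B1 * B2 * (Beta \<mu>1 \<mu>2 * T powr (\<mu>1 + \<mu>2 - 1))"
    if x: "x \<le> T" for x
  proof -
    have c: "has_bochner_integral lborel (\<lambda>s. B1 * B2 * (power_kernel \<mu>1 (x - s) * power_kernel \<mu>2 s)) (B1 * B2 * (Beta \<mu>1 \<mu>2 * power_kernel (\<mu>1 + \<mu>2) x))"
      by (rule has_bochner_integral_mult_right[OF power_kernel_convolution[OF \<mu>(1,2)]])
    have "?N x \<le> (\<integral>s. B1 * B2 * (power_kernel \<mu>1 (x - s) * power_kernel \<mu>2 s) \<partial>lborel)"
    proof (rule integral_mono)
      show "integrable lborel (\<lambda>s. norm (pk \<gamma>1 \<mu>1 (x - s) * pk \<gamma>2 \<mu>2 s))"
        using pk_convolution[OF \<mu>(1,2)] by (simp add: has_bochner_integral_iff)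
      show "integrable lborel (\<lambda>s. B1 * B2 * (power_kernel \<mu>1 (x - s) * power_kernel \<mu>2 s))"
        using c by (simp add: has_bochner_integral_iff)
      fix s
      consider "s \<le> 0" | "s \<ge> x" | "0 < s" "s < x" by linarith
      then show "norm (pk \<gamma>1 \<mu>1 (x - s) * pk \<gamma>2 \<mu>2 s) \<le> B1 * B2 * (power_kernel \<mu>1 (x - s) * power_kernel \<mu>2 s)"
      proof cases
        case 3
        then have "x - s \<le> T" "s \<le> T" using x by auto
        from mult_mono[OF B1(2)[OF this(1)] B2(2)[OF this(2)]] B1(1) show ?thesis
          by (simp add: norm_mult mult_ac)
      qed (simp_all add: pk_nonpos power_kernel_eq_0)
    qed
    also have "\<dots> = B1 * B2 * (Beta \<mu>1 \<mu>2 * power_kernel (\<mu>1 + \<mu>2) x)" using c by (simp add: has_bochner_integral_iff)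
    also have "\<dots> \<le> B1 * B2 * (Beta \<mu>1 \<mu>2 * T powr (\<mu>1 + \<mu>2 - 1))"
    proof -
      have "Beta \<mu>1 \<mu>2 \<ge> 0" using \<mu> Gamma_real_pos by (simp add: Beta_def less_imp_le)
      moreover have "power_kernel (\<mu>1 + \<mu>2) x \<le> T powr (\<mu>1 + \<mu>2 - 1)"
        using x \<mu>(3) by (auto simp: power_kernel_def intro: powr_mono2)
      ultimately show ?thesis using B1(1) B2(1) by (intro mult_left_mono) auto
    qed
    finally show ?thesis .
  qed
  then show ?thesis by (rule that)
qed

text \<open>The semigroup law for the operators.  Besides the value it records that the outer integrand is
  integrable, which is needed to add such integrals.\<close>

theorem pk_assoc:
  assumes \<mu>: "\<mu>1 > 0" "\<mu>2 > 0" "\<mu>1 + \<mu>2 \<ge> 1"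
    and g: "integrable lborel g" "\<And>x. x \<le> 0 \<Longrightarrow> g x = 0"
  shows "has_bochner_integral lborel (\<lambda>s. pk \<gamma>1 \<mu>1 (t - s) * convolution (pk \<gamma>2 \<mu>2) g s)
    (convolution (pk (\<gamma>1 + \<gamma>2) (\<mu>1 + \<mu>2)) g t)"
proof -
  obtain M where M: "\<And>x. x \<le> max 1 t \<Longrightarrow> (\<integral>s. norm (pk \<gamma>1 \<mu>1 (x - s) * pk \<gamma>2 \<mu>2 s) \<partial>lborel) \<le> M"
    using pk_product_integral_bound[OF \<mu>, of "max 1 t"] by (metis less_max_iff_disj zero_less_one)
  have "has_bochner_integral lborel (\<lambda>s. pk \<gamma>1 \<mu>1 (t - s) * convolution (pk \<gamma>2 \<mu>2) g s)
      (convolution (convolution (pk \<gamma>1 \<mu>1) (pk \<gamma>2 \<mu>2)) g t)"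
  proof (rule convolution_assoc[where T = "max 1 t" and M = M])
    show "integrable lborel (\<lambda>s. pk \<gamma>1 \<mu>1 (x - s) * pk \<gamma>2 \<mu>2 s)" for x
      using pk_convolution[OF \<mu>(1,2)] by (simp add: has_bochner_integral_iff)
  qed (use \<mu> g M in auto)
  then show ?thesis by (simp add: convolution_pk_pk[OF \<mu>(1,2)])
qed

corollary convolution_pk_assoc:
  assumes "\<mu>1 > 0" "\<mu>2 > 0" "\<mu>1 + \<mu>2 \<ge> 1" "integrable lborel g" "\<And>x. x \<le> 0 \<Longrightarrow> g x = 0"
  shows "convolution (pk \<gamma>1 \<mu>1) (convolution (pk \<gamma>2 \<mu>2) g) t = convolution (pk (\<gamma>1 + \<gamma>2) (\<mu>1 + \<mu>2)) g t"
  using pk_assoc[OF assms] by (simp add: has_bochner_integral_iff convolution_def)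

text \<open>The factor \<open>power_kernel 1 (T' + 1 - s)\<close> is an indicator function in disguise, so the dominating
  function is an instance of the Beta integral.\<close>

lemma integrable_truncated_pk:
  assumes \<mu>: "\<mu> > 0"
  shows "integrable lborel (\<lambda>x. indicator {..T} x *\<^sub>R pk \<gamma> \<mu> x)"
proof -
  \<comment> \<open>positive even if \<open>T\<close> is not, as the bound for the kernel requires\<close>
  define T' where "T' = max 1 T"
  obtain B where B: "B > 0" "\<And>x. x \<le> T' \<Longrightarrow> cmod (pk \<gamma> \<mu> x) \<le> B * power_kernel \<mu> x"
    using pk_bound[OF \<mu>, of T'] unfolding T'_def by (metis less_max_iff_disj zero_less_one)
  have [measurable]: "pk \<gamma> \<mu> \<in> borel_measurable borel" by (rule borel_measurable_pk[OF \<mu>])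
  show ?thesis
  proof (rule Bochner_Integration.integrable_bound)
    show "integrable lborel (\<lambda>s. B * (power_kernel 1 (T' + 1 - s) * power_kernel \<mu> s))"
      using power_kernel_convolution[of 1 \<mu> "T' + 1"] \<mu> by (simp add: has_bochner_integral_iff)
    show "AE x in lborel. norm (indicator {..T} x *\<^sub>R pk \<gamma> \<mu> x) \<le> norm (B * (power_kernel 1 (T' + 1 - x) * power_kernel \<mu> x))"
    proof (rule AE_I2)
      fix x
      show "norm (indicator {..T} x *\<^sub>R pk \<gamma> \<mu> x) \<le> norm (B * (power_kernel 1 (T' + 1 - x) * power_kernel \<mu> x))"
      proof (cases "x \<le> T")
        case True
        then have "x \<le> T'" by (simp add: T'_def)
        moreover from this have "power_kernel 1 (T' + 1 - x) = 1" by (simp add: power_kernel_def)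
        ultimately show ?thesis using B(1) B(2)[of x] True by (simp add: abs_mult)
      qed simp
    qed
  qed measurable
qed

lemma integrable_truncated_convolution:
  assumes \<mu>: "\<mu> > 0" and g: "integrable lborel g" "\<And>x. x \<le> 0 \<Longrightarrow> g x = 0"
  shows "integrable lborel (\<lambda>t. indicator {0<..<T} t *\<^sub>R convolution (pk \<gamma> \<mu>) g t)"
proof -
  let ?k = "\<lambda>x. indicator {..T} x *\<^sub>R pk \<gamma> \<mu> x"
  have "integrable lborel (\<lambda>t. indicator {0<..<T} t *\<^sub>R convolution ?k g t)"
    by (rule integrable_mult_indicator[OF _ integrable_convolution[OF integrable_truncated_pk[OF \<mu>] g(1)]]) simp
  moreover have "indicator {0<..<T} t *\<^sub>R convolution ?k g t = indicator {0<..<T} t *\<^sub>R convolution (pk \<gamma> \<mu>) g t" for t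
  proof (cases "t \<in> {0<..<T}")
    case True
    have "convolution ?k g t = convolution (pk \<gamma> \<mu>) g t"
      unfolding convolution_def
    proof (rule Bochner_Integration.integral_cong[OF refl])
      fix s show "?k (t - s) * g s = pk \<gamma> \<mu> (t - s) * g s"
        using True g(2)[of s] by (cases "s \<le> 0") (auto simp: indicator_def)
    qed
    then show ?thesis by simp
  qed simp
  ultimately show ?thesis by simp
qed

lemma prabhakar_integral_eq_convolution:
  assumes "t \<in> {0..T}" "\<mu> > 0" "represents T g f"
  shows "prabhakar_integral \<rho> \<mu> \<omega> \<gamma> f t = convolution (pk \<gamma> \<mu>) g t"
  unfolding prabhakar_integral_def
  by (rule conv_op_eq_convolution[OF assms(1,3)]) (auto simp: borel_measurable_pk[OF assms(2)] pk_nonpos pk_pos)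

lemma pk_0_1: "pk 0 1 x = (if x > 0 then 1 else 0)"
  by (simp add: pk_0 power_kernel_def)

lemma convolution_pk_0_1:
  assumes g [measurable]: "g \<in> borel_measurable borel" and supp: "\<And>x. x \<le> 0 \<Longrightarrow> g x = 0"
  shows "convolution (pk 0 1) g t = (LINT s:{0..t}|lborel. g s)"
  unfolding convolution_def set_lebesgue_integral_def
proof (rule integral_cong_AE)
  have [measurable]: "pk 0 1 \<in> borel_measurable borel" by (rule borel_measurable_pk) simp
  show "(\<lambda>s. pk 0 1 (t - s) * g s) \<in> borel_measurable lborel" by measurable
  show "AE s in lborel. pk 0 1 (t - s) * g s = indicator {0..t} s *\<^sub>R g s"
    using AE_lborel_singleton[of t]
  proof eventually_elim
    case (elim s)
    then show ?case using supp[of s] by (auto simp: pk_0_1 indicator_def)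
  qed
qed measurable

lemma convolution_pk_supp:
  "(\<And>x. x \<le> 0 \<Longrightarrow> g x = 0) \<Longrightarrow> t \<le> 0 \<Longrightarrow> convolution (pk \<gamma> \<mu>) g t = 0"
  by (rule convolution_eq_0) (auto simp: pk_nonpos)

context
  fixes g :: "real \<Rightarrow> complex" and T :: real
  assumes T: "T > 0" and g: "integrable lborel g" and supp: "\<And>x. x \<notin> {0<..<T} \<Longrightarrow> g x = 0"
begin

abbreviation iterated_integral :: "nat \<Rightarrow> real \<Rightarrow> complex" where
  "iterated_integral j \<equiv> convolution (pk 0 (real j)) g"

lemma supp0: "x \<le> 0 \<Longrightarrow> g x = 0"
  using supp by simp

lemma iterated_integral_Suc:
  assumes "j \<ge> 1"
  shows "iterated_integral (Suc j) t = (LINT s:{0..t}|lborel. iterated_integral j s)"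
proof -
  have [measurable]: "g \<in> borel_measurable borel" "pk 0 (real j) \<in> borel_measurable borel"
    using g assms by (auto intro: borel_measurable_pk)
  have "iterated_integral (Suc j) t = convolution (pk 0 1) (iterated_integral j) t"
    using convolution_pk_assoc[of 1 "real j" g 0 0 t] g supp0 assms by simp
  also have "\<dots> = (LINT s:{0..t}|lborel. iterated_integral j s)"
    by (rule convolution_pk_0_1) (auto intro: convolution_pk_supp supp0)
  finally show ?thesis .
qed

lemma iterated_integral_1: "iterated_integral 1 t = (LINT s:{0..t}|lborel. g s)"
  using convolution_pk_0_1[of g t] g supp0 by auto

lemma continuous_iterated_integral: "j \<ge> 1 \<Longrightarrow> continuous_on {0..b} (iterated_integral j)"
proof (induction j rule: nat_induct_at_least)
  case base
  have si: "set_integrable lborel {0..t} g" for t by (rule set_integrable_Icc[OF g])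
  have "continuous_on {0..b} (\<lambda>t. integral {0..t} g)"
    by (rule indefinite_integral_continuous_1) (rule set_borel_integral_eq_integral(1)[OF si])
  then show ?case
    using iterated_integral_1 set_borel_integral_eq_integral(2)[OF si] by simp
next
  case (Suc j)
  have si: "set_integrable lborel {0..t} (iterated_integral j)" if "t \<in> {0..b}" for t
    by (rule borel_integrable_atLeastAtMost'[OF continuous_on_subset[OF Suc.IH]]) (use that in auto)
  have "continuous_on {0..b} (\<lambda>t. integral {0..t} (iterated_integral j))"
    by (rule indefinite_integral_continuous_1) (rule integrable_continuous_real[OF Suc.IH])
  then show ?case
    by (rule continuous_on_eq) (use iterated_integral_Suc[OF Suc.hyps] set_borel_integral_eq_integral(2)[OF si] in auto)
qed

lemma iterated_integral_has_derivative:
  assumes "j \<ge> 1" "t \<in> {0..T}"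
  shows "(iterated_integral (Suc j) has_vector_derivative iterated_integral j t) (at t within {0..T})"
proof -
  have c: "continuous_on {0..T} (iterated_integral j)" by (rule continuous_iterated_integral[OF assms(1)])
  have "iterated_integral (Suc j) x = integral {0..x} (iterated_integral j)" if "x \<in> {0..T}" for x
  proof -
    have "set_integrable lborel {0..x} (iterated_integral j)"
      by (rule borel_integrable_atLeastAtMost'[OF continuous_on_subset[OF c]]) (use that in auto)
    then show ?thesis using iterated_integral_Suc[OF assms(1)] set_borel_integral_eq_integral(2) by metis
  qed
  then show ?thesis
    by (intro has_vector_derivative_transform[OF assms(2) _ integral_has_vector_derivative[OF c assms(2)]]) simp
qed

text \<open>Each derivative removes one integration, down to the continuous single integral.\<close>

lemma deriv_on_iterated_integral:
  assumes y: "\<And>t. t \<in> {0..T} \<Longrightarrow> y t = iterated_integral m t"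
  shows "k < m \<Longrightarrow> t \<in> {0..T} \<Longrightarrow> deriv_on T k y t = iterated_integral (m - k) t"
proof (induction k arbitrary: t)
  case 0
  then show ?case using y by (simp add: deriv_on_def)
next
  case (Suc k)
  then have mk: "m - k = Suc (m - Suc k)" "m - Suc k \<ge> 1" by auto
  have "(deriv_on T k y has_vector_derivative iterated_integral (m - Suc k) t) (at t within {0..T})"
    using Suc mk by (intro has_vector_derivative_transform[OF _ _ iterated_integral_has_derivative]) auto
  then have "vector_derivative (deriv_on T k y) (at t within {0..T}) = iterated_integral (m - Suc k) t"
    using Suc.prems T by (intro vector_derivative_within_closed_interval) auto
  then show ?case by (simp add: deriv_on_def)
qed

lemma iterated_integral_AC0:
  assumes m: "m \<ge> 1" and y: "\<And>t. t \<in> {0..T} \<Longrightarrow> y t = iterated_integral m t"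
  shows "y \<in> AC0 T m"
proof -
  have d: "deriv_on T k y t = iterated_integral (m - k) t" if "k < m" "t \<in> {0..T}" for k t
    using deriv_on_iterated_integral[OF y that] .
  have "deriv_on T k y differentiable (at t within {0..T})" if "k < m - 1" "t \<in> {0..T}" for k t
  proof -
    have mk: "m - k = Suc (m - Suc k)" "m - Suc k \<ge> 1" using that by auto
    have "(deriv_on T k y has_vector_derivative iterated_integral (m - Suc k) t) (at t within {0..T})"
      using d[of k] mk that by (intro has_vector_derivative_transform[OF _ _ iterated_integral_has_derivative]) auto
    then show ?thesis by (rule differentiableI_vector)
  qed
  moreover have top: "deriv_on T (m - 1) y t = iterated_integral 1 t" if "t \<in> {0..T}" for t
    using d[of "m - 1" t] m that by simp
  moreover from top have "continuous_on {0..T} (deriv_on T (m - 1) y)"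
    using continuous_iterated_integral[of 1 T] by (metis (no_types, lifting) continuous_on_cong le_refl)
  moreover have "deriv_on T (m - 1) y \<in> AC T"
    by (rule indefinite_integral_AC[OF g]) (use top iterated_integral_1 in simp)
  moreover have "deriv_on T k y 0 = 0" if "k < m" for k
    using d[OF that, of 0] T by (simp add: convolution_pk_supp supp0)
  ultimately show ?thesis by (auto simp: AC0_def ACm_def Cspace_def)
qed

text \<open>Differentiate \<open>m - 1\<close> times; the last integration is undone almost everywhere by Lebesgue
  differentiation.\<close>

lemma iterated_integral_eq_0_imp:
  assumes m: "m \<ge> 1" and 0: "\<And>t. t \<in> {0..T} \<Longrightarrow> iterated_integral m t = 0"
  shows "AE s in lebesgue. g s = 0"
proof -
  have 1: "iterated_integral 1 t = 0" if "t \<in> {0..T}" for t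
    using m 0 that
  proof (induction m arbitrary: t rule: nat_induct_at_least)
    case (Suc j)
    have "iterated_integral j s = 0" if s: "s \<in> {0..T}" for s
    proof -
      have "(iterated_integral (Suc j) has_vector_derivative iterated_integral j s) (at s within {0..T})"
        by (rule iterated_integral_has_derivative[OF Suc.hyps s])
      moreover have "(iterated_integral (Suc j) has_vector_derivative 0) (at s within {0..T})"
        by (rule has_vector_derivative_transform[OF s _ has_vector_derivative_const[of 0]]) (use Suc.prems in auto)
      ultimately show ?thesis using vector_derivative_unique_within_closed_interval[of 0 T s] s T
        by (metis box_real(2))
    qed
    then show ?case using Suc.IH Suc.prems by blast
  qed
  show ?thesis
    using AE_has_vector_derivative_integral[OF g, of T]
  proof eventually_elim
    case (elim x)
    show ?case
    proof (cases "x \<in> {0<..<T}")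
      case True
      have "((\<lambda>t. LINT s:{0..t}|lborel. g s) has_vector_derivative 0) (at x)"
        by (rule has_vector_derivative_transform_within_open[OF has_vector_derivative_const open_greaterThanLessThan True])
          (use 1 iterated_integral_1 in simp)
      then show ?thesis using elim True by (auto intro: vector_derivative_unique_at)
    qed (use supp in simp)
  qed
qed

end

text \<open>The top derivative is the integral of its own derivative, and since all initial values vanish,
  each lower derivative is the integral of the next one.\<close>

lemma AC0_imp_iterated_integral:
  assumes T: "T > 0" and m: "m \<ge> 1" and y: "y \<in> AC0 T m"
  obtains g where "integrable lborel g" "\<And>x. x \<notin> {0<..<T} \<Longrightarrow> g x = 0"
    "\<And>t. t \<in> {0..T} \<Longrightarrow> y t = convolution (pk 0 (real m)) g t"
proof -
  have diff: "\<And>k t. k < m - 1 \<Longrightarrow> t \<in> {0..T} \<Longrightarrow> deriv_on T k y differentiable (at t within {0..T})"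
    and ac: "deriv_on T (m - 1) y \<in> AC T" and zero: "\<And>k. k < m \<Longrightarrow> deriv_on T k y 0 = 0"
    using y by (auto simp: AC0_def ACm_def Cspace_def)
  obtain g where rep: "represents T g (\<lambda>s. vector_derivative (deriv_on T (m - 1) y) (at s))"
    and gy: "\<And>t. t \<in> {0..T} \<Longrightarrow> deriv_on T (m - 1) y t = deriv_on T (m - 1) y 0 + (LINT s:{0..t}|lborel. g s)"
    using AC_vector_derivative[OF T ac] by blast
  have g: "integrable lborel g" "\<And>x. x \<notin> {0<..<T} \<Longrightarrow> g x = 0" using rep by (auto simp: represents_def)
  have "\<forall>t\<in>{0..T}. deriv_on T (m - 1 - j) y t = convolution (pk 0 (real (Suc j))) g t" if "j < m" for j
    using that
  proof (induction j)
    case 0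
    show ?case using gy zero[of "m - 1"] m iterated_integral_1[OF T g] by simp
  next
    case (Suc j)
    let ?k = "m - 1 - Suc j" let ?u = "deriv_on T ?k y"
    have k: "Suc ?k = m - 1 - j" "?k < m - 1" using Suc.prems by auto
    have IH: "deriv_on T (Suc ?k) y t = convolution (pk 0 (real (Suc j))) g t" if "t \<in> {0..T}" for t
      using Suc that unfolding k(1) by simp
    have der: "(?u has_vector_derivative convolution (pk 0 (real (Suc j))) g t) (at t within {0..T})" if "t \<in> {0..T}" for t
    proof -
      have "(?u has_vector_derivative vector_derivative ?u (at t within {0..T})) (at t within {0..T})"
        using diff[OF k(2) that] by (simp add: vector_derivative_works[symmetric])
      then show ?thesis using IH[OF that] by (simp add: deriv_on_def)
    qed
    show ?case
    proof
      fix t assume t: "t \<in> {0..T}"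
      have c: "continuous_on {0..t} (convolution (pk 0 (real (Suc j))) g)"
        by (rule continuous_iterated_integral[OF T g]) auto
      have "(convolution (pk 0 (real (Suc j))) g has_integral ?u t - ?u 0) {0..t}"
      proof (rule fundamental_theorem_of_calculus)
        fix x assume "x \<in> {0..t}"
        then show "(?u has_vector_derivative convolution (pk 0 (real (Suc j))) g x) (at x within {0..t})"
          using t by (intro has_vector_derivative_within_subset[OF der]) auto
      qed (use t in auto)
      then have "?u t = integral {0..t} (convolution (pk 0 (real (Suc j))) g)"
        using zero[of ?k] k by (simp add: integral_unique)
      also have "\<dots> = (LINT s:{0..t}|lborel. convolution (pk 0 (real (Suc j))) g s)"
        by (rule set_borel_integral_eq_integral(2)[symmetric, OF borel_integrable_atLeastAtMost'[OF c]])
      also have "\<dots> = convolution (pk 0 (real (Suc (Suc j)))) g t"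
        by (rule iterated_integral_Suc[OF T g, symmetric]) auto
      finally show "?u t = convolution (pk 0 (real (Suc (Suc j)))) g t" .
    qed
  qed
  from this[of "m - 1"] m have "y t = convolution (pk 0 (real m)) g t" if "t \<in> {0..T}" for t
    using that by (simp add: deriv_on_def)
  then show ?thesis using that[OF g] by blast
qed

end

section \<open>Fourier coefficients of Prabhakar integrals\<close>

lemma norm_convolution_le:
  assumes k: "\<And>x. x \<le> T \<Longrightarrow> norm (k x) \<le> C" and g: "integrable lborel g" "\<And>x. x \<le> 0 \<Longrightarrow> g x = 0"
    and x: "x \<le> T"
  shows "norm (convolution k g x) \<le> C * (\<integral>s. norm (g s) \<partial>lborel)"
proof (cases "integrable lborel (\<lambda>s. k (x - s) * g s)")
  case True
  have "norm (convolution k g x) \<le> (\<integral>s. C * norm (g s) \<partial>lborel)"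
    unfolding convolution_def
  proof (rule Bochner_Integration.integral_norm_bound_integral[OF True])
    show "integrable lborel (\<lambda>s. C * norm (g s))" using g by simp
    fix s show "norm (k (x - s) * g s) \<le> C * norm (g s)"
      using k[of "x - s"] x g(2)[of s] by (cases "s \<le> 0") (auto simp: norm_mult intro: mult_right_mono)
  qed
  then show ?thesis by simp
next
  case False
  have "0 \<le> C" using k[OF x] norm_ge_zero order_trans by blast
  then show ?thesis using False by (simp add: convolution_def not_integrable_integral_eq)
qed

lemma has_vector_derivative_cis_mult:
  "((\<lambda>s. cis (l * s)) has_vector_derivative (of_real l * \<i> * cis (l * s))) (at s within A)"
  unfolding has_vector_derivative_def
  by (auto intro!: derivative_eq_intros simp: scaleR_conv_of_real mult_ac)

text \<open>Split at \<open>s = 1 / l\<close>.  Below, the integrand is bounded by its modulus; above, integrate by parts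
  against the oscillating factor.  Both parts are of order \<open>l powr - a\<close>, uniformly in \<open>x\<close>.\<close>

lemma oscillatory_power_integral_bound:
  fixes a l x :: real
  assumes a: "0 < a" "a < 1" and l: "l > 0"
  shows "norm (\<integral>s. indicator {0<..<x} s *\<^sub>R (cis (l * s) * of_real (s powr (a - 1))) \<partial>lborel) \<le> (1 / a + 3) * l powr - a"
proof -
  define e where "e s = cis (l * s) * complex_of_real (s powr (a - 1))" for s
  have [measurable]: "e \<in> borel_measurable borel" unfolding e_def[abs_def] cis_conv_exp by measurable
  have pw: "has_bochner_integral lborel (\<lambda>s. indicator {0<..<z} s * s powr (a - 1)) (z powr a / a)" if z: "z \<ge> 0" for z
  proof -
    have "a \<notin> \<int>\<^sub>\<le>\<^sub>0" using a by (auto elim!: nonpos_Ints_cases)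
    then have "Gamma (1 + a) = a * Gamma a" using Gamma_plus1[of a] by (simp add: add.commute)
    moreover have "Gamma a \<noteq> 0" using Gamma_real_pos[OF a(1)] by linarith
    ultimately have "Beta 1 a * power_kernel (1 + a) z = z powr a / a"
      using a z by (auto simp: Beta_def power_kernel_def)
    moreover have "(\<lambda>s. power_kernel 1 (z - s) * power_kernel a s) = (\<lambda>s. indicator {0<..<z} s * s powr (a - 1))"
      by (auto simp: power_kernel_def indicator_def)
    ultimately show ?thesis using power_kernel_convolution[of 1 a z] a by simp
  qed
  have pwi: "integrable lborel (\<lambda>s. indicator {0<..<z} s * s powr (a - 1))" if "z \<ge> 0" for z
    using pw[OF that] by (rule integrable.intros)
  have eint: "integrable lborel (\<lambda>s. indicator {0<..<z} s *\<^sub>R e s)" if z: "z \<ge> 0" for z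
  proof (rule Bochner_Integration.integrable_bound[OF pwi[OF z]])
    show "(\<lambda>s. indicator {0<..<z} s *\<^sub>R e s) \<in> borel_measurable lborel" by measurable
  qed (auto simp: e_def norm_mult)
  have small: "norm (\<integral>s. indicator {0<..<z} s *\<^sub>R e s \<partial>lborel) \<le> z powr a / a" if z: "z \<ge> 0" for z
  proof -
    have "norm (\<integral>s. indicator {0<..<z} s *\<^sub>R e s \<partial>lborel) \<le> (\<integral>s. indicator {0<..<z} s * s powr (a - 1) \<partial>lborel)"
      by (rule Bochner_Integration.integral_norm_bound_integral[OF eint[OF z] pwi[OF z]])
         (simp add: e_def norm_mult)
    then show ?thesis using has_bochner_integral_integral_eq[OF pw[OF z]] by simp
  qed
  define y where "y = 1 / l"
  have y: "y > 0" using l by (simp add: y_def)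
  have ya: "y powr a = l powr - a" using l by (simp add: y_def powr_divide powr_minus_divide)
  show ?thesis
  proof (cases "x \<le> y")
    case True
    show ?thesis
    proof (cases "x \<ge> 0")
      case x: True
      have "x powr a / a \<le> l powr - a / a" unfolding ya[symmetric] using True x a by (intro divide_right_mono powr_mono2) auto
      also have "\<dots> \<le> (1 / a + 3) * l powr - a" by (simp add: algebra_simps)
      finally show ?thesis using small[OF x] unfolding e_def by linarith
    next
      case False
      then show ?thesis using a by simp
    qed
  next
    case False
    then have xy: "y < x" by simp
    have ya1: "y powr (a - 1) / l = l powr - a"
      using l by (simp add: y_def powr_divide powr_minus_divide powr_diff)
    define G where "G s = e s / (\<i> * of_real l)" for s
    \<comment> \<open>\<open>G\<close> is the boundary term of the integration by parts, \<open>- r\<close> the remaining integrand\<close>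
    define r where "r s = cis (l * s) * of_real ((a - 1) * s powr (a - 2)) / (\<i> * of_real l)" for s
    have Gd: "(G has_vector_derivative e s + r s) (at s within {y..x})" if "s \<in> {y..x}" for s
    proof -
      have s: "s > 0" using that y by simp
      have p: "((\<lambda>s. complex_of_real (s powr (a - 1))) has_vector_derivative of_real ((a - 1) * s powr (a - 2))) (at s within {y..x})"
        using s by (intro has_vector_derivative_of_real) (auto intro!: derivative_eq_intros simp: has_real_derivative_iff_has_vector_derivative[symmetric])
      have c: "((\<lambda>s. cis (l * s)) has_vector_derivative (of_real l * \<i> * cis (l * s))) (at s within {y..x})"
        by (rule has_vector_derivative_cis_mult)
      let ?D = "cis (l * s) * of_real ((a - 1) * s powr (a - 2)) + of_real l * \<i> * cis (l * s) * of_real (s powr (a - 1))"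
      have "((\<lambda>s. e s) has_vector_derivative ?D) (at s within {y..x})"
        unfolding e_def by (rule has_vector_derivative_mult[OF c p])
      then have "(G has_vector_derivative ?D / (\<i> * of_real l)) (at s within {y..x})"
        unfolding G_def by (rule has_vector_derivative_divide)
      moreover have "?D / (\<i> * of_real l) = e s + r s"
        using l by (simp add: e_def r_def field_simps)
      ultimately show ?thesis by simp
    qed
    have I1: "((\<lambda>s. e s + r s) has_integral G x - G y) {y..x}"
      by (rule fundamental_theorem_of_calculus) (use xy Gd in auto)
    have I2: "((\<lambda>s. (1 - a) * s powr (a - 2) / l) has_integral (- (x powr (a - 1)) / l) - (- (y powr (a - 1)) / l)) {y..x}"
    proof (rule fundamental_theorem_of_calculus)
      fix s assume "s \<in> {y..x}"
      then have s: "s > 0" using y by simp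
      show "((\<lambda>s. - (s powr (a - 1)) / l) has_vector_derivative (1 - a) * s powr (a - 2) / l) (at s within {y..x})"
        unfolding has_real_derivative_iff_has_vector_derivative[symmetric]
        using s l by (auto intro!: derivative_eq_intros simp: field_simps)
    qed (use xy in simp)
    have rint: "r integrable_on {y..x}"
      unfolding r_def by (rule integrable_continuous_real) (use y l in \<open>auto intro!: continuous_intros simp: cis_conv_exp\<close>)
    have rb: "norm (integral {y..x} r) \<le> integral {y..x} (\<lambda>s. (1 - a) * s powr (a - 2) / l)"
    proof (rule Henstock_Kurzweil_Integration.integral_norm_bound_integral[OF rint has_integral_integrable[OF I2]])
      fix s assume "s \<in> {y..x}"
      have "cmod (complex_of_real ((a - 1) * s powr (a - 2))) = (1 - a) * s powr (a - 2)"
        using a by (simp only: norm_of_real abs_mult) simp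
      then show "norm (r s) \<le> (1 - a) * s powr (a - 2) / l"
        using l unfolding r_def norm_mult norm_divide by simp
    qed
    have "integral {y..x} e = integral {y..x} (\<lambda>s. (e s + r s) - r s)" by simp
    also have "\<dots> = (G x - G y) - integral {y..x} r"
      using Henstock_Kurzweil_Integration.integral_diff[OF has_integral_integrable[OF I1] rint] integral_unique[OF I1] by simp
    finally have "norm (integral {y..x} e) \<le> norm (G x) + norm (G y) + norm (integral {y..x} r)"
      using norm_triangle_ineq4[of "G x - G y" "integral {y..x} r"] norm_triangle_ineq4[of "G x" "G y"] by simp
    also have "norm (G x) = x powr (a - 1) / l" using l by (simp add: G_def e_def norm_mult norm_divide)
    also have "norm (G y) = y powr (a - 1) / l" using l by (simp add: G_def e_def norm_mult norm_divide)
    also have "norm (integral {y..x} r) \<le> y powr (a - 1) / l - x powr (a - 1) / l"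
      using rb integral_unique[OF I2] by simp
    finally have big: "norm (integral {y..x} e) \<le> 2 * l powr - a" unfolding ya1 by simp
    have si: "set_integrable lborel {y..x} e"
      unfolding e_def by (rule borel_integrable_atLeastAtMost') (use y in \<open>auto intro!: continuous_intros simp: cis_conv_exp\<close>)
    have si': "integrable lborel (\<lambda>s. indicator {y..x} s *\<^sub>R e s)" using si by (simp add: set_integrable_def)
    have "(\<integral>s. indicator {0<..<x} s *\<^sub>R e s \<partial>lborel) = (\<integral>s. indicator {0<..<y} s *\<^sub>R e s + indicator {y..x} s *\<^sub>R e s \<partial>lborel)"
    proof (rule integral_cong_AE)
      show "AE s in lborel. indicator {0<..<x} s *\<^sub>R e s = indicator {0<..<y} s *\<^sub>R e s + indicator {y..x} s *\<^sub>R e s"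
        using AE_lborel_singleton[of x] by eventually_elim (use y xy in \<open>auto simp: indicator_def\<close>)
    qed measurable
    also have "\<dots> = (\<integral>s. indicator {0<..<y} s *\<^sub>R e s \<partial>lborel) + (\<integral>s. indicator {y..x} s *\<^sub>R e s \<partial>lborel)"
      by (rule Bochner_Integration.integral_add[OF eint si']) (use y in simp)
    also have "(\<integral>s. indicator {y..x} s *\<^sub>R e s \<partial>lborel) = integral {y..x} e"
      using set_borel_integral_eq_integral(2)[OF si] by (simp add: set_lebesgue_integral_def)
    finally have "norm (\<integral>s. indicator {0<..<x} s *\<^sub>R e s \<partial>lborel) \<le> y powr a / a + 2 * l powr - a"
      using small[of y] y big norm_triangle_ineq[of "\<integral>s. indicator {0<..<y} s *\<^sub>R e s \<partial>lborel" "integral {y..x} e"] by simp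
    also have "\<dots> \<le> (1 / a + 3) * l powr - a" unfolding ya by (simp add: algebra_simps)
    finally show ?thesis unfolding e_def .
  qed
qed

text \<open>The kernel whose convolution, evaluated at \<open>T\<close>, is a unimodular multiple of the Fourier coefficient
  on \<open>(0,T)\<close> at frequency \<open>l\<close>.  In this form Fourier coefficients fall under the associativity of convolution.\<close>

definition oscillation :: "real \<Rightarrow> real \<Rightarrow> real \<Rightarrow> complex" where
  "oscillation T l x = (if 0 < x \<and> x < T then cis (- (l * x)) else 0)"

lemma borel_measurable_oscillation [measurable]: "oscillation T l \<in> borel_measurable borel"
  unfolding oscillation_def[abs_def] cis_conv_exp by measurable

lemma norm_oscillation_le: "norm (oscillation T l x) \<le> 1"
  by (simp add: oscillation_def)

context prabhakar
begin

lemma oscillation_pk_int: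
  assumes \<mu>: "\<mu> > 0" and x: "x \<le> T"
  shows "integrable lborel (\<lambda>s. oscillation T l (x - s) * pk \<gamma> \<mu> s)"
    and "(\<integral>s. norm (oscillation T l (x - s) * pk \<gamma> \<mu> s) \<partial>lborel) \<le> (\<integral>s. norm (indicator {..T} s *\<^sub>R pk \<gamma> \<mu> s) \<partial>lborel)"
proof -
  have [measurable]: "pk \<gamma> \<mu> \<in> borel_measurable borel" by (rule borel_measurable_pk[OF \<mu>])
  have b: "norm (oscillation T l (x - s) * pk \<gamma> \<mu> s) \<le> norm (indicator {..T} s *\<^sub>R pk \<gamma> \<mu> s)" for s
  proof (cases "s \<le> T")
    case True
    then show ?thesis using mult_right_mono[OF norm_oscillation_le, of "norm (pk \<gamma> \<mu> s)"] by (simp add: norm_mult)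
  next
    case False
    then show ?thesis using x by (simp add: oscillation_def)
  qed
  show 1: "integrable lborel (\<lambda>s. oscillation T l (x - s) * pk \<gamma> \<mu> s)"
    by (rule Bochner_Integration.integrable_bound[OF integrable_truncated_pk[OF \<mu>, of T \<gamma>]]) (use b in auto)
  show "(\<integral>s. norm (oscillation T l (x - s) * pk \<gamma> \<mu> s) \<partial>lborel) \<le> (\<integral>s. norm (indicator {..T} s *\<^sub>R pk \<gamma> \<mu> s) \<partial>lborel)"
    by (rule integral_mono[OF integrable_norm[OF 1] integrable_norm[OF integrable_truncated_pk[OF \<mu>]] b])
qed

lemma oscillation_pk_assoc:
  assumes \<mu>: "\<mu> > 0" and x: "x \<le> T" and g: "integrable lborel g" "\<And>x. x \<le> 0 \<Longrightarrow> g x = 0"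
  shows "convolution (oscillation T l) (convolution (pk \<gamma> \<mu>) g) x = convolution (convolution (oscillation T l) (pk \<gamma> \<mu>)) g x"
proof -
  have "has_bochner_integral lborel (\<lambda>s. oscillation T l (x - s) * convolution (pk \<gamma> \<mu>) g s) (convolution (convolution (oscillation T l) (pk \<gamma> \<mu>)) g x)"
    by (rule convolution_assoc[OF _ _ g oscillation_pk_int[OF \<mu>] x]) (auto simp: borel_measurable_pk[OF \<mu>])
  then show ?thesis by (simp add: convolution_def[of "oscillation T l" "convolution _ _"] has_bochner_integral_iff)
qed

lemma oscillation_power_bound:
  assumes a: "0 < a" "a < 1" and l: "l > 0" and x: "x \<le> T"
  shows "norm (convolution (oscillation T l) (pk 0 a) x) \<le> (1 / a + 3) / Gamma a * l powr - a"
proof -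
  have "convolution (oscillation T l) (pk 0 a) x = (\<integral>s. (cis (- (l * x)) / of_real (Gamma a)) * (indicator {0<..<x} s *\<^sub>R (cis (l * s) * of_real (s powr (a - 1)))) \<partial>lborel)"
    unfolding convolution_def
  proof (rule Bochner_Integration.integral_cong[OF refl])
    fix s
    have "cis (- (l * (x - s))) = cis (- (l * x)) * cis (l * s)" by (simp add: cis_mult algebra_simps)
    then show "oscillation T l (x - s) * pk 0 a s = (cis (- (l * x)) / of_real (Gamma a)) * (indicator {0<..<x} s *\<^sub>R (cis (l * s) * of_real (s powr (a - 1))))"
      using x a by (auto simp: oscillation_def pk_0 power_kernel_def indicator_def)
  qed
  also have "\<dots> = (cis (- (l * x)) / of_real (Gamma a)) * (\<integral>s. indicator {0<..<x} s *\<^sub>R (cis (l * s) * of_real (s powr (a - 1))) \<partial>lborel)"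
    by (rule integral_mult_right_zero)
  finally have "norm (convolution (oscillation T l) (pk 0 a) x) = 1 / Gamma a * norm (\<integral>s. indicator {0<..<x} s *\<^sub>R (cis (l * s) * complex_of_real (s powr (a - 1))) \<partial>lborel)"
    using Gamma_real_pos[OF a(1)] by (simp add: norm_mult norm_divide)
  also have "\<dots> \<le> 1 / Gamma a * ((1 / a + 3) * l powr - a)"
    using Gamma_real_pos[OF a(1)] by (intro mult_left_mono oscillatory_power_integral_bound[OF a l]) auto
  finally show ?thesis by simp
qed

text \<open>Only pure powers need an oscillation estimate.  By the semigroup law the kernel of order \<open>\<delta>\<close> contains
  the power kernel of order \<open>\<delta> / 2\<close> as a convolution factor, which gives the decay, while the
  remaining factors are absolutely integrable.\<close>

theorem fourier_decay:
  assumes \<delta>: "0 < \<delta>" "\<delta> < 1" and g: "integrable lborel g" "\<And>x. x \<le> 0 \<Longrightarrow> g x = 0"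
  obtains C where "\<And>l. l > 0 \<Longrightarrow> norm (convolution (oscillation T l) (convolution (pk \<gamma> \<delta>) g) T) \<le> C * l powr - (\<delta> / 2)"
proof -
  define a where "a = \<delta> / 2"
  have a: "0 < a" "a < 1" using \<delta> by (auto simp: a_def)
  let ?h = "\<lambda>x. indicator {..T} x *\<^sub>R pk \<gamma> a x"
  have h: "integrable lborel ?h" "\<And>x. x \<le> 0 \<Longrightarrow> ?h x = 0"
    using integrable_truncated_pk[OF a(1)] by (auto simp: pk_nonpos)
  define D where "D = (1 / a + 3) / Gamma a * (\<integral>s. norm (?h s) \<partial>lborel)"
  have inner: "norm (convolution (oscillation T l) (pk \<gamma> \<delta>) x) \<le> D * l powr - a" if l: "l > 0" and x: "x \<le> T" for l x
  proof -
    have "pk \<gamma> \<delta> = convolution (pk 0 a) (pk \<gamma> a)" using convolution_pk_pk[OF a(1) a(1)] by (simp add: a_def)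
    then have "convolution (oscillation T l) (pk \<gamma> \<delta>) x = convolution (oscillation T l) (convolution (pk 0 a) ?h) x"
      using x by (intro convolution_cong) (auto simp: oscillation_def pk_nonpos intro!: convolution_cong)
    also have "\<dots> = convolution (convolution (oscillation T l) (pk 0 a)) ?h x"
      by (rule oscillation_pk_assoc[OF a(1) x h])
    also have "norm \<dots> \<le> ((1 / a + 3) / Gamma a * l powr - a) * (\<integral>s. norm (?h s) \<partial>lborel)"
      by (rule norm_convolution_le[OF oscillation_power_bound[OF a l] h x])
    finally show ?thesis by (simp add: D_def mult_ac)
  qed
  have "norm (convolution (oscillation T l) (convolution (pk \<gamma> \<delta>) g) T) \<le> D * (\<integral>s. norm (g s) \<partial>lborel) * l powr - a" if l: "l > 0" for l
  proof -
    have "norm (convolution (oscillation T l) (convolution (pk \<gamma> \<delta>) g) T) = norm (convolution (convolution (oscillation T l) (pk \<gamma> \<delta>)) g T)"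
      using oscillation_pk_assoc[OF \<delta>(1) order_refl g] by simp
    also have "\<dots> \<le> D * l powr - a * (\<integral>s. norm (g s) \<partial>lborel)"
      by (rule norm_convolution_le[OF inner[OF l] g order_refl])
    finally show ?thesis by (simp add: mult_ac)
  qed
  then show ?thesis using that unfolding a_def by blast
qed

end

section \<open>Lacunary series\<close>

text \<open>A continuous function whose Fourier coefficients at the sparse frequencies \<open>M ^ j\<close> decay only like
  \<open>(1/2) ^ j\<close>, that is, more slowly than any prescribed power of the frequency once \<open>M\<close> is large.\<close>

definition lacunary :: "real \<Rightarrow> nat \<Rightarrow> real \<Rightarrow> complex" where
  "lacunary T M t = (\<Sum>j. of_real ((1/2) ^ j) * cis (- (2 * pi * real M ^ j / T * t)))"

lemma continuous_lacunary: "continuous_on A (lacunary T M)"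
proof -
  define c where "c j = 2 * pi * real M ^ j / T" for j
  let ?f = "\<lambda>j t. complex_of_real ((1/2) ^ j) * cis (- (c j * t))"
  have "uniform_limit A (\<lambda>n t. \<Sum>j<n. ?f j t) (\<lambda>t. \<Sum>j. ?f j t) sequentially"
    by (rule Weierstrass_m_test[where M = "\<lambda>j. (1/2) ^ j"]) (auto simp: norm_mult norm_power summable_geometric)
  then have "continuous_on A (\<lambda>t. \<Sum>j. ?f j t)"
    by (rule uniform_limit_theorem[rotated]) (auto intro!: always_eventually continuous_intros simp: cis_conv_exp)
  then show ?thesis unfolding lacunary_def[abs_def] c_def .
qed

lemma fourier_mode_integral:
  fixes c T :: real
  assumes T: "T > 0" and c: "c * T = 2 * pi * of_int k" and k: "k \<noteq> 0"
  shows "(\<integral>s. indicator {0<..<T} s *\<^sub>R cis (c * s) \<partial>lborel) = 0"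
proof -
  have c0: "c \<noteq> 0" using c k by auto
  have cont: "continuous_on {0..T} (\<lambda>s. cis (c * s))" unfolding cis_conv_exp by (intro continuous_intros)
  have si: "set_integrable lborel {0..T} (\<lambda>s. cis (c * s))" by (rule borel_integrable_atLeastAtMost'[OF cont])
  have "((\<lambda>s. cis (c * s)) has_integral cis (c * T) / (\<i> * of_real c) - cis (c * 0) / (\<i> * of_real c)) {0..T}"
  proof (rule fundamental_theorem_of_calculus)
    fix s
    have "((\<lambda>s. cis (c * s)) has_vector_derivative (of_real c * \<i> * cis (c * s))) (at s within {0..T})"
      by (rule has_vector_derivative_cis_mult)
    then have "((\<lambda>s. cis (c * s) / (\<i> * of_real c)) has_vector_derivative (of_real c * \<i> * cis (c * s)) / (\<i> * of_real c)) (at s within {0..T})"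
      by (rule has_vector_derivative_divide)
    then show "((\<lambda>s. cis (c * s) / (\<i> * of_real c)) has_vector_derivative cis (c * s)) (at s within {0..T})"
      using c0 by simp
  qed (use T in simp)
  moreover have "cis (c * T) = 1" unfolding c by (rule cis_multiple_2pi) simp
  ultimately have "integral {0..T} (\<lambda>s. cis (c * s)) = 0" by (simp add: integral_unique)
  moreover have "(\<integral>s. indicator {0<..<T} s *\<^sub>R cis (c * s) \<partial>lborel) = (LINT s:{0..T}|lborel. cis (c * s))"
    unfolding set_lebesgue_integral_def
  proof (rule integral_cong_AE)
    show "AE s in lborel. indicator {0<..<T} s *\<^sub>R cis (c * s) = indicator {0..T} s *\<^sub>R cis (c * s)"
      using AE_lborel_singleton[of T] AE_lborel_singleton[of 0] by eventually_elim (auto simp: indicator_def)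
  qed (auto simp: cis_conv_exp)
  ultimately show ?thesis using set_borel_integral_eq_integral(2)[OF si] by simp
qed

lemma lacunary_fourier_coefficient:
  assumes T: "T > 0" and M: "M \<ge> 2"
  shows "convolution (oscillation T (2 * pi * real M ^ n / T)) (lacunary T M) T = of_real (T / 2 ^ n)"
proof -
  let ?l = "\<lambda>j. 2 * pi * real M ^ j / T"
  \<comment> \<open>orthogonality leaves only the term \<open>j = n\<close>\<close>
  define F where "F j s = indicator {0<..<T} s *\<^sub>R (complex_of_real ((1/2) ^ j) * cis ((?l n - ?l j) * s))" for j s
  have Fint: "integrable lborel (F j)" for j
  proof -
    have "set_integrable lborel {0..T} (\<lambda>s. complex_of_real ((1/2) ^ j) * cis ((?l n - ?l j) * s))"
      by (rule borel_integrable_atLeastAtMost') (auto intro!: continuous_intros simp: cis_conv_exp)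
    then have "set_integrable lborel {0<..<T} (\<lambda>s. complex_of_real ((1/2) ^ j) * cis ((?l n - ?l j) * s))"
      by (rule set_integrable_subset) auto
    then show ?thesis by (simp add: set_integrable_def F_def[abs_def])
  qed
  have nF: "norm (F j s) = (1/2) ^ j * indicator {0<..<T} s" for j s
    by (simp add: F_def norm_mult norm_power indicator_def)
  have nFs: "summable (\<lambda>j. norm (F j s))" for s
    unfolding nF by (intro summable_mult2 summable_geometric) simp
  have nFi: "summable (\<lambda>j. \<integral>s. norm (F j s) \<partial>lborel)"
    unfolding nF using T by (simp add: summable_mult2 summable_geometric)
  have eq: "oscillation T (?l n) (T - s) * lacunary T M s = (\<Sum>j. F j s)" for s
  proof (cases "s \<in> {0<..<T}")
    case True
    have "cis (- (?l n * T)) = 1"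
    proof -
      have "- (?l n * T) = 2 * pi * of_int (- (int M ^ n))" using T by simp
      then show ?thesis using cis_multiple_2pi[of "of_int (- (int M ^ n))"] by simp
    qed
    moreover have "cis (- (?l n * (T - s))) = cis (- (?l n * T)) * cis (?l n * s)"
      by (simp only: cis_mult right_diff_distrib minus_diff_eq uminus_add_conv_diff)
    ultimately have "cis (- (?l n * (T - s))) = cis (?l n * s)" by simp
    then have o: "oscillation T (?l n) (T - s) = cis (?l n * s)" using True by (simp add: oscillation_def)
    have sm: "summable (\<lambda>j. complex_of_real ((1/2) ^ j) * cis (- (?l j * s)))"
      by (rule summable_norm_cancel) (simp add: norm_mult norm_power summable_geometric)
    have "oscillation T (?l n) (T - s) * lacunary T M s = (\<Sum>j. cis (?l n * s) * (complex_of_real ((1/2) ^ j) * cis (- (?l j * s))))"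
      unfolding o lacunary_def by (rule suminf_mult[OF sm, symmetric])
    also have "\<dots> = (\<Sum>j. F j s)"
    proof (rule suminf_cong)
      fix j
      have "cis (?l n * s) * cis (- (?l j * s)) = cis ((?l n - ?l j) * s)"
        by (simp only: cis_mult left_diff_distrib add_uminus_conv_diff)
      then show "cis (?l n * s) * (complex_of_real ((1/2) ^ j) * cis (- (?l j * s))) = F j s"
        using True by (simp add: F_def mult.left_commute)
    qed
    finally show ?thesis .
  next
    case False
    then have "oscillation T (?l n) (T - s) = 0" by (auto simp: oscillation_def)
    then show ?thesis using False by (simp add: F_def)
  qed
  have Fval: "(\<integral>s. F j s \<partial>lborel) = (if j = n then of_real (T / 2 ^ n) else 0)" for j
  proof (cases "j = n")
    case True
    have "F n = (\<lambda>s. complex_of_real ((1/2) ^ n) * complex_of_real (indicator {0<..<T} s))"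
      by (auto simp: F_def indicator_def)
    then show ?thesis using True T by (simp add: power_one_over field_simps)
  next
    case False
    have k: "(?l n - ?l j) * T = 2 * pi * of_int (int M ^ n - int M ^ j)" using T by (simp add: field_simps)
    have "int M ^ n - int M ^ j \<noteq> 0" using False M by (simp add: power_inject_exp)
    have "F j = (\<lambda>s. complex_of_real ((1/2) ^ j) * (indicator {0<..<T} s *\<^sub>R cis ((?l n - ?l j) * s)))"
      by (auto simp: F_def indicator_def)
    then have "(\<integral>s. F j s \<partial>lborel) = complex_of_real ((1/2) ^ j) * (\<integral>s. indicator {0<..<T} s *\<^sub>R cis ((?l n - ?l j) * s) \<partial>lborel)"
      by (simp only: integral_mult_right_zero)
    then show ?thesis using fourier_mode_integral[OF T k \<open>int M ^ n - int M ^ j \<noteq> 0\<close>] False by simp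
  qed
  have "convolution (oscillation T (?l n)) (lacunary T M) T = (\<integral>s. (\<Sum>j. F j s) \<partial>lborel)"
    unfolding convolution_def eq ..
  also have "\<dots> = (\<Sum>j. \<integral>s. F j s \<partial>lborel)"
    by (rule integral_suminf[OF Fint _ nFi]) (use nFs in simp)
  also have "\<dots> = of_real (T / 2 ^ n)"
    unfolding Fval using suminf_finite[of "{n}" "\<lambda>j. if j = n then complex_of_real (T / 2 ^ n) else 0"] by simp
  finally show ?thesis .
qed

section \<open>The range condition\<close>

text \<open>The set where two continuous functions differ is open, hence empty as soon as it is null.\<close>

lemma continuous_AE_eq_imp_eq:
  fixes x y :: "real \<Rightarrow> complex"
  assumes T: "T > 0" and c: "continuous_on {0..T} x" "continuous_on {0..T} y"
    and ae: "AE t in lebesgue. t \<in> {0<..<T} \<longrightarrow> x t = y t" and t: "t \<in> {0..T}"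
  shows "x t = y t"
proof -
  let ?d = "\<lambda>t. x t - y t"
  have d: "continuous_on {0..T} ?d" by (intro continuous_intros c)
  have "?d s = 0" if s: "s \<in> {0<..<T}" for s
  proof (rule ccontr)
    assume ne: "?d s \<noteq> 0"
    let ?U = "{u \<in> {0<..<T}. ?d u \<noteq> 0}"
    have U: "?d -` (- {0}) \<inter> {0<..<T} = ?U" by auto
    have o: "open ?U" unfolding U[symmetric]
      by (rule continuous_on_open_vimage[THEN iffD1, rule_format]) (auto intro: continuous_on_subset[OF d])
    have "?U \<in> null_sets lebesgue"
    proof -
      have "AE u in lebesgue. u \<notin> ?U" using ae by eventually_elim auto
      then show ?thesis using completion.null_sets_iff_AE[of ?U lborel] by simp
    qed
    then have "negligible ?U" by (simp add: negligible_iff_null_sets)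
    moreover have "?U \<noteq> {}" using s ne by blast
    ultimately show False using open_not_negligible[OF o] by blast
  qed
  then have "?d t = 0"
    using continuous_constant_on_closure[of "{0<..<T}" ?d 0 t] d T t by simp
  then show ?thesis by simp
qed

lemma weakly_singular_zero: "weakly_singular T (\<lambda>_. 0)"
proof -
  have "(\<lambda>_. 0) \<in> L1 T" by (simp add: L1_def set_integrable_def)
  then show ?thesis unfolding weakly_singular_def by (auto intro!: exI[of _ 1])
qed

context prabhakar
begin

lemma integrable_pk_mult:
  assumes \<mu>: "\<mu> \<ge> 1" and g: "integrable lborel g" "\<And>x. x \<le> 0 \<Longrightarrow> g x = 0"
  shows "integrable lborel (\<lambda>s. pk \<gamma> \<mu> (t - s) * g s)"
proof -
  have \<mu>0: "\<mu> > 0" using \<mu> by simp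
  have [measurable]: "pk \<gamma> \<mu> \<in> borel_measurable borel" "g \<in> borel_measurable borel"
    using borel_measurable_pk[OF \<mu>0] g by auto
  obtain B where B: "B > 0" "\<And>x. x \<le> max 1 t \<Longrightarrow> cmod (pk \<gamma> \<mu> x) \<le> B * power_kernel \<mu> x"
    using pk_bound[OF \<mu>0, of "max 1 t"] by (metis less_max_iff_disj zero_less_one)
  have b: "cmod (pk \<gamma> \<mu> x) \<le> B * max 1 t powr (\<mu> - 1)" if "x \<le> max 1 t" for x
  proof -
    have "power_kernel \<mu> x \<le> max 1 t powr (\<mu> - 1)"
      using that \<mu> by (auto simp: power_kernel_def intro: powr_mono2)
    then show ?thesis using B(2)[OF that] mult_left_mono[of "power_kernel \<mu> x" "max 1 t powr (\<mu> - 1)" B] B(1) by linarith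
  qed
  show ?thesis
  proof (rule Bochner_Integration.integrable_bound)
    show "integrable lborel (\<lambda>s. B * max 1 t powr (\<mu> - 1) * norm (g s))" using g by simp
    show "AE s in lborel. norm (pk \<gamma> \<mu> (t - s) * g s) \<le> norm (B * max 1 t powr (\<mu> - 1) * norm (g s))"
    proof (rule AE_I2)
      fix s
      show "norm (pk \<gamma> \<mu> (t - s) * g s) \<le> norm (B * max 1 t powr (\<mu> - 1) * norm (g s))"
      proof (cases "s \<le> 0")
        case False
        then have "t - s \<le> max 1 t" by simp
        from mult_right_mono[OF b[OF this], of "norm (g s)"] B(1) show ?thesis by (simp add: norm_mult abs_mult)
      qed (simp add: g)
    qed
  qed measurable
qed

context
  fixes T \<mu> \<delta> :: real and m :: nat
  assumes T: "T > 0" and m: "m \<ge> 1" and \<mu>: "real m - 1 < \<mu>" "\<mu> < real m" and \<delta>: "\<delta> = real m - \<mu>"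
begin

lemma orders: "\<mu> > 0" "0 < \<delta>" "\<delta> < 1" "\<mu> + \<delta> = real m" "\<mu> + \<delta> \<ge> 1" "\<delta> + \<mu> = real m" "\<delta> + \<mu> \<ge> 1"
  using m \<mu> \<delta> by auto

text \<open>Convolving with the kernel of order \<open>\<delta>\<close> and parameter \<open>- \<gamma>\<close> turns the operator into \<open>m\<close>-fold integration, which is
  injective modulo null sets.\<close>

lemma convolution_pk_injective:
  assumes g1: "integrable lborel g1" "\<And>x. x \<notin> {0<..<T} \<Longrightarrow> g1 x = 0"
    and g2: "integrable lborel g2" "\<And>x. x \<notin> {0<..<T} \<Longrightarrow> g2 x = 0"
    and eq: "\<And>t. t \<in> {0..T} \<Longrightarrow> convolution (pk \<gamma> \<mu>) g1 t = convolution (pk \<gamma> \<mu>) g2 t"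
  shows "AE s in lebesgue. g1 s = g2 s"
proof -
  have s1: "\<And>x. x \<le> 0 \<Longrightarrow> g1 x = 0" and s2: "\<And>x. x \<le> 0 \<Longrightarrow> g2 x = 0" using g1 g2 by auto
  have "convolution (pk 0 (real m)) g1 t = convolution (pk 0 (real m)) g2 t" if t: "t \<in> {0..T}" for t
  proof -
    have "convolution (pk 0 (real m)) g1 t = convolution (pk (- \<gamma>) \<delta>) (convolution (pk \<gamma> \<mu>) g1) t"
      using convolution_pk_assoc[OF orders(2,1,7) g1(1) s1, of "- \<gamma>" \<gamma> t] orders by simp
    also have "\<dots> = convolution (pk (- \<gamma>) \<delta>) (convolution (pk \<gamma> \<mu>) g2) t"
    proof (rule convolution_cong)
      fix s assume s: "s < t"
      show "convolution (pk \<gamma> \<mu>) g1 s = convolution (pk \<gamma> \<mu>) g2 s"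
      proof (cases "s \<le> 0")
        case True
        then show ?thesis using convolution_pk_supp[of g1 s] convolution_pk_supp[of g2 s] s1 s2 by simp
      qed (use eq[of s] s t in simp)
    qed (simp add: pk_nonpos)
    also have "\<dots> = convolution (pk 0 (real m)) g2 t"
      using convolution_pk_assoc[OF orders(2,1,7) g2(1) s2, of "- \<gamma>" \<gamma> t] orders by simp
    finally show ?thesis .
  qed
  moreover have "convolution (pk 0 (real m)) (\<lambda>s. g1 s - g2 s) t = convolution (pk 0 (real m)) g1 t - convolution (pk 0 (real m)) g2 t" for t
    unfolding convolution_def right_diff_distrib
    by (rule Bochner_Integration.integral_diff) (use m in \<open>auto intro!: integrable_pk_mult g1(1) g2(1) s1 s2\<close>)
  ultimately have "convolution (pk 0 (real m)) (\<lambda>s. g1 s - g2 s) t = 0" if "t \<in> {0..T}" for t using that by simp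
  then have "AE s in lebesgue. g1 s - g2 s = 0"
    by (intro iterated_integral_eq_0_imp[OF T _ _ m]) (use g1 g2 in auto)
  then show ?thesis by eventually_elim simp
qed

lemma truncated_convolution_represents:
  assumes g: "integrable lborel g" "\<And>x. x \<notin> {0<..<T} \<Longrightarrow> g x = 0"
    and ae: "AE t in lebesgue. t \<in> {0<..<T} \<longrightarrow> v t = convolution (pk \<gamma> \<delta>) g t"
  shows "represents T (\<lambda>t. indicator {0<..<T} t *\<^sub>R convolution (pk \<gamma> \<delta>) g t) v"
proof -
  have "AE t in lebesgue. t \<in> {0<..<T} \<longrightarrow> v t = indicator {0<..<T} t *\<^sub>R convolution (pk \<gamma> \<delta>) g t"
    using ae by eventually_elim simp
  then show ?thesis
    using integrable_truncated_convolution[OF orders(2) g(1), of T \<gamma>] g(2) by (auto simp: represents_def)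
qed

text \<open>The value at \<open>t \<le> T\<close> only uses arguments below \<open>t\<close>.  The truncation makes the inner convolution
  integrable over the line, as its kernel need not be.\<close>

lemma convolution_truncated:
  assumes t: "t \<in> {0..T}" and g: "\<And>x. x \<le> 0 \<Longrightarrow> g x = 0"
  shows "convolution (pk \<gamma>1 \<mu>1) (\<lambda>t. indicator {0<..<T} t *\<^sub>R convolution (pk \<gamma>2 \<mu>2) g t) t
    = convolution (pk \<gamma>1 \<mu>1) (convolution (pk \<gamma>2 \<mu>2) g) t"
proof (rule convolution_cong)
  fix s assume "s < t"
  then show "indicator {0<..<T} s *\<^sub>R convolution (pk \<gamma>2 \<mu>2) g s = convolution (pk \<gamma>2 \<mu>2) g s"
    using t convolution_pk_supp[of g s] g by (cases "s \<le> 0") auto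
qed (simp add: pk_nonpos)

lemma convolution_truncated_inverse:
  assumes t: "t \<in> {0..T}" and g: "integrable lborel g" "\<And>x. x \<le> 0 \<Longrightarrow> g x = 0"
  shows "convolution (pk \<gamma> \<mu>) (\<lambda>t. indicator {0<..<T} t *\<^sub>R convolution (pk (- \<gamma>) \<delta>) g t) t = convolution (pk 0 (real m)) g t"
  using convolution_truncated[of t g \<gamma> \<mu> "- \<gamma>" \<delta>] t g(2)
    convolution_pk_assoc[OF orders(1,2,5) g, of \<gamma> "- \<gamma>" t] orders by simp

lemma range_condition_imp_AC0:
  assumes "range_condition T m \<rho> \<mu> \<omega> \<gamma> v"
  shows "prabhakar_integral \<rho> \<mu> \<omega> \<gamma> v \<in> AC0 T m"
proof -
  obtain w where w: "w \<in> L1 T" and ae: "AE t in lebesgue. t \<in> {0<..<T} \<longrightarrow> v t = prabhakar_integral \<rho> \<delta> \<omega> (- \<gamma>) w t"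
    using assms unfolding range_condition_def \<delta> by blast
  obtain g where rep: "represents T g w" using L1_imp_represents[OF w] by blast
  then have g: "integrable lborel g" "\<And>x. x \<notin> {0<..<T} \<Longrightarrow> g x = 0" by (auto simp: represents_def)
  have vg: "AE t in lebesgue. t \<in> {0<..<T} \<longrightarrow> v t = convolution (pk (- \<gamma>) \<delta>) g t"
    using ae by eventually_elim (use prabhakar_integral_eq_convolution[OF _ orders(2) rep] in auto)
  have rv: "represents T (\<lambda>t. indicator {0<..<T} t *\<^sub>R convolution (pk (- \<gamma>) \<delta>) g t) v"
    by (rule truncated_convolution_represents[OF g(1) _ vg]) (rule g(2))
  have "prabhakar_integral \<rho> \<mu> \<omega> \<gamma> v t = convolution (pk 0 (real m)) g t" if t: "t \<in> {0..T}" for t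
    using prabhakar_integral_eq_convolution[OF t orders(1) rv] convolution_truncated_inverse[OF t g(1)] g(2) by simp
  then show ?thesis by (intro iterated_integral_AC0[OF T g m])
qed

text \<open>Let \<open>g\<close> be the \<open>m\<close>-th derivative of \<open>R v\<close>.  Its convolution with the kernel of order \<open>\<delta>\<close> and
  parameter \<open>- \<gamma>\<close> has the same image under \<open>R\<close> as \<open>v\<close>, namely the \<open>m\<close>-fold integral of \<open>g\<close>, and \<open>R\<close> is
  injective.\<close>

lemma AC0_imp_range_condition:
  assumes v: "v \<in> L1 T" and ac: "prabhakar_integral \<rho> \<mu> \<omega> \<gamma> v \<in> AC0 T m"
  shows "range_condition T m \<rho> \<mu> \<omega> \<gamma> v"
proof -
  obtain h where rep: "represents T h v" using L1_imp_represents[OF v] by blast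
  then have h: "integrable lborel h" "\<And>x. x \<notin> {0<..<T} \<Longrightarrow> h x = 0"
    and hv: "AE x in lebesgue. x \<in> {0<..<T} \<longrightarrow> v x = h x" by (auto simp: represents_def)
  obtain g where g: "integrable lborel g" "\<And>x. x \<notin> {0<..<T} \<Longrightarrow> g x = 0"
    and y: "\<And>t. t \<in> {0..T} \<Longrightarrow> prabhakar_integral \<rho> \<mu> \<omega> \<gamma> v t = convolution (pk 0 (real m)) g t"
    using AC0_imp_iterated_integral[OF T m ac] by blast
  let ?h = "\<lambda>t. indicator {0<..<T} t *\<^sub>R convolution (pk (- \<gamma>) \<delta>) g t"
  have "AE s in lebesgue. h s = ?h s"
  proof (rule convolution_pk_injective[where \<gamma> = \<gamma>])
    show "integrable lborel ?h" using integrable_truncated_convolution[OF orders(2) g(1)] g(2) by simp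
    show "convolution (pk \<gamma> \<mu>) h t = convolution (pk \<gamma> \<mu>) ?h t" if t: "t \<in> {0..T}" for t
      using y[OF t] prabhakar_integral_eq_convolution[OF t orders(1) rep] convolution_truncated_inverse[OF t g(1)] g(2) by simp
  qed (auto simp: h indicator_def)
  with hv have ae: "AE t in lebesgue. t \<in> {0<..<T} \<longrightarrow> v t = convolution (pk (- \<gamma>) \<delta>) g t"
    by eventually_elim simp
  have rg: "represents T g g" using g by (simp add: represents_def)
  have "AE t in lebesgue. t \<in> {0<..<T} \<longrightarrow> v t = prabhakar_integral \<rho> \<delta> \<omega> (- \<gamma>) g t"
    using ae by eventually_elim (use prabhakar_integral_eq_convolution[OF _ orders(2) rg] in auto)
  with represents_imp_L1[OF rg] show ?thesis unfolding range_condition_def \<delta> by blast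
qed

text \<open>Write \<open>v = v 0 * 1 + 1 * v'\<close>, the second product being a convolution.  The constant \<open>1\<close> is the
  kernel of order \<open>\<delta> + (1 - \<delta>)\<close> with parameter \<open>- \<gamma> + \<gamma>\<close>, and the semigroup law factors it.\<close>

lemma AC_density:
  fixes \<gamma> :: complex
  assumes v: "v \<in> AC T"
  defines "w \<equiv> \<lambda>t. v 0 * prabhakar_kernel \<rho> (1 - \<delta>) \<omega> \<gamma> t
    + prabhakar_integral \<rho> (1 - \<delta>) \<omega> \<gamma> (\<lambda>s. vector_derivative v (at s)) t"
  shows "w \<in> L1 T" and "\<And>t. t \<in> {0<..<T} \<Longrightarrow> v t = prabhakar_integral \<rho> \<delta> \<omega> (- \<gamma>) w t"
proof -
  obtain g where rep: "represents T g (\<lambda>s. vector_derivative v (at s))"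
    and vg: "\<And>t. t \<in> {0..T} \<Longrightarrow> v t = v 0 + (LINT s:{0..t}|lborel. g s)"
    using AC_vector_derivative[OF T v] by blast
  then have g: "integrable lborel g" "\<And>x. x \<notin> {0<..<T} \<Longrightarrow> g x = 0" by (auto simp: represents_def)
  have g0: "\<And>x. x \<le> 0 \<Longrightarrow> g x = 0" using g by simp
  have [measurable]: "g \<in> borel_measurable borel" using g by auto
  have d1: "1 - \<delta> > 0" "\<delta> + (1 - \<delta>) \<ge> 1" using orders by auto
  define u where "u t = v 0 * pk \<gamma> (1 - \<delta>) t + convolution (pk \<gamma> (1 - \<delta>)) g t" for t
  let ?h = "\<lambda>t. indicator {0<..<T} t *\<^sub>R u t"
  have wu: "w t = u t" if "t \<in> {0<..<T}" for t
    using prabhakar_integral_eq_convolution[OF _ d1(1) rep, of t \<gamma>] that by (simp add: w_def u_def pk_pos)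
  have "integrable lborel (\<lambda>t. v 0 * (indicator {0<..<T} t *\<^sub>R (indicator {..T} t *\<^sub>R pk \<gamma> (1 - \<delta>) t)) +
      indicator {0<..<T} t *\<^sub>R convolution (pk \<gamma> (1 - \<delta>)) g t)"
    by (intro Bochner_Integration.integrable_add integrable_mult_right integrable_mult_indicator
        integrable_truncated_pk integrable_truncated_convolution d1 g g0) simp
  moreover have "v 0 * (indicator {0<..<T} t *\<^sub>R (indicator {..T} t *\<^sub>R pk \<gamma> (1 - \<delta>) t)) +
      indicator {0<..<T} t *\<^sub>R convolution (pk \<gamma> (1 - \<delta>)) g t = ?h t" for t
    by (simp add: u_def indicator_def)
  ultimately have rw: "represents T ?h w" using wu by (simp add: represents_def)
  show "w \<in> L1 T" by (rule represents_imp_L1[OF rw])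
  fix t assume t: "t \<in> {0<..<T}"
  have "prabhakar_integral \<rho> \<delta> \<omega> (- \<gamma>) w t = convolution (pk (- \<gamma>) \<delta>) ?h t"
    by (rule prabhakar_integral_eq_convolution[OF _ orders(2) rw]) (use t in auto)
  also have "\<dots> = convolution (pk (- \<gamma>) \<delta>) u t"
  proof (rule convolution_cong)
    fix s assume "s < t"
    then show "?h s = u s" using t convolution_pk_supp[of g s] g0 by (cases "s \<le> 0") (auto simp: u_def pk_nonpos)
  qed (simp add: pk_nonpos)
  also have "\<dots> = v 0 * pk 0 1 t + convolution (pk 0 1) g t"
  proof -
    have "has_bochner_integral lborel (\<lambda>s. v 0 * (pk (- \<gamma>) \<delta> (t - s) * pk \<gamma> (1 - \<delta>) s) + pk (- \<gamma>) \<delta> (t - s) * convolution (pk \<gamma> (1 - \<delta>)) g s)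
       (v 0 * pk (- \<gamma> + \<gamma>) (\<delta> + (1 - \<delta>)) t + convolution (pk (- \<gamma> + \<gamma>) (\<delta> + (1 - \<delta>))) g t)"
      by (intro has_bochner_integral_add has_bochner_integral_mult_right pk_convolution pk_assoc orders d1 g g0)
    then show ?thesis
      unfolding convolution_def[of _ u] u_def by (simp add: has_bochner_integral_iff algebra_simps)
  qed
  also have "\<dots> = v t" using vg[of t] t convolution_pk_0_1[of g t] g0 by (simp add: pk_0_1)
  finally show "v t = prabhakar_integral \<rho> \<delta> \<omega> (- \<gamma>) w t" ..
qed

text \<open>The equation \<open>A u = f\<close>, where all perturbation terms vanish, has density \<open>f\<close>.\<close>

lemma continuous_in_resolvent_densities:
  assumes v: "continuous_on {0..T} v"
  shows "v \<in> resolvent_densities T (prabhakar_kernel \<rho> \<mu> \<omega> \<gamma>)"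
proof -
  let ?r = "prabhakar_kernel \<rho> \<mu> \<omega> \<gamma>" and ?z = "\<lambda>_ _. 0 :: complex" and ?B = "\<lambda>_ _ _. 0 :: complex"
  have z: "conv_op (\<lambda>_. 0) f t = 0" for f t by (simp add: conv_op_def set_lebesgue_integral_def)
  have ws: "weakly_singular T ?r"
  proof -
    have rep: "represents T (\<lambda>t. indicator {0<..<T} t *\<^sub>R (indicator {..T} t *\<^sub>R pk \<gamma> \<mu> t)) ?r"
      using integrable_mult_indicator[OF _ integrable_truncated_pk[OF orders(1), of T \<gamma>], of "{0<..<T}"]
      by (auto simp: represents_def pk_pos)
    obtain B where B: "B > 0" "\<And>x. x \<le> T \<Longrightarrow> cmod (pk \<gamma> \<mu> x) \<le> B * power_kernel \<mu> x"
      using pk_bound[OF orders(1) T] by metis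
    have "cmod (?r t) \<le> B * t powr (\<mu> - 1)" if "t \<in> {0<..<T}" for t
      using B(2)[of t] that by (simp add: pk_pos power_kernel_def)
    then have "AE t in lebesgue. t \<in> {0<..<T} \<longrightarrow> cmod (?r t) \<le> B * t powr (\<mu> - 1)" by simp
    with represents_imp_L1[OF rep] B(1) orders(1) show ?thesis unfolding weakly_singular_def by blast
  qed
  have inj: "x t = y t" if c: "continuous_on {0..T} x" "continuous_on {0..T} y"
    and eq: "\<forall>t\<in>{0..T}. conv_op ?r x t = conv_op ?r y t" and t: "t \<in> {0..T}" for x y t
  proof -
    note rx = continuous_represents[OF c(1)] and ry = continuous_represents[OF c(2)]
    have "AE s in lebesgue. indicator {0<..<T} s *\<^sub>R x s = indicator {0<..<T} s *\<^sub>R y s"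
    proof (rule convolution_pk_injective[where \<gamma> = \<gamma>])
      show "convolution (pk \<gamma> \<mu>) (\<lambda>s. indicator {0<..<T} s *\<^sub>R x s) t = convolution (pk \<gamma> \<mu>) (\<lambda>s. indicator {0<..<T} s *\<^sub>R y s) t"
        if "t \<in> {0..T}" for t
        using prabhakar_integral_eq_convolution[OF that orders(1) rx, of \<gamma>] prabhakar_integral_eq_convolution[OF that orders(1) ry, of \<gamma>] eq that
        by (simp add: prabhakar_integral_def)
    qed (use rx ry in \<open>auto simp: represents_def\<close>)
    then have "AE s in lebesgue. s \<in> {0<..<T} \<longrightarrow> x s = y s" by eventually_elim (auto simp: indicator_def)
    then show ?thesis by (rule continuous_AE_eq_imp_eq[OF T c _ t])
  qed
  have setting: "resolvent_setting T ?r 1 ?z ?B ?z ?z"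
    unfolding resolvent_setting_def linear_on_range_def
    using ws inj weakly_singular_zero z by (auto simp: case_prod_unfold)
  have GL0: "GL ?r 1 ?z ?z ?z = ?z"
    by (simp add: GL_def fun_eq_iff set_lebesgue_integral_def)
  have "iterated_kernel ?z n = ?z" for n
    by (induction n) (simp_all add: fun_eq_iff set_lebesgue_integral_def)
  then have "kernel_op (resolvent_kernel (GL ?r 1 ?z ?z ?z)) v t = 0" for t
    unfolding GL0 resolvent_kernel_def kernel_op_def set_lebesgue_integral_def by simp
  then have "\<forall>t\<in>{0..T}. v t = v t - kernel_op (resolvent_kernel (GL ?r 1 ?z ?z ?z)) v t" by simp
  with setting v show ?thesis unfolding resolvent_densities_def mem_Collect_eq by blast
qed

text \<open>The range condition would force the coefficient at the \<open>n\<close>-th frequency, which is \<open>T / 2 ^ n\<close>, to be at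
  most a multiple of \<open>(M powr (\<delta> / 2)) powr - n\<close>, and \<open>M\<close> is chosen so large that this is \<open>O(4 ^ - n)\<close>.\<close>

lemma lacunary_not_range_condition:
  obtains M where "\<not> range_condition T m \<rho> \<mu> \<omega> \<gamma> (lacunary T M)"
proof -
  define a where "a = \<delta> / 2"
  have a: "a > 0" using orders by (simp add: a_def)
  \<comment> \<open>large enough for \<open>M powr a \<ge> 4\<close>, and at least \<open>2\<close> to keep the frequencies distinct\<close>
  define M where "M = nat \<lceil>4 powr (1 / a)\<rceil> + 2"
  have M2: "M \<ge> 2" by (simp add: M_def)
  have "4 powr (1 / a) \<le> real M" unfolding M_def by linarith
  then have "(4 powr (1 / a)) powr a \<le> real M powr a" using a by (intro powr_mono2) auto
  then have M4: "4 \<le> real M powr a" using a by (simp add: powr_powr)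
  have "\<not> range_condition T m \<rho> \<mu> \<omega> \<gamma> (lacunary T M)"
  proof
    assume "range_condition T m \<rho> \<mu> \<omega> \<gamma> (lacunary T M)"
    then obtain w where w: "w \<in> L1 T" and ae: "AE t in lebesgue. t \<in> {0<..<T} \<longrightarrow> lacunary T M t = prabhakar_integral \<rho> \<delta> \<omega> (- \<gamma>) w t"
      unfolding range_condition_def \<delta> by blast
    obtain g where rep: "represents T g w" using L1_imp_represents[OF w] by blast
    then have g: "integrable lborel g" "\<And>x. x \<le> 0 \<Longrightarrow> g x = 0" by (auto simp: represents_def)
    have [measurable]: "g \<in> borel_measurable borel" "pk (- \<gamma>) \<delta> \<in> borel_measurable borel" "lacunary T M \<in> borel_measurable borel"
      using g borel_measurable_pk[OF orders(2)] borel_measurable_continuous_onI[OF continuous_lacunary] by auto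
    have "AE t in lebesgue. t \<in> {0<..<T} \<longrightarrow> lacunary T M t = convolution (pk (- \<gamma>) \<delta>) g t"
      using ae by eventually_elim (use prabhakar_integral_eq_convolution[OF _ orders(2) rep] in auto)
    then have ae': "AE t in lborel. t \<in> {0<..<T} \<longrightarrow> lacunary T M t = convolution (pk (- \<gamma>) \<delta>) g t"
      unfolding AE_completion_iff .
    have coeff: "convolution (oscillation T l) (convolution (pk (- \<gamma>) \<delta>) g) T = convolution (oscillation T l) (lacunary T M) T" for l
      unfolding convolution_def[of "oscillation T l"]
    proof (rule integral_cong_AE)
      show "AE s in lborel. oscillation T l (T - s) * convolution (pk (- \<gamma>) \<delta>) g s = oscillation T l (T - s) * lacunary T M s"
        using ae' by eventually_elim (auto simp: oscillation_def)
    qed measurable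
    obtain C where C: "\<And>l. l > 0 \<Longrightarrow> norm (convolution (oscillation T l) (convolution (pk (- \<gamma>) \<delta>) g) T) \<le> C * l powr - a"
      using fourier_decay[OF orders(2,3) g] unfolding a_def by metis
    define c where "c = (2 * pi / T) powr - a"
    have c: "c > 0" using T by (simp add: c_def)
    have bound: "T * 2 ^ n \<le> \<bar>C\<bar> * c" for n
    proof -
      let ?l = "2 * pi * real M ^ n / T"
      have l: "?l > 0" using T M2 by simp
      have "T / 2 ^ n \<le> C * ?l powr - a"
        using C[OF l] T unfolding coeff lacunary_fourier_coefficient[OF T M2] by (simp add: norm_divide norm_power)
      also have "\<dots> \<le> \<bar>C\<bar> * ?l powr - a" by (intro mult_right_mono) auto
      also have "?l powr - a = c * ((real M powr a) ^ n) powr - 1"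
      proof -
        have "?l powr - a = ((2 * pi / T) * (real M powr real n)) powr - a" using M2 by (simp add: powr_realpow)
        also have "\<dots> = c * (real M powr real n) powr - a" unfolding c_def by (rule powr_mult)
        also have "(real M powr real n) powr - a = ((real M powr a) ^ n) powr - 1"
          using M2 by (simp add: powr_powr powr_realpow[symmetric] powr_minus_divide mult.commute)
        finally show ?thesis .
      qed
      also have "\<dots> \<le> c * (1 / 4 ^ n)"
      proof -
        have "4 ^ n \<le> (real M powr a) ^ n" using M4 by (intro power_mono) auto
        then have "1 / (real M powr a) ^ n \<le> 1 / 4 ^ n" using M2 by (intro divide_left_mono) auto
        moreover have "((real M powr a) ^ n) powr - 1 = 1 / (real M powr a) ^ n" using M2 by (simp add: powr_minus_divide)
        ultimately show ?thesis using c by (intro mult_left_mono) auto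
      qed
      finally have "T / 2 ^ n \<le> \<bar>C\<bar> * (c * (1 / 4 ^ n))" by (simp add: mult_left_mono)
      moreover have "(4::real) ^ n = 2 ^ n * 2 ^ n" by (simp add: power_mult_distrib[symmetric])
      ultimately show ?thesis by (simp add: field_simps)
    qed
    obtain n where "\<bar>C\<bar> * c / T < 2 ^ n" using real_arch_pow[of 2 "\<bar>C\<bar> * c / T"] by auto
    then have "\<bar>C\<bar> * c < T * 2 ^ n" using T by (simp add: field_simps)
    with bound[of n] show False by simp
  qed
  then show ?thesis by (rule that)
qed

end

end

lemma continuous_imp_L1: "continuous_on {0..T} v \<Longrightarrow> v \<in> L1 T"
  using continuous_represents represents_imp_L1 by blast

section \<open>Absolutely continuous and continuous densities\<close>

theorem corollary7:
  fixes T \<rho> \<mu> \<delta> :: real and \<gamma> \<omega> :: complex and m :: nat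
  assumes "T > 0" and "m \<ge> 1" and "real m - 1 < \<mu>" and "\<mu> < real m" and "\<rho> > 0"
    and "\<delta> = real m - \<mu>"
  shows "(\<forall>v\<in>AC T.
            prabhakar_integral \<rho> \<mu> \<omega> \<gamma> v \<in> AC0 T m \<and>
            (let w = (\<lambda>t. v 0 * prabhakar_kernel \<rho> (1 - \<delta>) \<omega> \<gamma> t
                        + prabhakar_integral \<rho> (1 - \<delta>) \<omega> \<gamma> (\<lambda>s. vector_derivative v (at s)) t)
             in w \<in> L1 T \<and>
                (AE t in lebesgue. t \<in> {0<..<T} \<longrightarrow>
                   v t = prabhakar_integral \<rho> \<delta> \<omega> (- \<gamma>) w t)))
       \<and> (\<forall>v. continuous_on {0..T} v \<longrightarrow>
            (range_condition T m \<rho> \<mu> \<omega> \<gamma> v \<longleftrightarrow> prabhakar_integral \<rho> \<mu> \<omega> \<gamma> v \<in> AC0 T m))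
       \<and> (\<forall>v\<in>AC T. range_condition T m \<rho> \<mu> \<omega> \<gamma> v)
       \<and> (\<exists>v\<in>resolvent_densities T (prabhakar_kernel \<rho> \<mu> \<omega> \<gamma>).
            \<not> range_condition T m \<rho> \<mu> \<omega> \<gamma> v)"
proof -
  interpret prabhakar \<rho> \<omega> by unfold_locales (rule assms(5))
  note data = assms(1-4,6)
  let ?w = "\<lambda>v t. v 0 * prabhakar_kernel \<rho> (1 - \<delta>) \<omega> \<gamma> t
    + prabhakar_integral \<rho> (1 - \<delta>) \<omega> \<gamma> (\<lambda>s. vector_derivative v (at s)) t"
  have w: "?w v \<in> L1 T \<and> (AE t in lebesgue. t \<in> {0<..<T} \<longrightarrow> v t = prabhakar_integral \<rho> \<delta> \<omega> (- \<gamma>) (?w v) t)"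
    if "v \<in> AC T" for v
    using AC_density[OF data that] by (intro conjI AE_I2 impI) auto
  then have rc: "range_condition T m \<rho> \<mu> \<omega> \<gamma> v" if "v \<in> AC T" for v
    unfolding range_condition_def assms(6)[symmetric] using that by blast
  have ac: "prabhakar_integral \<rho> \<mu> \<omega> \<gamma> v \<in> AC0 T m" if "v \<in> AC T" for v
    by (rule range_condition_imp_AC0[OF data rc[OF that]])
  have iff: "range_condition T m \<rho> \<mu> \<omega> \<gamma> v \<longleftrightarrow> prabhakar_integral \<rho> \<mu> \<omega> \<gamma> v \<in> AC0 T m"
    if "continuous_on {0..T} v" for v
    using range_condition_imp_AC0[OF data] AC0_imp_range_condition[OF data continuous_imp_L1[OF that]] by blast
  obtain M where "\<not> range_condition T m \<rho> \<mu> \<omega> \<gamma> (lacunary T M)"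
    using lacunary_not_range_condition[OF data] by blast
  moreover have "lacunary T M \<in> resolvent_densities T (prabhakar_kernel \<rho> \<mu> \<omega> \<gamma>)"
    by (rule continuous_in_resolvent_densities[OF data continuous_lacunary])
  ultimately show ?thesis using w rc ac iff unfolding Let_def by blast
qed

end
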